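(* Let $\Sigma$ be a finite subset of $\mathbb C^*$. The local groupoids $G^{(0)}$ at $0$ and $G^{(\infty)}$ at $\infty$, together with the paths $\Gamma_{z_0}$, $z_0\in\mathbb C^*\setminus q^{\mathbb Z}\Sigma$, generate a Zariski-dense subgroupoid of the Galois groupoid of $\mathcal C_\Sigma$.
   Context: Fix $q\in\mathbb C$, $|q|>1$; $(\sigma_qF)(z)=F(qz)$. $\mathbb C_\infty$ is the Riemann sphere minus $0$; $\mathcal M(U)$ denotes meromorphic functions on $U$. Category $\mathcal C$: objects are triples $(A^{(0)},M,A^{(\infty)})$ with $A^{(0)},A^{(\infty)}\in GL_n(\mathbb C)$, $M\in GL_n(\mathcal M(\mathbb C^* ))$ and $(\sigma_qM)A^{(0)}=A^{(\infty)}M$. Morphisms $(A^{(0)},M,A^{(\infty)})\to(B^{(0)},N,B^{(\infty)})$ (of ranks $n$, $p$) are pairs $(S^{(0)},S^{(\infty)})$ with $S^{(0)}\in M_{p,n}(\mathcal M(\mathbb C))$, $S^{(\infty)}\in M_{p,n}(\mathcal M(\mathbb C_\infty))$, $(\sigma_qS^{(0)})A^{(0)}=B^{(0)}S^{(0)}$, $(\sigma_qS^{(\infty)})A^{(\infty)}=B^{(\infty)}S^{(\infty)}$, $S^{(\infty)}M=NS^{(0)}$. (Such $S^{(0)},S^{(\infty)}$ automatically have Laurent polynomial entries.) Tensor products are componentwise Kronecker products. With $\mathcal S(M)=\{\text{poles of }M\}\cup\{\text{poles of }M^{-1}\}$, $\mathcal C_\Sigma$ is the full (tannakian) subcategory of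 triples with $\mathcal S(M)\subset q^{\mathbb Z}\Sigma$. Local categories: $\mathcal P^{(0)}$ (resp. $\mathcal P^{(\infty)}$) has as objects the matrices $A\in GL_n(\mathbb C)$ and as morphisms $A\to B$ the matrices $S$ with entries in $\mathcal M(\mathbb C)$ (resp. $\mathcal M(\mathbb C_\infty)$) such that $(\sigma_qS)A=BS$. For $a\in\mathbb C^*$, $\omega^{(0)}_a$ on $\mathcal P^{(0)}$ (resp. $\omega^{(\infty)}_a$ on $\mathcal P^{(\infty)}$) is the fibre functor $A\mapsto\mathbb C^n$, $S\mapsto S(a)$. The local groupoid $G^{(0)}$ (resp. $G^{(\infty)}$) has base set $\mathbb C^*$ and arrows $G^{(0)}(a,b)=\mathrm{Iso}^{\otimes}(\omega^{(0)}_a,\omega^{(0)}_b)$ (resp. $G^{(\infty)}(a,b)=\mathrm{Iso}^{\otimes}(\omega^{(\infty)}_a,\omega^{(\infty)}_b)$), taken on $\mathcal P^{(0)}$ (resp. $\mathcal P^{(\infty)}$). Composing with the projections $(A^{(0)},M,A^{(\infty)})\mapsto A^{(0)}$, $A^{(\infty)}$, the $\omega^{(0)}_a$, $\omega^{(\infty)}_a$ become fibre functors on $\mathcal C_\Sigma$, still denoted in the same way, and the arrows of $G^{(0)}$, $G^{(\infty)}$ induce tensor isomorphisms between them. The Galois groupoid of $\mathcal C_\Sigma$ has base set $\{\omega^{(0)}_a\;:\;a\in\mathbb C^*\}\amalg\{\omega^{(\infty)}_a\;:\;a\in\mathbb C^*\}$, and its arrows from one of these fibre functors on $\mathcal C_\Sigma$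 to another are the tensor isomorphisms ($\mathrm{Iso}^\otimes$). For $z_0\notin q^{\mathbb Z}\Sigma$, $\Gamma_{z_0}\in\mathrm{Iso}^{\otimes}(\omega^{(0)}_{z_0},\omega^{(\infty)}_{z_0})$ is given by $(A^{(0)},M,A^{(\infty)})\mapsto M(z_0)$. Each set $\mathrm{Iso}^\otimes(\omega',\omega'')$ carries the Zariski topology of its proalgebraic structure: closed sets are those defined by polynomial conditions on the matrices $h(\mathcal X)\in GL_n(\mathbb C)$ through which $h$ acts on the objects $\mathcal X$. A subgroupoid with the same base set is Zariski-dense if, for any two base points, its set of arrows between them is Zariski-dense in the set of all arrows between them. *)

theory Defs
  imports
    "HOL-Complex_Analysis.Complex_Analysis"
    "Jordan_Normal_Form.Matrix"
begin

no_notation fps_nth (infixl \<open>$\<close> 75)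
no_notation fls_nth (infixl \<open>$$\<close> 75)
no_notation eq_closure_of (\<open>closure'_of\<index>\<close>)

section \<open>The field of meromorphic functions on the punctured plane\<close>

text \<open>
  A meromorphic function on \<open>- {0}\<close> is a class of functions that are meromorphic there in the
  sense of the library, two of them being identified if they agree off a sparse subset.
\<close>

quotient_type mero = "complex \<Rightarrow> complex" / partial:
  "\<lambda>f g. f meromorphic_on - {0} \<and> g meromorphic_on - {0} \<and> (\<forall>\<^sub>\<approx>z\<in>- {0}. f z = g z)"
proof (rule part_equivpI)
  show "\<exists>f::complex \<Rightarrow> complex. f meromorphic_on - {0} \<and> f meromorphic_on - {0} \<and>
      (\<forall>\<^sub>\<approx>z\<in>- {0}. f z = f z)"
    by (intro exI[of _ "\<lambda>_. 0"]) (auto intro: meromorphic_intros)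
  show "symp (\<lambda>f g. f meromorphic_on - {0} \<and> g meromorphic_on - {0} \<and>
      (\<forall>\<^sub>\<approx>z\<in>- {0}. f z = g z))"
    by (rule sympI) (auto elim: eventually_mono)
  show "transp (\<lambda>f g. f meromorphic_on - {0} \<and> g meromorphic_on - {0} \<and>
      (\<forall>\<^sub>\<approx>z\<in>- {0}. f z = g z))"
    by (rule transpI) (auto elim: eventually_elim2)
qed

instantiation mero :: field
begin

lift_definition zero_mero :: mero is "\<lambda>_. 0"
  by (auto intro: meromorphic_intros)

lift_definition one_mero :: mero is "\<lambda>_. 1"
  by (auto intro: meromorphic_intros)

lift_definition plus_mero :: "mero \<Rightarrow> mero \<Rightarrow> mero" is "\<lambda>f g z. f z + g z"
  by (auto intro!: meromorphic_intros elim: eventually_elim2)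

lift_definition minus_mero :: "mero \<Rightarrow> mero \<Rightarrow> mero" is "\<lambda>f g z. f z - g z"
  by (auto intro!: meromorphic_intros elim: eventually_elim2)

lift_definition uminus_mero :: "mero \<Rightarrow> mero" is "\<lambda>f z. - f z"
  by (auto intro!: meromorphic_intros elim: eventually_mono)

lift_definition times_mero :: "mero \<Rightarrow> mero \<Rightarrow> mero" is "\<lambda>f g z. f z * g z"
  by (auto intro!: meromorphic_intros elim: eventually_elim2)

lift_definition inverse_mero :: "mero \<Rightarrow> mero" is "\<lambda>f z. inverse (f z)"
  by (auto intro!: meromorphic_intros elim: eventually_mono)

lift_definition divide_mero :: "mero \<Rightarrow> mero \<Rightarrow> mero" is "\<lambda>f g z. f z / g z"
  by (auto intro!: meromorphic_intros elim: eventually_elim2)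

instance
proof
  fix a b c :: mero
  show "a * b * c = a * (b * c)" "a * b = b * a" "1 * a = a"
    "a + b + c = a + (b + c)" "a + b = b + a" "0 + a = a" "- a + a = 0" "a - b = a + - b"
    "(a + b) * c = a * c + b * c"
    by (transfer; auto intro!: meromorphic_intros simp: algebra_simps)+
  show "0 \<noteq> (1::mero)"
  proof (transfer)
    have "- {0::complex} \<noteq> {}"
      using one_neq_zero by blast
    then show "\<not> ((\<lambda>_. 0::complex) meromorphic_on - {0} \<and> (\<lambda>_. 1::complex) meromorphic_on - {0} \<and>
        (\<forall>\<^sub>\<approx>z\<in>- {0::complex}. (0::complex) = 1))"
      by simp
  qed
  show "a \<noteq> 0 \<Longrightarrow> inverse a * a = 1"
  proof (transfer)
    fix f :: "complex \<Rightarrow> complex"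
    assume f: "f meromorphic_on - {0} \<and> f meromorphic_on - {0} \<and> (\<forall>\<^sub>\<approx>z\<in>- {0}. f z = f z)"
      and nz: "\<not> (f meromorphic_on - {0} \<and> (\<lambda>_. 0) meromorphic_on - {0} \<and>
        (\<forall>\<^sub>\<approx>z\<in>- {0}. f z = 0))"
    have "connected (- {0::complex})"
      by (intro connected_punctured_universe) simp
    then have "\<forall>\<^sub>\<approx>z\<in>- {0}. f z \<noteq> 0"
      using meromorphic_imp_constant_or_avoid[of f "- {0}" 0] f nz
      by (auto intro: meromorphic_intros)
    then show "(\<lambda>z. inverse (f z) * f z) meromorphic_on - {0} \<and> (\<lambda>_. 1) meromorphic_on - {0} \<and>
        (\<forall>\<^sub>\<approx>z\<in>- {0}. inverse (f z) * f z = 1)"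
      using f by (auto intro!: meromorphic_intros elim: eventually_mono)
  qed
  show "a div b = a * inverse b"
    by (transfer; auto intro!: meromorphic_intros simp: field_simps)
  show "inverse (0::mero) = 0"
    by (transfer; auto intro!: meromorphic_intros)
qed

end

lift_definition mero_const :: "complex \<Rightarrow> mero" is "\<lambda>c _. c"
  by (auto intro: meromorphic_intros)

lemma eventually_at_punctured:
  assumes "\<forall>\<^sub>\<approx>z\<in>- {0::complex}. P z" "z \<noteq> 0"
  shows "eventually P (at z)"
proof -
  have "z \<in> - {0}" using assms(2) by simp
  then show ?thesis
    using assms(1) unfolding eventually_cosparse_open_eq[OF open_Compl[OF closed_singleton]] by blast
qed

lemma eventually_cosparse_scale:
  fixes q :: complex
  assumes "q \<noteq> 0" "\<forall>\<^sub>\<approx>z\<in>- {0}. P z"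
  shows "\<forall>\<^sub>\<approx>z\<in>- {0}. P (q * z)"
  unfolding eventually_cosparse_open_eq[OF open_Compl[OF closed_singleton]]
proof
  fix z :: complex assume "z \<in> - {0}"
  then have "eventually P (at (q * z))"
    using assms by (intro eventually_at_punctured) simp_all
  moreover have "((\<lambda>z. q * z) \<longlongrightarrow> q * z) (at z)"
    by (intro tendsto_intros)
  then have "filterlim (\<lambda>z. q * z) (at (q * z)) (at z)"
    unfolding filterlim_at using assms(1) by (simp add: eventually_at_filter)
  ultimately show "\<forall>\<^sub>F x in at z. P (q * x)"
    unfolding filterlim_iff by blast
qed

text \<open>The operator \<open>f \<mapsto> f (q \<cdot> _)\<close>; the value for \<open>q = 0\<close> is a dummy.\<close>

lift_definition mero_shift :: "complex \<Rightarrow> mero \<Rightarrow> mero" is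
  "\<lambda>q f. if q = 0 then f else (\<lambda>z. f (q * z))"
proof -
  fix q :: complex and f g :: "complex \<Rightarrow> complex"
  assume *: "f meromorphic_on - {0} \<and> g meromorphic_on - {0} \<and> (\<forall>\<^sub>\<approx>z\<in>- {0}. f z = g z)"
  have "(\<lambda>z. h (q * z)) meromorphic_on - {0}" if "h meromorphic_on - {0}" "q \<noteq> 0" for h
    by (rule meromorphic_on_compose[OF that(1)]) (use that in \<open>auto intro!: analytic_intros\<close>)
  then show "(if q = 0 then f else (\<lambda>z. f (q * z))) meromorphic_on - {0} \<and>
      (if q = 0 then g else (\<lambda>z. g (q * z))) meromorphic_on - {0} \<and>
      (\<forall>\<^sub>\<approx>z\<in>- {0}. (if q = 0 then f else (\<lambda>z. f (q * z))) z =
         (if q = 0 then g else (\<lambda>z. g (q * z))) z)"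
    using * eventually_cosparse_scale[of q "\<lambda>z. f z = g z"] by (cases "q = 0") simp_all
qed

text \<open>
  Value and poles at points of \<open>- {0}\<close>. A representative is only determined off a sparse set, so
  its value at \<open>z\<close> is replaced by its limit at \<open>z\<close> (and by the dummy \<open>0\<close> at a pole, and at \<open>z = 0\<close>).
\<close>

lift_definition mero_eval :: "mero \<Rightarrow> complex \<Rightarrow> complex" is
  "\<lambda>f z. if z = 0 then 0 else remove_sings f z"
proof -
  fix f g :: "complex \<Rightarrow> complex"
  assume *: "f meromorphic_on - {0} \<and> g meromorphic_on - {0} \<and> (\<forall>\<^sub>\<approx>z\<in>- {0}. f z = g z)"
  have "remove_sings f z = remove_sings g z" if "z \<noteq> 0" for z
    by (rule remove_sings_cong[OF eventually_at_punctured refl]) (use * that in blast)+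
  then show "(\<lambda>z. if z = 0 then 0 else remove_sings f z) =
      (\<lambda>z. if z = 0 then 0 else remove_sings g z)"
    by (intro ext) simp
qed

lift_definition mero_pole :: "mero \<Rightarrow> complex \<Rightarrow> bool" is
  "\<lambda>f z. z \<noteq> 0 \<and> is_pole f z"
proof -
  fix f g :: "complex \<Rightarrow> complex"
  assume *: "f meromorphic_on - {0} \<and> g meromorphic_on - {0} \<and> (\<forall>\<^sub>\<approx>z\<in>- {0}. f z = g z)"
  have "is_pole f z = is_pole g z" if "z \<noteq> 0" for z
    by (rule is_pole_cong[OF eventually_at_punctured refl]) (use * that in blast)+
  then show "(\<lambda>z. z \<noteq> 0 \<and> is_pole f z) = (\<lambda>z. z \<noteq> 0 \<and> is_pole g z)"
    by blast
qed

text \<open>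
  The meromorphic functions on the plane, and those on the Riemann sphere minus \<open>0\<close>, as subfields
  of \<^typ>\<open>mero\<close> (restriction to \<open>- {0}\<close> is injective).
\<close>

lift_definition mero_plane :: "mero \<Rightarrow> bool" is
  "\<lambda>f. \<exists>g. g meromorphic_on UNIV \<and> (\<forall>\<^sub>\<approx>z\<in>- {0}. f z = g z)"
  by (safe; rule exI, intro conjI, assumption, erule (1) eventually_elim2, simp)

lift_definition mero_sphere_minus_0 :: "mero \<Rightarrow> bool" is
  "\<lambda>f. \<exists>g. g meromorphic_on - {0} \<and> (\<lambda>w. g (inverse w)) meromorphic_on {0} \<and>
         (\<forall>\<^sub>\<approx>z\<in>- {0}. f z = g z)"
  by (safe; rule exI, intro conjI, assumption, assumption, erule (1) eventually_elim2, simp)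


section \<open>Matrices\<close>

definition GL :: "nat \<Rightarrow> 'a::comm_ring_1 mat set" where
  "GL n = {A \<in> carrier_mat n n. invertible_mat A}"

definition mat_inv :: "'a::comm_ring_1 mat \<Rightarrow> 'a mat" where
  "mat_inv A = (THE B. inverts_mat A B \<and> inverts_mat B A)"

lemma mat_inv_eqI:
  assumes "inverts_mat A B" "inverts_mat B A"
  shows "mat_inv A = B"
  unfolding mat_inv_def
proof (rule the_equality)
  fix C assume C: "inverts_mat A C \<and> inverts_mat C A"
  have dims: "dim_row D = dim_col A" "dim_col D = dim_row A"
    if "inverts_mat A D" "inverts_mat D A" for D
    using arg_cong[OF that(1)[unfolded inverts_mat_def], of dim_col]
      arg_cong[OF that(2)[unfolded inverts_mat_def], of dim_col] by simp_all
  define n m where "n = dim_row A" and "m = dim_col A"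
  have car: "A \<in> carrier_mat n m" "B \<in> carrier_mat m n" "C \<in> carrier_mat m n"
    using dims[OF assms] dims[OF conjunct1[OF C] conjunct2[OF C]]
    unfolding n_def m_def carrier_mat_def by simp_all
  have AB: "A * B = 1\<^sub>m n" and CA: "C * A = 1\<^sub>m m"
    using assms C car unfolding inverts_mat_def by auto
  have "C = C * (A * B)"
    unfolding AB using car(3) by simp
  also have "\<dots> = (C * A) * B"
    by (rule assoc_mult_mat[symmetric]) (rule car)+
  also have "\<dots> = B"
    unfolding CA using car(2) by simp
  finally show "C = B" .
qed (use assms in blast)

definition kronecker :: "'a::times mat \<Rightarrow> 'a mat \<Rightarrow> 'a mat" where
  "kronecker A B = Matrix.mat (dim_row A * dim_row B) (dim_col A * dim_col B)
     (\<lambda>(i, j). A $$ (i div dim_row B, j div dim_col B) * B $$ (i mod dim_row B, j mod dim_col B))"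

abbreviation eval_mat :: "complex \<Rightarrow> mero mat \<Rightarrow> complex mat" where
  "eval_mat a \<equiv> map_mat (\<lambda>f. mero_eval f a)"

abbreviation shift_mat :: "complex \<Rightarrow> mero mat \<Rightarrow> mero mat" where
  "shift_mat q \<equiv> map_mat (mero_shift q)"

abbreviation const_mat :: "complex mat \<Rightarrow> mero mat" where
  "const_mat \<equiv> map_mat mero_const"

definition poles_mat :: "mero mat \<Rightarrow> complex set" where
  "poles_mat M = {z. \<exists>f \<in> elements_mat M. mero_pole f z}"


section \<open>Fibre functors and tensor isomorphisms\<close>

text \<open>
  Only the data entering the definition of a tensor isomorphism is recorded. A fibre functor
  sends an object \<open>X\<close> to \<open>\<complex>\<^sup>n\<close> with \<open>n = fib_dim F X\<close>, and
  \<open>\<complex>\<^sup>n \<otimes> \<complex>\<^sup>p\<close> is identified with \<open>\<complex>\<^sup>n\<^sup>p\<close> as in \<^const>\<open>kronecker\<close>.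
\<close>

record ('o, 'm) tensor_cat =
  Obj :: "'o set"
  Hom :: "'o \<Rightarrow> 'o \<Rightarrow> 'm set"
  tensor :: "'o \<Rightarrow> 'o \<Rightarrow> 'o"
  unit_obj :: 'o

record ('o, 'm) fibre_functor =
  fib_dim :: "'o \<Rightarrow> nat"
  fib_map :: "'m \<Rightarrow> complex mat"

definition Iso_tensor ::
  "('o, 'm) tensor_cat \<Rightarrow> ('o, 'm) fibre_functor \<Rightarrow> ('o, 'm) fibre_functor \<Rightarrow>
     ('o \<Rightarrow> complex mat) set" where
  "Iso_tensor C F G = {h \<in> extensional (Obj C).
     (\<forall>X \<in> Obj C. h X \<in> carrier_mat (fib_dim G X) (fib_dim F X) \<and> invertible_mat (h X)) \<and>
     (\<forall>X \<in> Obj C. \<forall>Y \<in> Obj C. \<forall>f \<in> Hom C X Y. fib_map G f * h X = h Y * fib_map F f) \<and>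
     (\<forall>X \<in> Obj C. \<forall>Y \<in> Obj C. h (tensor C X Y) = kronecker (h X) (h Y)) \<and>
     h (unit_obj C) = 1\<^sub>m 1}"

definition id_iso ::
  "('o, 'm) tensor_cat \<Rightarrow> ('o, 'm) fibre_functor \<Rightarrow> 'o \<Rightarrow> complex mat" where
  "id_iso C F = restrict (\<lambda>X. 1\<^sub>m (fib_dim F X)) (Obj C)"

definition comp_iso ::
  "('o, 'm) tensor_cat \<Rightarrow> ('o \<Rightarrow> complex mat) \<Rightarrow> ('o \<Rightarrow> complex mat) \<Rightarrow> 'o \<Rightarrow> complex mat" where
  "comp_iso C h g = restrict (\<lambda>X. h X * g X) (Obj C)"

definition inv_iso ::
  "('o, 'm) tensor_cat \<Rightarrow> ('o \<Rightarrow> complex mat) \<Rightarrow> 'o \<Rightarrow> complex mat" where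
  "inv_iso C h = restrict (\<lambda>X. mat_inv (h X)) (Obj C)"


subsection \<open>The Zariski topology\<close>

inductive_set poly_functions ::
  "('o, 'm) tensor_cat \<Rightarrow> ('o, 'm) fibre_functor \<Rightarrow> ('o, 'm) fibre_functor \<Rightarrow>
     (('o \<Rightarrow> complex mat) \<Rightarrow> complex) set"
  for C F G where
  const: "(\<lambda>_. c) \<in> poly_functions C F G"
| entry: "X \<in> Obj C \<Longrightarrow> i < fib_dim G X \<Longrightarrow> j < fib_dim F X \<Longrightarrow>
    (\<lambda>h. h X $$ (i, j)) \<in> poly_functions C F G"
| add: "p \<in> poly_functions C F G \<Longrightarrow> r \<in> poly_functions C F G \<Longrightarrow>
    (\<lambda>h. p h + r h) \<in> poly_functions C F G"
| mult: "p \<in> poly_functions C F G \<Longrightarrow> r \<in> poly_functions C F G \<Longrightarrow>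
    (\<lambda>h. p h * r h) \<in> poly_functions C F G"

definition zero_locus ::
  "('o, 'm) tensor_cat \<Rightarrow> ('o, 'm) fibre_functor \<Rightarrow> ('o, 'm) fibre_functor \<Rightarrow>
     (('o \<Rightarrow> complex mat) \<Rightarrow> complex) set \<Rightarrow> ('o \<Rightarrow> complex mat) set" where
  "zero_locus C F G P = {h \<in> Iso_tensor C F G. \<forall>p \<in> P. p h = 0}"

definition zariski_topology ::
  "('o, 'm) tensor_cat \<Rightarrow> ('o, 'm) fibre_functor \<Rightarrow> ('o, 'm) fibre_functor \<Rightarrow>
     ('o \<Rightarrow> complex mat) topology" where
  "zariski_topology C F G = topology (\<lambda>U. U \<subseteq> Iso_tensor C F G \<and>
     (\<exists>P \<subseteq> poly_functions C F G. Iso_tensor C F G - U = zero_locus C F G P))"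

lemma istopology_zariski:
  "istopology (\<lambda>U. U \<subseteq> Iso_tensor C F G \<and>
     (\<exists>P \<subseteq> poly_functions C F G. Iso_tensor C F G - U = zero_locus C F G P))"
  unfolding istopology_def
proof (intro conjI allI impI)
  let ?I = "Iso_tensor C F G" and ?R = "poly_functions C F G" and ?V = "zero_locus C F G"
  fix S T
  assume S: "S \<subseteq> ?I \<and> (\<exists>P \<subseteq> ?R. ?I - S = ?V P)" and T: "T \<subseteq> ?I \<and> (\<exists>P \<subseteq> ?R. ?I - T = ?V P)"
  then show "S \<inter> T \<subseteq> ?I" by blast
  from S T obtain P Q where PQ: "P \<subseteq> ?R" "?I - S = ?V P" "Q \<subseteq> ?R" "?I - T = ?V Q" by blast
  let ?PQ = "(\<lambda>(p, r) h. p h * r h) ` (P \<times> Q)"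
  have "?V P \<union> ?V Q = ?V ?PQ"
    by (auto simp: zero_locus_def)
  then have "?I - S \<inter> T = ?V ?PQ"
    using PQ by (simp add: Diff_Int)
  moreover have "?PQ \<subseteq> ?R"
    using PQ by (auto intro!: poly_functions.mult)
  ultimately show "\<exists>P \<subseteq> ?R. ?I - S \<inter> T = ?V P" by blast
next
  let ?I = "Iso_tensor C F G" and ?R = "poly_functions C F G" and ?V = "zero_locus C F G"
  fix K assume K: "\<forall>U \<in> K. U \<subseteq> ?I \<and> (\<exists>P \<subseteq> ?R. ?I - U = ?V P)"
  then show "\<Union>K \<subseteq> ?I" by blast
  from K obtain P where P: "\<And>U. U \<in> K \<Longrightarrow> P U \<subseteq> ?R \<and> ?I - U = ?V (P U)" by metis
  have "?V (\<Union>(P ` K)) = ?I - \<Union>K"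
  proof (intro equalityI subsetI)
    fix h assume "h \<in> ?V (\<Union>(P ` K))"
    then have "h \<in> ?I" "\<And>U. U \<in> K \<Longrightarrow> h \<in> ?V (P U)" by (auto simp: zero_locus_def)
    then show "h \<in> ?I - \<Union>K" using P by blast
  next
    fix h assume h: "h \<in> ?I - \<Union>K"
    then have "\<And>U. U \<in> K \<Longrightarrow> h \<in> ?V (P U)" using P by blast
    then show "h \<in> ?V (\<Union>(P ` K))" using h by (auto simp: zero_locus_def)
  qed
  then show "\<exists>P \<subseteq> ?R. ?I - \<Union>K = ?V P"
    using P by (intro exI[of _ "\<Union>(P ` K)"]) blast
qed

lemma topspace_zariski [simp]: "topspace (zariski_topology C F G) = Iso_tensor C F G"
proof -
  have "openin (zariski_topology C F G) (Iso_tensor C F G)"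
    unfolding zariski_topology_def topology_inverse'[OF istopology_zariski]
    by (auto simp: zero_locus_def intro!: exI[of _ "{\<lambda>_. 1}"] poly_functions.const)
  moreover have "\<And>U. openin (zariski_topology C F G) U \<Longrightarrow> U \<subseteq> Iso_tensor C F G"
    unfolding zariski_topology_def topology_inverse'[OF istopology_zariski] by blast
  ultimately show ?thesis
    by (auto simp: topspace_def)
qed

lemma closedin_zariski:
  "closedin (zariski_topology C F G) Z \<longleftrightarrow>
     (\<exists>P \<subseteq> poly_functions C F G. Z = zero_locus C F G P)"
proof -
  let ?I = "Iso_tensor C F G" and ?R = "poly_functions C F G" and ?V = "zero_locus C F G"
  have sub: "?V P \<subseteq> ?I" for P
    unfolding zero_locus_def by (rule Collect_restrict)
  have iff: "closedin (zariski_topology C F G) Z \<longleftrightarrow>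
      Z \<subseteq> ?I \<and> ?I - Z \<subseteq> ?I \<and> (\<exists>P \<subseteq> ?R. ?I - (?I - Z) = ?V P)"
    unfolding closedin_def topspace_zariski
    unfolding zariski_topology_def topology_inverse'[OF istopology_zariski] ..
  show ?thesis
  proof
    assume "closedin (zariski_topology C F G) Z"
    then obtain P where P: "Z \<subseteq> ?I" "P \<subseteq> ?R" "?I - (?I - Z) = ?V P"
      unfolding iff by (elim conjE exE)
    have "Z = ?V P"
      using P(1,3) by (simp only: double_diff[OF P(1) subset_refl])
    with P(2) show "\<exists>P \<subseteq> ?R. Z = ?V P" by (intro exI conjI)
  next
    assume "\<exists>P \<subseteq> ?R. Z = ?V P"
    then obtain P where P: "P \<subseteq> ?R" "Z = ?V P" by (elim conjE exE)
    have Z: "Z \<subseteq> ?I" unfolding P(2) by (rule sub)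
    have "?I - (?I - Z) = ?V P"
      unfolding double_diff[OF Z subset_refl] by (rule P(2))
    with Z P(1) show "closedin (zariski_topology C F G) Z"
      unfolding iff by (intro exI conjI Diff_subset)
  qed
qed


subsection \<open>Groupoids of tensor isomorphisms\<close>

text \<open>
  A groupoid on the set \<open>B\<close> of base points, the base point \<open>x\<close> standing for the fibre functor \<open>F x\<close>;
  \<open>H x y\<close> is its set of arrows from \<open>x\<close> to \<open>y\<close>. The groupoid of all tensor isomorphisms has
  arrows \<open>Iso_tensor C (F x) (F y)\<close>.
\<close>

definition subgroupoid ::
  "('o, 'm) tensor_cat \<Rightarrow> ('b \<Rightarrow> ('o, 'm) fibre_functor) \<Rightarrow> 'b set \<Rightarrow>
     ('b \<Rightarrow> 'b \<Rightarrow> ('o \<Rightarrow> complex mat) set) \<Rightarrow> bool" where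
  "subgroupoid C F B H \<longleftrightarrow>
     (\<forall>x \<in> B. \<forall>y \<in> B. H x y \<subseteq> Iso_tensor C (F x) (F y)) \<and>
     (\<forall>x \<in> B. id_iso C (F x) \<in> H x x) \<and>
     (\<forall>x \<in> B. \<forall>y \<in> B. \<forall>z \<in> B. \<forall>g \<in> H x y. \<forall>h \<in> H y z. comp_iso C h g \<in> H x z) \<and>
     (\<forall>x \<in> B. \<forall>y \<in> B. \<forall>h \<in> H x y. inv_iso C h \<in> H y x)"

definition zariski_dense_subgroupoid ::
  "('o, 'm) tensor_cat \<Rightarrow> ('b \<Rightarrow> ('o, 'm) fibre_functor) \<Rightarrow> 'b set \<Rightarrow>
     ('b \<Rightarrow> 'b \<Rightarrow> ('o \<Rightarrow> complex mat) set) \<Rightarrow> bool" where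
  "zariski_dense_subgroupoid C F B H \<longleftrightarrow> subgroupoid C F B H \<and>
     (\<forall>x \<in> B. \<forall>y \<in> B.
        zariski_topology C (F x) (F y) closure_of H x y = Iso_tensor C (F x) (F y))"

inductive_set generated ::
  "('o, 'm) tensor_cat \<Rightarrow> ('b \<Rightarrow> ('o, 'm) fibre_functor) \<Rightarrow> 'b set \<Rightarrow>
     ('b \<Rightarrow> 'b \<Rightarrow> ('o \<Rightarrow> complex mat) set) \<Rightarrow> ('b \<times> 'b \<times> ('o \<Rightarrow> complex mat)) set"
  for C F B gens where
  gen: "x \<in> B \<Longrightarrow> y \<in> B \<Longrightarrow> h \<in> gens x y \<Longrightarrow> (x, y, h) \<in> generated C F B gens"
| ident: "x \<in> B \<Longrightarrow> (x, x, id_iso C (F x)) \<in> generated C F B gens"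
| comp: "(x, y, g) \<in> generated C F B gens \<Longrightarrow> (y, z, h) \<in> generated C F B gens \<Longrightarrow>
    (x, z, comp_iso C h g) \<in> generated C F B gens"
| inv: "(x, y, h) \<in> generated C F B gens \<Longrightarrow> (y, x, inv_iso C h) \<in> generated C F B gens"

definition generated_subgroupoid ::
  "('o, 'm) tensor_cat \<Rightarrow> ('b \<Rightarrow> ('o, 'm) fibre_functor) \<Rightarrow> 'b set \<Rightarrow>
     ('b \<Rightarrow> 'b \<Rightarrow> ('o \<Rightarrow> complex mat) set) \<Rightarrow> 'b \<Rightarrow> 'b \<Rightarrow> ('o \<Rightarrow> complex mat) set" where
  "generated_subgroupoid C F B gens x y = {h. (x, y, h) \<in> generated C F B gens}"


section \<open>The local categories and the local groupoids\<close>

definition local_hom ::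
  "(mero \<Rightarrow> bool) \<Rightarrow> complex \<Rightarrow> complex mat \<Rightarrow> complex mat \<Rightarrow> mero mat set" where
  "local_hom R q A B = {S \<in> carrier_mat (dim_row B) (dim_row A).
     (\<forall>f \<in> elements_mat S. R f) \<and> shift_mat q S * const_mat A = const_mat B * S}"

definition local_cat :: "(mero \<Rightarrow> bool) \<Rightarrow> complex \<Rightarrow> (complex mat, mero mat) tensor_cat" where
  "local_cat R q = \<lparr>Obj = (\<Union>n. GL n), Hom = local_hom R q, tensor = kronecker, unit_obj = 1\<^sub>m 1\<rparr>"

abbreviation P_zero :: "complex \<Rightarrow> (complex mat, mero mat) tensor_cat" where
  "P_zero \<equiv> local_cat mero_plane"

abbreviation P_infinity :: "complex \<Rightarrow> (complex mat, mero mat) tensor_cat" where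
  "P_infinity \<equiv> local_cat mero_sphere_minus_0"

definition omega :: "complex \<Rightarrow> (complex mat, mero mat) fibre_functor" where
  "omega a = \<lparr>fib_dim = dim_row, fib_map = eval_mat a\<rparr>"

definition G_zero :: "complex \<Rightarrow> complex \<Rightarrow> complex \<Rightarrow> (complex mat \<Rightarrow> complex mat) set" where
  "G_zero q a b = Iso_tensor (P_zero q) (omega a) (omega b)"

definition G_infinity :: "complex \<Rightarrow> complex \<Rightarrow> complex \<Rightarrow> (complex mat \<Rightarrow> complex mat) set" where
  "G_infinity q a b = Iso_tensor (P_infinity q) (omega a) (omega b)"


section \<open>The category of connection triples\<close>

type_synonym triple = "complex mat \<times> mero mat \<times> complex mat"
type_synonym triple_mor = "mero mat \<times> mero mat"

definition q_orbits :: "complex \<Rightarrow> complex set \<Rightarrow> complex set" where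
  "q_orbits q \<Sigma> = {q powi k * s |k s. s \<in> \<Sigma>}"

definition singular_set :: "mero mat \<Rightarrow> complex set" where
  "singular_set M = poles_mat M \<union> poles_mat (mat_inv M)"

definition triples :: "complex \<Rightarrow> triple set" where
  "triples q = {(A0, M, Ainf). \<exists>n. A0 \<in> GL n \<and> Ainf \<in> GL n \<and> M \<in> GL n \<and>
     shift_mat q M * const_mat A0 = const_mat Ainf * M}"

fun triple_hom :: "complex \<Rightarrow> triple \<Rightarrow> triple \<Rightarrow> triple_mor set" where
  "triple_hom q (A0, M, Ainf) (B0, N, Binf) =
     {(S0, Sinf). S0 \<in> local_hom mero_plane q A0 B0 \<and>
        Sinf \<in> local_hom mero_sphere_minus_0 q Ainf Binf \<and> Sinf * M = N * S0}"

fun triple_tensor :: "triple \<Rightarrow> triple \<Rightarrow> triple" where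
  "triple_tensor (A0, M, Ainf) (B0, N, Binf) =
     (kronecker A0 B0, kronecker M N, kronecker Ainf Binf)"

definition C_Sigma :: "complex \<Rightarrow> complex set \<Rightarrow> (triple, triple_mor) tensor_cat" where
  "C_Sigma q \<Sigma> = \<lparr>
     Obj = {(A0, M, Ainf) \<in> triples q. singular_set M \<subseteq> q_orbits q \<Sigma>},
     Hom = triple_hom q, tensor = triple_tensor, unit_obj = (1\<^sub>m 1, 1\<^sub>m 1, 1\<^sub>m 1)\<rparr>"


section \<open>The Galois groupoid\<close>

datatype base_point = At_zero complex | At_infinity complex

definition base_points :: "base_point set" where
  "base_points = At_zero ` (- {0}) \<union> At_infinity ` (- {0})"

definition fibre_comp ::
  "('o1 \<Rightarrow> 'o2) \<Rightarrow> ('m1 \<Rightarrow> 'm2) \<Rightarrow> ('o2, 'm2) fibre_functor \<Rightarrow> ('o1, 'm1) fibre_functor" where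
  "fibre_comp p r F = \<lparr>fib_dim = fib_dim F \<circ> p, fib_map = fib_map F \<circ> r\<rparr>"

abbreviation zero_part :: "triple \<Rightarrow> complex mat" where
  "zero_part \<equiv> \<lambda>(A0, M, Ainf). A0"

abbreviation infinity_part :: "triple \<Rightarrow> complex mat" where
  "infinity_part \<equiv> \<lambda>(A0, M, Ainf). Ainf"

fun fibre :: "base_point \<Rightarrow> (triple, triple_mor) fibre_functor" where
  "fibre (At_zero a) = fibre_comp zero_part fst (omega a)"
| "fibre (At_infinity a) = fibre_comp infinity_part snd (omega a)"

definition Gamma_path :: "complex \<Rightarrow> complex set \<Rightarrow> complex \<Rightarrow> triple \<Rightarrow> complex mat" where
  "Gamma_path q \<Sigma> z0 = restrict (\<lambda>(A0, M, Ainf). eval_mat z0 M) (Obj (C_Sigma q \<Sigma>))"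

fun local_arrows_and_paths ::
  "complex \<Rightarrow> complex set \<Rightarrow> base_point \<Rightarrow> base_point \<Rightarrow> (triple \<Rightarrow> complex mat) set" where
  "local_arrows_and_paths q \<Sigma> (At_zero a) (At_zero b) =
     (\<lambda>g. restrict (g \<circ> zero_part) (Obj (C_Sigma q \<Sigma>))) ` G_zero q a b"
| "local_arrows_and_paths q \<Sigma> (At_infinity a) (At_infinity b) =
     (\<lambda>g. restrict (g \<circ> infinity_part) (Obj (C_Sigma q \<Sigma>))) ` G_infinity q a b"
| "local_arrows_and_paths q \<Sigma> (At_zero a) (At_infinity b) =
     (if a = b \<and> a \<notin> q_orbits q \<Sigma> then {Gamma_path q \<Sigma> a} else {})"
| "local_arrows_and_paths q \<Sigma> (At_infinity a) (At_zero b) = {}"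

end

theory Submission
  imports Defs "Jordan_Normal_Form.Jordan_Normal_Form_Existence"
begin

text \<open>
  Density says that a polynomial function on the arrows from \<open>x\<close> to \<open>y\<close> which vanishes on the
  generated arrows vanishes on all arrows. Every polynomial function is a matrix coefficient
  \<open>h \<mapsto> U h(X) V\<close> of a single object \<open>X\<close>, products coming from tensor products and sums from direct
  sums (\<open>poly_function_coefficient\<close>). For such an \<open>X\<close> and a vector \<open>V\<close> of its fibre at \<open>x\<close>, let
  \<open>W z\<close> be the span, in the fibre at \<open>z\<close>, of the vectors \<open>h(X) V\<close> with \<open>h\<close> a generated arrow from
  \<open>x\<close> to \<open>z\<close>. The generated groupoid permutes the subspaces \<open>W z\<close>. The main point is that a family
  of subspaces with this property consists of the fibres of a subobject \<open>f : Z \<rightarrow> X\<close>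
  (\<open>connection_subobject\<close>). Once this is known, naturality finishes the proof: \<open>V = f\<^sub>x C\<close> for some
  \<open>C\<close>, so every tensor isomorphism \<open>h\<close> satisfies \<open>h(X) V = f\<^sub>y h(Z) C \<in> W y\<close>, and a row \<open>U\<close> which
  kills the generated orbit of \<open>V\<close> kills \<open>h(X) V\<close> (\<open>coefficient_vanishes\<close>).

  The subobject is found at \<open>0\<close> and at \<open>\<infinity>\<close> separately (\<open>local_subobject\<close>), from two kinds of local
  arrows at \<open>A\<close>. For a character \<open>g\<close> of \<open>\<complex>\<^sup>*\<close> with \<open>g q = b/a\<close>, the operator acting as \<open>g c\<close> on the
  generalized eigenspace of the eigenvalue \<open>c\<close> is an arrow from \<open>a\<close> to \<open>b\<close> (\<open>char_arrow\<close>); and \<open>A\<close>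
  itself is an arrow from \<open>a\<close> to \<open>qa\<close> (\<open>shift_arrow\<close>). The first claim holds since the entries of a
  morphism are monomials \<open>\<alpha> z\<^sup>m\<close> in bases adapted to the eigenvalues, with \<open>m\<close> determined by the two
  eigenvalues concerned (\<open>local_hom_spectral\<close>). Two characters with value \<open>1\<close> at \<open>q\<close> suffice to
  separate the points of \<open>\<complex>\<^sup>*/q\<^sup>\<int>\<close> (\<open>mult_char_separating\<close>), so the fibre at \<open>1\<close> of a stable family
  is preserved by every operator that acts by one scalar on all generalized eigenspaces whose
  eigenvalues lie in the same class modulo \<open>q\<^sup>\<int>\<close>. A monomial gauge transformation, which moves the eigenvalues of \<open>A\<close> within their classes to a
  fundamental annulus, therefore makes the fibre at \<open>1\<close> an invariant subspace and turns the fibre at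
  \<open>z\<close> into its image under the gauge.

  The resulting \<open>S\<^sub>0 : B\<^sub>0 \<rightarrow> A\<^sub>0\<close> and \<open>S\<^sub>i : B\<^sub>i \<rightarrow> A\<^sub>i\<close>, at \<open>0\<close> and at \<open>\<infinity>\<close>, have Laurent polynomial
  entries and Laurent polynomial left inverses. The paths \<open>\<Gamma>\<^sub>z\<close> identify the images of \<open>S\<^sub>0\<close> and
  \<open>S\<^sub>i\<close> at all points \<open>z\<close> outside countably many, hence \<open>S\<^sub>i N = M S\<^sub>0\<close> for the invertible matrix
  \<open>N = L\<^sub>i M S\<^sub>0\<close>, where \<open>L\<^sub>i\<close> is the left inverse of \<open>S\<^sub>i\<close>; the singularities of \<open>N\<close> are among
  those of \<open>M\<close>.
\<close>

section \<open>Values of meromorphic functions\<close>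

text \<open>The value of a class at a pole is a dummy, so values do not commute with sums and products,
  but finite limits do.\<close>


lift_definition mero_tendsto :: "mero \<Rightarrow> complex \<Rightarrow> complex \<Rightarrow> bool" is
  "\<lambda>f z c. z \<noteq> 0 \<and> (f \<longlongrightarrow> c) (at z)"
proof -
  fix f g :: "complex \<Rightarrow> complex"
  assume *: "f meromorphic_on - {0} \<and> g meromorphic_on - {0} \<and> (\<forall>\<^sub>\<approx>z\<in>- {0}. f z = g z)"
  have "(f \<longlongrightarrow> c) (at z) \<longleftrightarrow> (g \<longlongrightarrow> c) (at z)" if "z \<noteq> 0" for z c
    by (rule tendsto_cong[OF eventually_at_punctured]) (use * that in blast)+
  then show "(\<lambda>z c. z \<noteq> 0 \<and> (f \<longlongrightarrow> c) (at z)) = (\<lambda>z c. z \<noteq> 0 \<and> (g \<longlongrightarrow> c) (at z))"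
    by (intro ext) auto
qed

definition mero_regular :: "complex \<Rightarrow> mero \<Rightarrow> bool" where
  "mero_regular z f \<longleftrightarrow> z \<noteq> 0 \<and> \<not> mero_pole f z"

lemma mero_tendsto_iff:
  "mero_tendsto f z c \<longleftrightarrow> mero_regular z f \<and> mero_eval f z = c"
  unfolding mero_regular_def
proof transfer
  fix f :: "complex \<Rightarrow> complex" and z c
  assume f: "f meromorphic_on - {0} \<and> f meromorphic_on - {0} \<and> (\<forall>\<^sub>\<approx>z\<in>- {0}. f z = f z)"
  show "(z \<noteq> 0 \<and> (f \<longlongrightarrow> c) (at z)) \<longleftrightarrow>
    (z \<noteq> 0 \<and> \<not> (z \<noteq> 0 \<and> is_pole f z)) \<and> (if z = 0 then 0 else remove_sings f z) = c"
  proof (cases "z = 0")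
    case False
    then have "not_essential f z"
      using f meromorphic_on_not_essential[of f z] meromorphic_on_subset[of f "- {0}" "{z}"] by auto
    moreover have "\<not> ((f \<longlongrightarrow> d) (at z) \<and> is_pole f z)" for d
      using not_tendsto_and_filterlim_at_infinity[where F = "at z" and f = f and c = d]
      by (auto simp: is_pole_def)
    ultimately show ?thesis
      using False remove_sings_eqI[of f _ z] by (auto simp: not_essential_def)
  qed simp
qed

lemma mero_tendsto_eval: "mero_regular z f \<Longrightarrow> mero_tendsto f z (mero_eval f z)"
  by (simp add: mero_tendsto_iff)

lemma mero_tendsto_add:
  "mero_tendsto f z c \<Longrightarrow> mero_tendsto g z d \<Longrightarrow> mero_tendsto (f + g) z (c + d)"
  by transfer (auto intro: tendsto_add)

lemma mero_tendsto_mult: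
  "mero_tendsto f z c \<Longrightarrow> mero_tendsto g z d \<Longrightarrow> mero_tendsto (f * g) z (c * d)"
  by transfer (auto intro: tendsto_mult)

lemma mero_tendsto_const: "z \<noteq> 0 \<Longrightarrow> mero_tendsto (mero_const c) z c"
  by transfer auto

lemma mero_const_hom:
  "mero_const 0 = 0" "mero_const 1 = 1"
  "mero_const (c + d) = mero_const c + mero_const d"
  "mero_const (c * d) = mero_const c * mero_const d"
  by (transfer; auto intro!: meromorphic_intros)+

lemma regular_const [simp]: "mero_regular z (mero_const c) \<longleftrightarrow> z \<noteq> 0"
  and eval_const [simp]: "z \<noteq> 0 \<Longrightarrow> mero_eval (mero_const c) z = c"
  using mero_tendsto_const[of z c] by (auto simp: mero_tendsto_iff mero_regular_def)

lemma regular_0 [simp]: "mero_regular z 0 \<longleftrightarrow> z \<noteq> 0"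
  and eval_0 [simp]: "z \<noteq> 0 \<Longrightarrow> mero_eval 0 z = 0"
  and regular_1 [simp]: "mero_regular z 1 \<longleftrightarrow> z \<noteq> 0"
  and eval_1 [simp]: "z \<noteq> 0 \<Longrightarrow> mero_eval 1 z = 1"
  using regular_const[of z 0] eval_const[of z 0] regular_const[of z 1] eval_const[of z 1]
  by (simp_all add: mero_const_hom)

lemma regular_add [intro]: "mero_regular z f \<Longrightarrow> mero_regular z g \<Longrightarrow> mero_regular z (f + g)"
  and eval_add: "mero_regular z f \<Longrightarrow> mero_regular z g \<Longrightarrow>
    mero_eval (f + g) z = mero_eval f z + mero_eval g z"
  and regular_mult [intro]: "mero_regular z f \<Longrightarrow> mero_regular z g \<Longrightarrow> mero_regular z (f * g)"
  and eval_mult: "mero_regular z f \<Longrightarrow> mero_regular z g \<Longrightarrow>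
    mero_eval (f * g) z = mero_eval f z * mero_eval g z"
  using mero_tendsto_add[OF mero_tendsto_eval mero_tendsto_eval, of z f g]
    mero_tendsto_mult[OF mero_tendsto_eval mero_tendsto_eval, of z f g]
  by (simp_all add: mero_tendsto_iff)

lemma regular_eval_sum:
  assumes "z \<noteq> 0" "\<And>i. i \<in> I \<Longrightarrow> mero_regular z (f i)"
  shows "mero_regular z (\<Sum>i\<in>I. f i) \<and> mero_eval (\<Sum>i\<in>I. f i) z = (\<Sum>i\<in>I. mero_eval (f i) z)"
  using assms(2) by (induction I rule: infinite_finite_induct) (use assms(1) in \<open>auto simp: eval_add\<close>)

text \<open>The zeros and the singularities of a nonzero class form a sparse, hence countable, subset of the
  punctured plane.\<close>

lemma mero_eq_0_if_eval_0:
  assumes "countable Z" and "\<And>z. z \<noteq> 0 \<Longrightarrow> z \<notin> Z \<Longrightarrow> mero_eval f z = 0"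
  shows "f = 0"
  using assms(2)
proof (transfer fixing: Z)
  fix f :: "complex \<Rightarrow> complex"
  assume f: "f meromorphic_on - {0} \<and> f meromorphic_on - {0} \<and> (\<forall>\<^sub>\<approx>z\<in>- {0}. f z = f z)"
  assume zero: "\<And>z. z \<noteq> 0 \<Longrightarrow> z \<notin> Z \<Longrightarrow> (if z = 0 then 0 else remove_sings f z) = 0"
  have con: "connected (- {0::complex})"
    by (intro connected_punctured_universe) simp
  have "(\<forall>\<^sub>\<approx>z\<in>- {0}. f z \<noteq> 0) \<or> (\<forall>\<^sub>\<approx>z\<in>- {0}. f z = 0)"
    using meromorphic_imp_constant_or_avoid[of f "- {0}" 0] f con by (auto intro: meromorphic_intros)
  moreover have False if nz: "\<forall>\<^sub>\<approx>z\<in>- {0}. f z \<noteq> 0"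
  proof -
    have "\<forall>\<^sub>\<approx>z\<in>- {0}. remove_sings f z = f z"
      using f by (intro eventually_remove_sings_eq) auto
    with nz have "\<forall>\<^sub>\<approx>z\<in>- {0}. remove_sings f z \<noteq> 0"
      by eventually_elim simp
    then have "{z. remove_sings f z = 0} sparse_in - {0}"
      by (simp add: eventually_cosparse)
    then have "countable ((- {0}) \<inter> {z. remove_sings f z = 0})"
      by (intro sparse_imp_countable) auto
    then have "countable ((- {0}) \<inter> {z. remove_sings f z = 0} \<union> Z \<union> {0})"
      using assms(1) by simp
    moreover have "(- {0}) \<inter> {z. remove_sings f z = 0} \<union> Z \<union> {0} = UNIV"
      using zero by (auto split: if_splits)
    ultimately have "countable (UNIV :: complex set)"
      by (simp only:)
    then show False
      using uncountable_UNIV_complex by blast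
  qed
  ultimately show "f meromorphic_on - {0} \<and> (\<lambda>_. 0) meromorphic_on - {0} \<and> (\<forall>\<^sub>\<approx>z\<in>- {0}. f z = 0)"
    using f by auto
qed

subsection \<open>Shifts, inversion of the variable and monomials\<close>

lemma meromorphic_scale:
  "f meromorphic_on - {0} \<Longrightarrow> q \<noteq> 0 \<Longrightarrow> (\<lambda>z. f (q * z)) meromorphic_on - {0 :: complex}"
  by (rule meromorphic_on_compose[of f "- {0}"]) (auto intro!: analytic_intros)

lemma mero_shift_hom:
  "mero_shift q (mero_const c) = mero_const c"
  "mero_shift q (f + g) = mero_shift q f + mero_shift q g"
  "mero_shift q (f * g) = mero_shift q f * mero_shift q g"
  by (transfer; auto intro!: meromorphic_intros meromorphic_scale)+

lemma mero_shift_0 [simp]: "mero_shift q 0 = 0"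
  and mero_shift_1 [simp]: "mero_shift q 1 = 1"
  using mero_shift_hom(1)[of q 0] mero_shift_hom(1)[of q 1] by (simp_all add: mero_const_hom)

lemma mero_tendsto_shift:
  assumes "q \<noteq> 0" "mero_tendsto f (q * z) c"
  shows "mero_tendsto (mero_shift q f) z c"
  using assms
proof transfer
  fix q z c :: complex and f :: "complex \<Rightarrow> complex"
  assume a: "q \<noteq> 0" "q * z \<noteq> 0 \<and> (f \<longlongrightarrow> c) (at (q * z))"
  have "filterlim (\<lambda>z. q * z) (at (q * z)) (at z)"
    unfolding filterlim_at using a(1)
    by (auto simp: eventually_at_filter intro!: tendsto_intros)
  then show "z \<noteq> 0 \<and> ((if q = 0 then f else (\<lambda>z. f (q * z))) \<longlongrightarrow> c) (at z)"
    using a filterlim_compose by auto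
qed

lemma eval_shift:
  "q \<noteq> 0 \<Longrightarrow> mero_regular (q * z) f \<Longrightarrow> mero_eval (mero_shift q f) z = mero_eval f (q * z)"
  and regular_shift:
  "q \<noteq> 0 \<Longrightarrow> mero_regular (q * z) f \<Longrightarrow> mero_regular z (mero_shift q f)"
  using mero_tendsto_shift[OF _ mero_tendsto_eval, of q z f] by (auto simp: mero_tendsto_iff)

lift_definition mero_monom :: "int \<Rightarrow> mero" is "\<lambda>m z. z powi m"
  by (auto intro!: meromorphic_intros)

lemma eventually_nonzero_punctured: "\<forall>\<^sub>\<approx>z\<in>- {0::complex}. z \<noteq> 0"
  using eventually_in_cosparse[OF subset_refl open_Compl[OF closed_singleton], of "0 :: complex"]
  by simp

lemma mero_monom_0 [simp]: "mero_monom 0 = 1"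
  by transfer (auto intro: meromorphic_intros)

lemma mero_monom_add: "mero_monom (m + n) = mero_monom m * mero_monom n"
  by transfer (auto intro!: meromorphic_intros eventually_mono[OF eventually_nonzero_punctured]
      simp: power_int_add)

lemma mero_shift_monom:
  "q \<noteq> 0 \<Longrightarrow> mero_shift q (mero_monom m) = mero_const (q powi m) * mero_monom m"
  by transfer (auto intro!: meromorphic_intros simp: power_int_mult_distrib)

lemma mero_tendsto_monom: "z \<noteq> 0 \<Longrightarrow> mero_tendsto (mero_monom m) z (z powi m)"
  by transfer (auto intro!: tendsto_intros)

lemma regular_monom [simp]: "mero_regular z (mero_monom m) \<longleftrightarrow> z \<noteq> 0"
  and eval_monom [simp]: "z \<noteq> 0 \<Longrightarrow> mero_eval (mero_monom m) z = z powi m"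
  using mero_tendsto_monom[of z m] by (auto simp: mero_tendsto_iff mero_regular_def)

lemma filterlim_inverse_at:
  fixes z :: complex assumes "z \<noteq> 0"
  shows "filterlim inverse (at (inverse z)) (at z)"
  unfolding filterlim_at using assms
  by (auto simp: eventually_at_filter intro!: tendsto_intros)

lemma eventually_cosparse_inverse:
  assumes "\<forall>\<^sub>\<approx>z\<in>- {0::complex}. P z"
  shows "\<forall>\<^sub>\<approx>z\<in>- {0}. P (inverse z)"
  unfolding eventually_cosparse_open_eq[OF open_Compl[OF closed_singleton]]
proof
  fix z :: complex assume "z \<in> - {0}"
  then have "eventually P (at (inverse z))" "z \<noteq> 0"
    using assms by (auto intro!: eventually_at_punctured)
  then show "\<forall>\<^sub>F x in at z. P (inverse x)"
    using filterlim_inverse_at[of z] unfolding filterlim_iff by blast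
qed

lemma meromorphic_inverse_arg:
  "f meromorphic_on - {0} \<Longrightarrow> (\<lambda>z. f (inverse z)) meromorphic_on - {0 :: complex}"
  by (rule meromorphic_on_compose[of f "- {0}"]) (auto intro!: analytic_intros)

text \<open>The coordinate change \<open>z \<mapsto> 1 / z\<close>, which carries the point at infinity to \<open>0\<close>.\<close>

lift_definition mero_inv :: "mero \<Rightarrow> mero" is "\<lambda>f z. f (inverse z)"
  by (auto intro!: meromorphic_inverse_arg eventually_cosparse_inverse)

lemma mero_inv_hom:
  "mero_inv (mero_const c) = mero_const c"
  "mero_inv (f + g) = mero_inv f + mero_inv g"
  "mero_inv (f * g) = mero_inv f * mero_inv g"
  by (transfer; auto intro!: meromorphic_intros meromorphic_inverse_arg)+

lemma mero_inv_inv [simp]: "mero_inv (mero_inv f) = f"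
  by transfer (auto intro!: meromorphic_intros)

lemma mero_inv_monom: "mero_inv (mero_monom m) = mero_monom (- m)"
  by transfer (auto intro!: meromorphic_intros simp: power_int_minus power_int_inverse)

lemma mero_inv_shift:
  "q \<noteq> 0 \<Longrightarrow> mero_inv (mero_shift q f) = mero_shift (inverse q) (mero_inv f)"
  by transfer (auto intro!: meromorphic_scale meromorphic_inverse_arg)

section \<open>Laurent coefficients at the two ends\<close>

lemma eventually_cosparse_UNIV_D:
  "(\<forall>\<^sub>\<approx>z. P z) \<Longrightarrow> (\<forall>\<^sub>\<approx>z\<in>A. P (z :: complex))"
  by (auto simp: eventually_cosparse intro: sparse_in_subset)

text \<open>The set where a representative on the punctured plane may be changed is sparse there but can
  accumulate at \<open>0\<close>; a representative on the whole plane is fixed near \<open>0\<close> by the identity theorem.\<close>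

lift_definition mero_laurent :: "mero \<Rightarrow> (int \<Rightarrow> complex) \<Rightarrow> bool" is
  "\<lambda>f c. \<exists>g F. g meromorphic_on UNIV \<and> (\<forall>\<^sub>\<approx>z\<in>- {0}. f z = g z) \<and>
     g has_laurent_expansion F \<and> c = fls_nth F"
proof -
  fix f1 f2 :: "complex \<Rightarrow> complex"
  assume *: "f1 meromorphic_on - {0} \<and> f2 meromorphic_on - {0} \<and> (\<forall>\<^sub>\<approx>z\<in>- {0}. f1 z = f2 z)"
  have "(\<forall>\<^sub>\<approx>z\<in>- {0}. f1 z = g z) \<longleftrightarrow> (\<forall>\<^sub>\<approx>z\<in>- {0}. f2 z = g z)" for g
    using * by (auto elim: eventually_elim2)
  then show "(\<lambda>c. \<exists>g F. g meromorphic_on UNIV \<and> (\<forall>\<^sub>\<approx>z\<in>- {0}. f1 z = g z) \<and>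
       g has_laurent_expansion F \<and> c = fls_nth F) =
     (\<lambda>c. \<exists>g F. g meromorphic_on UNIV \<and> (\<forall>\<^sub>\<approx>z\<in>- {0}. f2 z = g z) \<and>
       g has_laurent_expansion F \<and> c = fls_nth F)"
    by simp
qed

lemma mero_laurent_ex: "mero_plane f \<longleftrightarrow> (\<exists>c. mero_laurent f c)"
proof transfer
  fix f :: "complex \<Rightarrow> complex"
  have "\<exists>F. g has_laurent_expansion F" if "g meromorphic_on UNIV" for g
  proof -
    have "\<exists>F. (\<lambda>w. g (0 + w)) has_laurent_expansion F"
      using that unfolding meromorphic_on_def by blast
    then show ?thesis
      by simp
  qed
  then show "(\<exists>g. g meromorphic_on UNIV \<and> (\<forall>\<^sub>\<approx>z\<in>- {0}. f z = g z)) \<longleftrightarrow>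
    (\<exists>c. \<exists>g F. g meromorphic_on UNIV \<and> (\<forall>\<^sub>\<approx>z\<in>- {0}. f z = g z) \<and>
       g has_laurent_expansion F \<and> c = fls_nth F)"
    by blast
qed

lemma mero_laurent_add:
  assumes "mero_laurent f c" "mero_laurent g d"
  shows "mero_laurent (f + g) (\<lambda>m. c m + d m)"
  using assms
proof (transfer, elim exE conjE)
  fix f1 f2 g1 g2 :: "complex \<Rightarrow> complex" and c d :: "int \<Rightarrow> complex" and F G
  assume a: "g1 meromorphic_on UNIV" "\<forall>\<^sub>\<approx>z\<in>- {0}. f1 z = g1 z" "g1 has_laurent_expansion F"
    "c = fls_nth F"
  assume b: "g2 meromorphic_on UNIV" "\<forall>\<^sub>\<approx>z\<in>- {0}. f2 z = g2 z" "g2 has_laurent_expansion G"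
    "d = fls_nth G"
  have "(\<lambda>z. g1 z + g2 z) meromorphic_on UNIV"
    using a(1) b(1) by (rule meromorphic_on_add)
  moreover have "\<forall>\<^sub>\<approx>z\<in>- {0}. f1 z + f2 z = g1 z + g2 z"
    using a(2) b(2) by eventually_elim simp
  moreover have "(\<lambda>z. g1 z + g2 z) has_laurent_expansion F + G"
    using a(3) b(3) by (rule has_laurent_expansion_add)
  ultimately show "\<exists>g FG. g meromorphic_on UNIV \<and> (\<forall>\<^sub>\<approx>z\<in>- {0}. f1 z + f2 z = g z) \<and>
      g has_laurent_expansion FG \<and> (\<lambda>m. c m + d m) = fls_nth FG"
    using a(4) b(4) by (intro exI[of _ "\<lambda>z. g1 z + g2 z"] exI[of _ "F + G"]) auto
qed

lemma mero_laurent_scale: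
  assumes "mero_laurent f c"
  shows "mero_laurent (mero_const a * f) (\<lambda>m. a * c m)"
  using assms
proof (transfer, elim exE conjE)
  fix f g :: "complex \<Rightarrow> complex" and c :: "int \<Rightarrow> complex" and F a
  assume g: "g meromorphic_on UNIV" "\<forall>\<^sub>\<approx>z\<in>- {0}. f z = g z" "g has_laurent_expansion F"
    "c = fls_nth F"
  have "(\<lambda>z. a * g z) meromorphic_on UNIV"
    using g(1) by (intro meromorphic_intros)
  moreover have "\<forall>\<^sub>\<approx>z\<in>- {0}. a * f z = a * g z"
    using g(2) by eventually_elim simp
  moreover have "(\<lambda>z. a * g z) has_laurent_expansion fls_const a * F"
    using g(3) by (rule has_laurent_expansion_cmult_left)
  ultimately show "\<exists>g F. g meromorphic_on UNIV \<and> (\<forall>\<^sub>\<approx>z\<in>- {0}. a * f z = g z) \<and>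
      g has_laurent_expansion F \<and> (\<lambda>m. a * c m) = fls_nth F"
    using g(4) by (intro exI[of _ "\<lambda>z. a * g z"] exI[of _ "fls_const a * F"]) auto
qed

lemma mero_laurent_shift:
  assumes "mero_laurent f c" "q \<noteq> 0"
  shows "mero_laurent (mero_shift q f) (\<lambda>m. q powi m * c m)"
  using assms
proof (transfer, elim exE conjE)
  fix f g :: "complex \<Rightarrow> complex" and c :: "int \<Rightarrow> complex" and F and q :: complex
  assume q: "q \<noteq> 0"
  assume g: "g meromorphic_on UNIV" "\<forall>\<^sub>\<approx>z\<in>- {0}. f z = g z" "g has_laurent_expansion F"
    "c = fls_nth F"
  have "(\<lambda>z. g (q * z)) meromorphic_on UNIV"
    by (rule meromorphic_on_compose[OF g(1)]) (auto intro!: analytic_intros)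
  moreover have "\<forall>\<^sub>\<approx>z\<in>- {0}. f (q * z) = g (q * z)"
    by (rule eventually_cosparse_scale[OF q g(2)])
  moreover have "(g \<circ> (\<lambda>z. q * z)) has_laurent_expansion
      fls_compose_fps F (fps_const q * fps_X)"
  proof (rule has_laurent_expansion_compose[OF g(3)])
    have "(\<lambda>z. q * z) has_fps_expansion fps_const q * fps_X"
      by (intro fps_expansion_intros)
    then show "(\<lambda>z. q * z) has_laurent_expansion fps_to_fls (fps_const q * fps_X)"
      by (rule has_laurent_expansion_fps)
    show "fps_const q * fps_X \<noteq> 0"
      using q by simp
  qed simp
  then have "(\<lambda>z. g (q * z)) has_laurent_expansion fls_compose_fps F (fps_const q * fps_X)"
    by (simp add: o_def)
  ultimately show "\<exists>g F. g meromorphic_on UNIV \<and>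
      (\<forall>\<^sub>\<approx>z\<in>- {0}. (if q = 0 then f else (\<lambda>z. f (q * z))) z = g z) \<and>
      g has_laurent_expansion F \<and> (\<lambda>m. q powi m * c m) = fls_nth F"
    using g(4) q
    by (intro exI[of _ "\<lambda>z. g (q * z)"] exI[of _ "fls_compose_fps F (fps_const q * fps_X)"])
      (auto simp: fls_nth_fls_compose_fps_linear)
qed

lemma mero_laurent_monom: "mero_laurent (mero_monom m) (\<lambda>k. if k = m then 1 else 0)"
proof transfer
  fix m :: int
  have "(\<lambda>z::complex. z powi m) meromorphic_on UNIV"
    by (intro meromorphic_intros)
  moreover have "(\<lambda>z::complex. z powi m) has_laurent_expansion fls_X_intpow m"
    using has_laurent_expansion_fps_X_power_int[of m] by simp
  ultimately show "\<exists>g F. g meromorphic_on UNIV \<and> (\<forall>\<^sub>\<approx>z\<in>- {0}. z powi m = g z) \<and>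
      g has_laurent_expansion F \<and> (\<lambda>k. if k = m then 1 else 0) = fls_nth F"
    by (intro exI[of _ "\<lambda>z. z powi m"] exI[of _ "fls_X_intpow m"]) auto
qed

lemma meromorphic_UNIV_zero_or_nonzero:
  assumes "g meromorphic_on UNIV"
  shows "(\<forall>\<^sub>\<approx>z. g z = 0) \<or> (\<forall>\<^sub>\<approx>z. g z \<noteq> 0)"
  using meromorphic_imp_constant_or_avoid[OF assms open_UNIV connected_UNIV, of 0] .

lemma mero_laurent_of_0: "mero_laurent 0 c \<Longrightarrow> c = (\<lambda>_. 0)"
proof (transfer, elim exE conjE)
  fix g :: "complex \<Rightarrow> complex" and c :: "int \<Rightarrow> complex" and F
  assume g: "g meromorphic_on UNIV" "\<forall>\<^sub>\<approx>z\<in>- {0}. 0 = g z" "g has_laurent_expansion F"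
    "c = fls_nth F"
  have "\<not> (\<forall>\<^sub>\<approx>z. g z \<noteq> 0)"
  proof
    assume "\<forall>\<^sub>\<approx>z. g z \<noteq> 0"
    then have "\<forall>\<^sub>\<approx>z\<in>- {0}. g z \<noteq> 0"
      by (rule eventually_cosparse_UNIV_D)
    with g(2) have "\<forall>\<^sub>\<approx>z\<in>- {0::complex}. False"
      by eventually_elim simp
    moreover have "- {0::complex} \<noteq> {}"
      using one_neq_zero by blast
    ultimately show False
      by simp
  qed
  then have "\<forall>\<^sub>\<approx>z. g z = 0"
    using meromorphic_UNIV_zero_or_nonzero[OF g(1)] by blast
  then have "eventually (\<lambda>z. g z = 0) (at 0)"
    by (auto simp: eventually_cosparse_open_eq)
  then have "F = 0"
    using has_laurent_expansion_eventually_zero_iff[of g 0 F] g(3) by simp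
  then show "c = (\<lambda>_. 0)"
    using g(4) by auto
qed

lemma mero_laurent_eq_0: "mero_laurent f (\<lambda>_. 0) \<Longrightarrow> f = 0"
proof (transfer, elim exE conjE)
  fix f g :: "complex \<Rightarrow> complex" and F
  assume f: "f meromorphic_on - {0}"
  assume g: "g meromorphic_on UNIV" "\<forall>\<^sub>\<approx>z\<in>- {0}. f z = g z" "g has_laurent_expansion F"
    "(\<lambda>_. 0) = fls_nth F"
  have "F = 0"
    using g(4) by (intro fls_eqI) (metis fls_zero_nth)
  then have "eventually (\<lambda>z. g z = 0) (at 0)"
    using has_laurent_expansion_eventually_zero_iff[of g 0 F] g(3) by simp
  moreover have False if "eventually (\<lambda>z. g z = 0) (at 0)" "\<forall>\<^sub>\<approx>z. g z \<noteq> 0"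
  proof -
    have "eventually (\<lambda>z. g z \<noteq> 0) (at 0)"
      using that(2) by (auto simp: eventually_cosparse_open_eq)
    with that(1) have "eventually (\<lambda>_. False) (at (0::complex))"
      by eventually_elim simp
    then show False
      by simp
  qed
  ultimately have "\<forall>\<^sub>\<approx>z. g z = 0"
    using meromorphic_UNIV_zero_or_nonzero[OF g(1)] by blast
  then have "\<forall>\<^sub>\<approx>z\<in>- {0}. g z = 0"
    by (rule eventually_cosparse_UNIV_D)
  with g(2) have "\<forall>\<^sub>\<approx>z\<in>- {0}. f z = 0"
    by eventually_elim simp
  with f show "f meromorphic_on - {0} \<and> (\<lambda>_. 0) meromorphic_on - {0} \<and> (\<forall>\<^sub>\<approx>z\<in>- {0}. f z = 0)"
    by auto
qed

lemma mero_sphere_minus_0_iff: "mero_sphere_minus_0 f \<longleftrightarrow> mero_plane (mero_inv f)"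
proof transfer
  fix f :: "complex \<Rightarrow> complex"
  show "(\<exists>g. g meromorphic_on - {0} \<and> (\<lambda>w. g (inverse w)) meromorphic_on {0} \<and>
      (\<forall>\<^sub>\<approx>z\<in>- {0}. f z = g z)) \<longleftrightarrow>
    (\<exists>g. g meromorphic_on UNIV \<and> (\<forall>\<^sub>\<approx>z\<in>- {0}. f (inverse z) = g z))" (is "?L \<longleftrightarrow> ?R")
  proof
    assume ?L
    then obtain g where g: "g meromorphic_on - {0}" "(\<lambda>w. g (inverse w)) meromorphic_on {0}"
      "\<forall>\<^sub>\<approx>z\<in>- {0}. f z = g z"
      by blast
    have "(\<lambda>w. g (inverse w)) meromorphic_on - {0} \<union> {0}"
      using meromorphic_inverse_arg[OF g(1)] g(2) by (rule meromorphic_on_Un)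
    then have "(\<lambda>w. g (inverse w)) meromorphic_on UNIV"
      by (simp only: Compl_partition2)
    with eventually_cosparse_inverse[OF g(3)] show ?R
      by blast
  next
    assume ?R
    then obtain g where g: "g meromorphic_on UNIV" "\<forall>\<^sub>\<approx>z\<in>- {0}. f (inverse z) = g z"
      by blast
    have "(\<lambda>w. g (inverse w)) meromorphic_on - {0}"
      using g(1) by (intro meromorphic_inverse_arg) (rule meromorphic_on_subset, auto)
    moreover have "(\<lambda>w. g (inverse (inverse w))) meromorphic_on {0}"
      using g(1) by (auto intro: meromorphic_on_subset)
    moreover have "\<forall>\<^sub>\<approx>z\<in>- {0}. f z = g (inverse z)"
      using eventually_cosparse_inverse[OF g(2)] by simp
    ultimately show ?L
      by (intro exI[of _ "\<lambda>w. g (inverse w)"] conjI)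
  qed
qed

text \<open>What the two ends have in common: linear and injective Laurent coefficients, on which the
  \<open>q\<close>-shift acts diagonally. At infinity the expansion in \<open>1 / z\<close> is reindexed, so that \<open>z\<^sup>m\<close> has
  index \<open>m\<close> at both ends.\<close>

locale laurent_ring =
  fixes R :: "mero \<Rightarrow> bool" and cf :: "mero \<Rightarrow> (int \<Rightarrow> complex) \<Rightarrow> bool"
  assumes R_iff: "R f \<longleftrightarrow> (\<exists>c. cf f c)"
    and cf_add: "cf f c \<Longrightarrow> cf g d \<Longrightarrow> cf (f + g) (\<lambda>m. c m + d m)"
    and cf_scale: "cf f c \<Longrightarrow> cf (mero_const a * f) (\<lambda>m. a * c m)"
    and cf_shift: "cf f c \<Longrightarrow> q \<noteq> 0 \<Longrightarrow> cf (mero_shift q f) (\<lambda>m. q powi m * c m)"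
    and cf_monom: "cf (mero_monom m) (\<lambda>k. if k = m then 1 else 0)"
    and cf_of_0: "cf 0 c \<Longrightarrow> c = (\<lambda>_. 0)"
    and cf_eq_0: "cf f (\<lambda>_. 0) \<Longrightarrow> f = 0"

lemma laurent_ring_plane: "laurent_ring mero_plane mero_laurent"
  by unfold_locales
    (simp_all add: mero_laurent_ex mero_laurent_add mero_laurent_scale mero_laurent_shift
      mero_laurent_monom mero_laurent_of_0 mero_laurent_eq_0)

lemma laurent_ring_sphere:
  "laurent_ring mero_sphere_minus_0 (\<lambda>f c. mero_laurent (mero_inv f) (\<lambda>m. c (- m)))"
proof
  fix f g c d and a q :: complex and m :: int
  show "mero_sphere_minus_0 f \<longleftrightarrow> (\<exists>c. mero_laurent (mero_inv f) (\<lambda>m. c (- m)))"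
  proof
    assume "mero_sphere_minus_0 f"
    then obtain c where "mero_laurent (mero_inv f) c"
      by (auto simp: mero_sphere_minus_0_iff mero_laurent_ex)
    then show "\<exists>c. mero_laurent (mero_inv f) (\<lambda>m. c (- m))"
      by (intro exI[of _ "\<lambda>m. c (- m)"]) simp
  qed (auto simp: mero_sphere_minus_0_iff mero_laurent_ex)
  show "mero_laurent (mero_inv (f + g)) (\<lambda>m. c (- m) + d (- m))"
    if "mero_laurent (mero_inv f) (\<lambda>m. c (- m))" "mero_laurent (mero_inv g) (\<lambda>m. d (- m))"
    using mero_laurent_add[OF that] by (simp add: mero_inv_hom)
  show "mero_laurent (mero_inv (mero_const a * f)) (\<lambda>m. a * c (- m))"
    if "mero_laurent (mero_inv f) (\<lambda>m. c (- m))"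
    using mero_laurent_scale[OF that] by (simp add: mero_inv_hom)
  show "mero_laurent (mero_inv (mero_shift q f)) (\<lambda>m. q powi (- m) * c (- m))"
    if "mero_laurent (mero_inv f) (\<lambda>m. c (- m))" "q \<noteq> 0"
    using mero_laurent_shift[OF that(1), of "inverse q"] that(2)
    by (simp add: mero_inv_shift power_int_minus power_int_inverse)
  have "(\<lambda>k. if - k = m then 1 else 0 :: complex) = (\<lambda>k. if k = - m then 1 else 0)"
    by auto
  then show "mero_laurent (mero_inv (mero_monom m)) (\<lambda>k. if - k = m then 1 else 0)"
    using mero_laurent_monom[of "- m"] by (simp add: mero_inv_monom)
  show "c = (\<lambda>_. 0)" if "mero_laurent (mero_inv 0) (\<lambda>m. c (- m))"
  proof
    fix m
    have "(\<lambda>m. c (- m)) = (\<lambda>_. 0)"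
      using that mero_inv_hom(1)[of 0] by (intro mero_laurent_of_0) (simp add: mero_const_hom)
    from fun_cong[OF this, of "- m"] show "c m = 0"
      by simp
  qed
  show "f = 0" if "mero_laurent (mero_inv f) (\<lambda>_. 0)"
  proof -
    have "mero_inv (mero_inv f) = mero_inv (mero_const 0)"
      using mero_laurent_eq_0[OF that] by (simp add: mero_const_hom)
    then show ?thesis
      using mero_inv_hom(1)[of 0] by (simp add: mero_const_hom)
  qed
qed

section \<open>Monomial solutions\<close>

text \<open>For \<open>c \<noteq> 0\<close>, the solutions of \<open>c f(qz) = d f(z)\<close> among the functions that are meromorphic at
  \<open>0\<close>, or among those that are meromorphic at infinity.\<close>

definition monomials :: "complex \<Rightarrow> complex \<Rightarrow> complex \<Rightarrow> mero set" where
  "monomials q c d = {f. f = 0 \<or> (\<exists>\<alpha> m. d = q powi m * c \<and> f = mero_const \<alpha> * mero_monom m)}"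

lemma powi_inj:
  fixes q :: complex
  assumes "norm q > 1" "q powi m = q powi n"
  shows "m = n"
proof -
  have "norm q powi m = norm q powi n"
    using assms(2) by (metis norm_power_int)
  then show ?thesis
    using power_int_strict_increasing[of m n "norm q"] power_int_strict_increasing[of n m "norm q"]
      assms(1) by (cases m n rule: linorder_cases) auto
qed

lemma monomialsI: "d = q powi m * c \<Longrightarrow> mero_const \<alpha> * mero_monom m \<in> monomials q c d"
  by (auto simp: monomials_def)

lemma monomialsE:
  assumes "f \<in> monomials q c d"
  obtains "f = 0" | \<alpha> m where "d = q powi m * c" "f = mero_const \<alpha> * mero_monom m"
  using assms by (auto simp: monomials_def)

lemma monomials_0 [simp]: "0 \<in> monomials q c d"
  by (simp add: monomials_def)

lemma monomials_add:
  assumes q: "norm q > 1" "c \<noteq> 0" and f: "f \<in> monomials q c d" "g \<in> monomials q c d"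
  shows "f + g \<in> monomials q c d"
proof (cases "f = 0 \<or> g = 0")
  case False
  then obtain \<alpha> m \<beta> n where fg: "d = q powi m * c" "f = mero_const \<alpha> * mero_monom m"
    "d = q powi n * c" "g = mero_const \<beta> * mero_monom n"
    using f by (blast elim: monomialsE)
  have "m = n"
    using fg q by (intro powi_inj[of q]) auto
  then have "f + g = mero_const (\<alpha> + \<beta>) * mero_monom m"
    using fg by (simp add: mero_const_hom algebra_simps)
  with fg(1) show ?thesis
    by (simp only: monomialsI)
qed (use f in auto)

lemma monomials_scale:
  assumes "f \<in> monomials q c d"
  shows "mero_const a * f \<in> monomials q c d"
  using assms
proof (cases rule: monomialsE)
  case (2 \<alpha> m)
  have "mero_const a * f = mero_const (a * \<alpha>) * mero_monom m"
    using 2 by (simp add: mero_const_hom)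
  with 2 show ?thesis
    by (simp only: monomialsI)
qed simp

lemma monomials_shift:
  assumes "f \<in> monomials q c d" "q \<noteq> 0"
  shows "mero_shift q f \<in> monomials q c d"
  using assms(1)
proof (cases rule: monomialsE)
  case (2 \<alpha> m)
  have "mero_shift q f = mero_const (\<alpha> * q powi m) * mero_monom m"
    using 2 assms(2) by (simp add: mero_shift_hom mero_shift_monom mero_const_hom)
  with 2 show ?thesis
    by (simp only: monomialsI)
qed simp

lemma monomials_sum:
  assumes "norm q > 1" "c \<noteq> 0" "\<And>i. i \<in> I \<Longrightarrow> f i \<in> monomials q c d"
  shows "sum f I \<in> monomials q c d"
  using assms(3)
  by (induction I rule: infinite_finite_induct) (auto intro: monomials_add[OF assms(1,2)])

lemma monomials_regular: "f \<in> monomials q c d \<Longrightarrow> z \<noteq> 0 \<Longrightarrow> mero_regular z f"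
  by (auto simp: monomials_def intro: regular_mult)

definition mult_char :: "(complex \<Rightarrow> complex) \<Rightarrow> bool" where
  "mult_char g \<longleftrightarrow> g 1 = 1 \<and> (\<forall>x y. x \<noteq> 0 \<longrightarrow> y \<noteq> 0 \<longrightarrow> g (x * y) = g x * g y)"

lemma mult_char_mult: "mult_char g \<Longrightarrow> x \<noteq> 0 \<Longrightarrow> y \<noteq> 0 \<Longrightarrow> g (x * y) = g x * g y"
  and mult_char_1: "mult_char g \<Longrightarrow> g 1 = 1"
  by (simp_all add: mult_char_def)

lemma mult_char_nonzero: "mult_char g \<Longrightarrow> x \<noteq> 0 \<Longrightarrow> g x \<noteq> 0"
  using mult_char_mult[of g x "inverse x"] by (auto simp: mult_char_1)

lemma mult_char_inverse: "mult_char g \<Longrightarrow> x \<noteq> 0 \<Longrightarrow> g (inverse x) = inverse (g x)"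
  using mult_char_mult[of g x "inverse x"] by (simp add: mult_char_1 inverse_unique)

lemma mult_char_power: "mult_char g \<Longrightarrow> x \<noteq> 0 \<Longrightarrow> g (x ^ n) = g x ^ n"
  by (induction n) (auto simp: mult_char_mult mult_char_1)

lemma mult_char_powi:
  assumes "mult_char g" "x \<noteq> 0"
  shows "g (x powi m) = g x powi m"
  using assms by (cases m rule: int_cases2)
    (simp_all add: power_int_minus mult_char_inverse mult_char_power)

text \<open>If \<open>d = q\<^sup>m c\<close> and \<open>f = \<alpha> z\<^sup>m\<close>, both sides change by \<open>(b/a)\<^sup>m\<close> from \<open>a\<close> to \<open>b\<close>. This is the
  source of the naturality of the arrows attached to characters.\<close>

lemma monomials_eval_char:
  assumes g: "mult_char g" "g q = b / a" and q: "q \<noteq> 0" and c: "c \<noteq> 0"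
    and ab: "a \<noteq> 0" "b \<noteq> 0" and f: "f \<in> monomials q c d"
  shows "mero_eval f b * g c = g d * mero_eval f a"
proof (cases "f = 0")
  case False
  then obtain \<alpha> m where m: "d = q powi m * c" "f = mero_const \<alpha> * mero_monom m"
    using f by (auto simp: monomials_def)
  have "g d = (b / a) powi m * g c"
    using g q c m(1) by (simp add: mult_char_mult mult_char_powi)
  then show ?thesis
    using ab by (simp add: m(2) eval_mult power_int_divide_distrib)
qed (use ab in simp)

lemma mero_const_uminus: "mero_const (- a) = - mero_const a"
  by transfer (auto intro: meromorphic_intros)

context laurent_ring
begin

lemma cf_uminus: "cf f c \<Longrightarrow> cf (- f) (\<lambda>m. - c m)"
  using cf_scale[of f c "-1"] by (simp add: mero_const_uminus mero_const_hom)

lemma cf_diff: "cf f c \<Longrightarrow> cf g d \<Longrightarrow> cf (f - g) (\<lambda>m. c m - d m)"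
  using cf_add[OF _ cf_uminus, of f c g d] by simp

lemma cf_unique: "cf f c \<Longrightarrow> cf f d \<Longrightarrow> c = d"
  using cf_of_0[of "\<lambda>m. c m - d m"] cf_diff[of f c f d] by (auto simp: fun_eq_iff)

lemma R_add: "R f \<Longrightarrow> R g \<Longrightarrow> R (f + g)"
  and R_scale: "R f \<Longrightarrow> R (mero_const a * f)"
  and R_monom: "R (mero_monom m)"
  using cf_add cf_scale cf_monom unfolding R_iff by blast+

lemma R_const: "R (mero_const a)"
  using R_scale[OF R_monom, of a 0] by simp

lemma R_0: "R 0"
  using R_const[of 0] by (simp add: mero_const_hom)

lemma R_sum: "(\<And>i. i \<in> I \<Longrightarrow> R (f i)) \<Longrightarrow> R (sum f I)"
  by (induction I rule: infinite_finite_induct) (auto intro: R_add R_0)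

lemma monomials_cf:
  assumes "f \<in> monomials q c d" "d \<noteq> q powi k * c" "cf f e"
  shows "e k = 0"
proof (cases "f = 0")
  case True
  then show ?thesis
    using cf_of_0 assms(3) by (auto simp: fun_eq_iff)
next
  case False
  then obtain \<alpha> m where m: "d = q powi m * c" "f = mero_const \<alpha> * mero_monom m"
    using assms(1) by (auto simp: monomials_def)
  then have "e = (\<lambda>k. \<alpha> * (if k = m then 1 else 0))"
    using cf_unique assms(3) cf_scale[OF cf_monom] by blast
  then show ?thesis
    using m assms(2) by auto
qed

text \<open>The shift multiplies the \<open>m\<close>-th coefficient by \<open>q\<^sup>m\<close>, so the equation forces it to vanish unless
  \<open>d = q\<^sup>m c\<close>, which happens for at most one \<open>m\<close>. The inhomogeneous term, which the recursion for
  triangular systems needs, has no coefficient at the other indices.\<close>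

lemma q_difference_monomial:
  assumes q: "norm q > 1" and c: "c \<noteq> 0" and f: "R f"
    and eq: "mero_const c * mero_shift q f - mero_const d * f \<in> monomials q c d"
  shows "f \<in> monomials q c d"
proof -
  have q0: "q \<noteq> 0"
    using q by auto
  obtain a where a: "cf f a"
    using f R_iff by blast
  have cfe: "cf (mero_const c * mero_shift q f - mero_const d * f)
      (\<lambda>m. c * (q powi m * a m) - d * a m)"
    using a q0 by (intro cf_diff cf_scale cf_shift)
  have a0: "a k = 0" if "d \<noteq> q powi k * c" for k
    using monomials_cf[OF eq that cfe] that by (auto simp: algebra_simps)
  show ?thesis
  proof (cases "a = (\<lambda>_. 0)")
    case True
    then have "f = 0"
      using a cf_eq_0 by blast
    then show ?thesis
      by simp
  next
    case False
    then obtain m where m: "a m \<noteq> 0"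
      by (auto simp: fun_eq_iff)
    then have dm: "d = q powi m * c"
      using a0 by blast
    have "a k - a m * (if k = m then 1 else 0) = 0" for k
      using a0[of k] dm c powi_inj[OF q, of m k] by (cases "k = m") auto
    then have "cf (f - mero_const (a m) * mero_monom m) (\<lambda>_. 0)"
      using cf_diff[OF a cf_scale[OF cf_monom, of "a m" m]] by (simp only:)
    then have "f = mero_const (a m) * mero_monom m"
      using cf_eq_0[of "f - mero_const (a m) * mero_monom m"] by simp
    with dm show ?thesis
      by (auto simp: monomials_def)
  qed
qed

end

text \<open>Jordan matrices have this form, and unlike Jordan matrices the matrices of this form are stable
  under Kronecker products.\<close>

definition coloured_triangular :: "nat \<Rightarrow> (nat \<Rightarrow> nat \<Rightarrow> complex) \<Rightarrow> bool" where
  "coloured_triangular n J \<longleftrightarrow>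
     (\<forall>i<n. \<forall>j<n. J i j \<noteq> 0 \<longrightarrow> i \<le> j \<and> J i i = J j j) \<and> (\<forall>i<n. J i i \<noteq> 0)"

lemma coloured_triangularD:
  assumes "coloured_triangular n J" "i < n"
  shows "J i i \<noteq> 0" "j < n \<Longrightarrow> J i j \<noteq> 0 \<Longrightarrow> i \<le> j" "j < n \<Longrightarrow> J i j \<noteq> 0 \<Longrightarrow> J j j = J i i"
proof -
  show "J i i \<noteq> 0"
    using assms unfolding coloured_triangular_def by blast
  assume "j < n" "J i j \<noteq> 0"
  with assms have "i \<le> j \<and> J i i = J j j"
    unfolding coloured_triangular_def by blast
  then show "i \<le> j" "J j j = J i i"
    by (blast, metis)
qed

text \<open>Back substitution from the lower left corner: the entries below \<open>T i j\<close> and to its left, which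
  enter its equation, belong to the same pair of eigenvalues.\<close>

lemma (in laurent_ring) triangular_solution_monomial:
  assumes q: "norm q > 1" and J: "coloured_triangular n J" and K: "coloured_triangular p K"
    and R: "\<And>i j. i < p \<Longrightarrow> j < n \<Longrightarrow> R (T i j)"
    and eq: "\<And>i j. i < p \<Longrightarrow> j < n \<Longrightarrow>
      (\<Sum>l<n. mero_shift q (T i l) * mero_const (J l j)) = (\<Sum>l<p. mero_const (K i l) * T l j)"
  shows "i < p \<Longrightarrow> j < n \<Longrightarrow> T i j \<in> monomials q (J j j) (K i i)"
proof (induction "(p - i) + j" arbitrary: i j rule: less_induct)
  case (less i j)
  have q0: "q \<noteq> 0" and c: "J j j \<noteq> 0"
    using q coloured_triangularD(1)[OF J less.prems(2)] by auto
  let ?M = "monomials q (J j j) (K i i)"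
  have 1: "mero_const (K i l) * T l j \<in> ?M" if "l \<in> {..<p} - {i}" for l
  proof (cases "K i l = 0")
    case False
    then have l: "i \<le> l" "K l l = K i i"
      using coloured_triangularD(2,3)[OF K less.prems(1), of l] that by blast+
    then have "i < l"
      using that by auto
    have "T l j \<in> monomials q (J j j) (K l l)"
      by (rule less.hyps) (use \<open>i < l\<close> that less.prems in auto)
    then show ?thesis
      unfolding l(2) by (rule monomials_scale)
  qed (simp add: mero_const_hom)
  have 2: "mero_shift q (T i l) * mero_const (J l j) \<in> ?M" if "l \<in> {..<n} - {j}" for l
  proof (cases "J l j = 0")
    case False
    then have l: "l \<le> j" "J j j = J l l"
      using coloured_triangularD(2,3)[OF J _ less.prems(2), of l] that by blast+
    then have "l < j"
      using that by auto
    have "T i l \<in> monomials q (J l l) (K i i)"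
      by (rule less.hyps) (use \<open>l < j\<close> that less.prems in auto)
    then show ?thesis
      unfolding l(2) by (subst mult.commute) (intro monomials_scale monomials_shift q0)
  qed (simp add: mero_const_hom)
  have "(\<Sum>l<n. mero_shift q (T i l) * mero_const (J l j)) =
      mero_const (J j j) * mero_shift q (T i j) +
      (\<Sum>l\<in>{..<n}-{j}. mero_shift q (T i l) * mero_const (J l j))"
    using less.prems by (subst sum.remove[of _ j]) (auto simp: mult.commute)
  moreover have "(\<Sum>l<p. mero_const (K i l) * T l j) = mero_const (K i i) * T i j +
      (\<Sum>l\<in>{..<p}-{i}. mero_const (K i l) * T l j)"
    using less.prems by (subst sum.remove[of _ i]) auto
  ultimately have "mero_const (J j j) * mero_shift q (T i j) - mero_const (K i i) * T i j =
      (\<Sum>l\<in>{..<p}-{i}. mero_const (K i l) * T l j) +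
      mero_const (- 1) * (\<Sum>l\<in>{..<n}-{j}. mero_shift q (T i l) * mero_const (J l j))"
    using eq[OF less.prems] by (simp add: mero_const_hom mero_const_uminus algebra_simps)
  also have "\<dots> \<in> ?M"
    by (intro monomials_add[OF q c] monomials_scale monomials_sum[OF q c] 1 2)
  finally show ?case
    by (intro q_difference_monomial[OF q c R]) (use less.prems in auto)
qed

section \<open>Matrix algebra\<close>

lemma mult_entry:
  assumes "A \<in> carrier_mat n m" "B \<in> carrier_mat m p" "i < n" "j < p"
  shows "(A * B) $$ (i, j) = (\<Sum>k<m. A $$ (i, k) * B $$ (k, j))"
  using assms by (simp add: scalar_prod_def lessThan_atLeast0)

lemma mat_eq_columnsI:
  fixes X Y :: "'a :: comm_ring_1 mat"
  assumes X: "X \<in> carrier_mat n k" and Y: "Y \<in> carrier_mat n k"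
    and eq: "\<And>C. C \<in> carrier_mat k 1 \<Longrightarrow> X * C = Y * C"
  shows "X = Y"
proof (rule eq_matI)
  fix i j assume ij: "i < dim_row Y" "j < dim_col Y"
  define C :: "'a mat" where "C = Matrix.mat k 1 (\<lambda>(l, _). if l = j then 1 else 0)"
  have C: "C \<in> carrier_mat k 1"
    by (simp add: C_def)
  have "(Z * C) $$ (i, 0) = Z $$ (i, j)" if "Z \<in> carrier_mat n k" for Z :: "'a mat"
    using ij Y by (subst mult_entry[OF that C])
      (auto simp: C_def if_distrib[of "times _"] cong: if_cong)
  from this[OF X] this[OF Y] eq[OF C] show "X $$ (i, j) = Y $$ (i, j)"
    by simp
qed (use X Y in auto)

lemma GL_memI:
  assumes "A \<in> carrier_mat n n" "B \<in> carrier_mat n n" "A * B = 1\<^sub>m n" "B * A = 1\<^sub>m n"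
  shows "A \<in> GL n" "mat_inv A = B"
proof -
  have "inverts_mat A B" "inverts_mat B A"
    using assms by (auto simp: inverts_mat_def)
  then show "A \<in> GL n" "mat_inv A = B"
    using assms by (auto simp: GL_def invertible_mat_def intro: mat_inv_eqI)
qed

lemma GL_carrier: "A \<in> GL n \<Longrightarrow> A \<in> carrier_mat n n"
  by (simp add: GL_def)

lemma mat_inv_GL:
  assumes "A \<in> GL n"
  shows "mat_inv A \<in> carrier_mat n n" "A * mat_inv A = 1\<^sub>m n" "mat_inv A * A = 1\<^sub>m n"
proof -
  have A: "A \<in> carrier_mat n n"
    using assms by (rule GL_carrier)
  obtain B where B: "inverts_mat A B" "inverts_mat B A"
    using assms by (auto simp: GL_def invertible_mat_def)
  have 1: "A * B = 1\<^sub>m n" "B * A = 1\<^sub>m (dim_row B)"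
    using A B by (auto simp: inverts_mat_def)
  have "dim_col (A * B) = n" "dim_col (B * A) = dim_row B"
    unfolding 1 by simp_all
  then have car: "B \<in> carrier_mat n n"
    using A by auto
  then show "mat_inv A \<in> carrier_mat n n" "A * mat_inv A = 1\<^sub>m n" "mat_inv A * A = 1\<^sub>m n"
    using 1 mat_inv_eqI[OF B] by auto
qed

lemma mat_inv_in_GL: "A \<in> GL n \<Longrightarrow> mat_inv A \<in> GL n"
  using mat_inv_GL[of A n] GL_carrier[of A n] GL_memI(1)[of "mat_inv A" n A] by blast

lemma GL_iff: "A \<in> GL n \<longleftrightarrow> A \<in> carrier_mat n n \<and> invertible_mat A"
  by (simp add: GL_def)

lemma GL_dim_unique: "A \<in> GL n \<Longrightarrow> dim_row A = n"
  by (auto simp: GL_def)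

lemma one_GL: "1\<^sub>m n \<in> GL n"
  by (rule GL_memI(1)[of _ _ "1\<^sub>m n"]) auto

lemma mat_cancel_left:
  fixes B Y X :: "'a :: comm_ring_1 mat"
  assumes "B * Y = 1\<^sub>m n" "B \<in> carrier_mat n m" "Y \<in> carrier_mat m n" "X \<in> carrier_mat n k"
  shows "B * (Y * X) = X"
  using assoc_mult_mat[OF assms(2-4)] left_mult_one_mat[OF assms(4)] by (simp only: assms(1))

text \<open>Associativity and cancellation with side conditions on dimensions, which the simplifier can
  check; the versions with carriers leave the middle dimensions undetermined.\<close>

lemma mat_assoc_dim:
  fixes A B C :: "'a :: comm_ring_1 mat"
  assumes "dim_col A = dim_row B" "dim_col B = dim_row C"
  shows "A * B * C = A * (B * C)"
  using carrier_matI[OF refl assms(1)] carrier_matI[OF refl assms(2)] carrier_matI[OF refl refl]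
  by (rule assoc_mult_mat)

lemma mat_cancel_dim:
  fixes B Y X :: "'a :: comm_ring_1 mat"
  assumes "B * Y = 1\<^sub>m n" "dim_col B = dim_row Y" "dim_row X = n"
  shows "B * (Y * X) = X"
proof -
  have n: "dim_row B = n" "dim_col Y = n"
    using arg_cong[OF assms(1), of dim_row] arg_cong[OF assms(1), of dim_col] by simp_all
  show ?thesis
    using assms(1) carrier_matI[OF n(1) assms(2)] carrier_matI[OF refl n(2)]
      carrier_matI[OF assms(3) refl]
    by (rule mat_cancel_left)
qed

lemma mat_one_right_dim: "dim_col X = n \<Longrightarrow> X * 1\<^sub>m n = (X :: 'a :: comm_ring_1 mat)"
  by (rule right_mult_one_mat[OF carrier_matI[OF refl]])

lemma GL_mult:
  assumes A: "A \<in> GL n" and B: "B \<in> GL n"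
  shows "A * B \<in> GL n" "mat_inv (A * B) = mat_inv B * mat_inv A"
proof -
  note c = GL_carrier[OF A] GL_carrier[OF B] mat_inv_GL[OF A] mat_inv_GL[OF B]
  have car: "A * B \<in> carrier_mat n n" "mat_inv B * mat_inv A \<in> carrier_mat n n"
    using c by (auto intro: mult_carrier_mat)
  have "A * B * (mat_inv B * mat_inv A) = A * (B * (mat_inv B * mat_inv A))"
    using c car by (intro assoc_mult_mat)
  then have 1: "A * B * (mat_inv B * mat_inv A) = 1\<^sub>m n"
    using c by (simp only: mat_cancel_left[of B "mat_inv B" n n "mat_inv A" n])
  have "mat_inv B * mat_inv A * (A * B) = mat_inv B * (mat_inv A * (A * B))"
    using c car by (intro assoc_mult_mat)
  then have 2: "mat_inv B * mat_inv A * (A * B) = 1\<^sub>m n"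
    using c by (simp only: mat_cancel_left[of "mat_inv A" A n n B n])
  from GL_memI[OF car 1 2] show "A * B \<in> GL n" "mat_inv (A * B) = mat_inv B * mat_inv A"
    by blast+
qed

text \<open>A retraction \<open>K\<^sup>n \<rightarrow> K\<^sup>r\<close> forces \<open>r \<le> n\<close>: otherwise, padding both matrices to
  square ones would give a square matrix with one-sided inverse and a zero row.\<close>

lemma left_inverse_dim:
  fixes L S :: "'a :: field mat"
  assumes L: "L \<in> carrier_mat r n" and S: "S \<in> carrier_mat n r" and LS: "L * S = 1\<^sub>m r"
  shows "r \<le> n"
proof (rule ccontr)
  assume "\<not> r \<le> n"
  then have nr: "n < r"
    by simp
  define L' where "L' = Matrix.mat r r (\<lambda>(i, j). if j < n then L $$ (i, j) else 0)"
  define S' where "S' = Matrix.mat r r (\<lambda>(i, j). if i < n then S $$ (i, j) else 0)"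
  have car: "L' \<in> carrier_mat r r" "S' \<in> carrier_mat r r"
    by (auto simp: L'_def S'_def)
  have "L' * S' = L * S"
  proof (rule eq_matI)
    fix i j assume ij: "i < dim_row (L * S)" "j < dim_col (L * S)"
    then have ij: "i < r" "j < r"
      using L S by auto
    have "(L' * S') $$ (i, j) = (\<Sum>k<r. if k < n then L $$ (i, k) * S $$ (k, j) else 0)"
      using ij by (subst mult_entry[OF car]) (auto simp: L'_def S'_def intro!: sum.cong)
    also have "\<dots> = (\<Sum>k<n. L $$ (i, k) * S $$ (k, j))"
      using nr by (intro sum.mono_neutral_cong_right) auto
    also have "\<dots> = (L * S) $$ (i, j)"
      using ij by (subst mult_entry[OF L S]) auto
    finally show "(L' * S') $$ (i, j) = (L * S) $$ (i, j)" .
  qed (use L S car in auto)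
  then have "S' * L' = 1\<^sub>m r"
    using mat_mult_left_right_inverse[OF car] LS by simp
  moreover have "(S' * L') $$ (n, n) = 0"
    using nr by (subst mult_entry[OF car(2,1)]) (auto simp: S'_def)
  ultimately show False
    using nr by simp
qed

text \<open>Among the retractions onto subspaces of \<open>W\<close> one of largest rank works: a vector of \<open>W\<close> outside
  its image, reduced modulo the image, together with a dual functional would extend it.\<close>

lemma subspace_projector:
  fixes W :: "'a :: field mat set"
  assumes sub: "W \<subseteq> carrier_mat n 1" and zero: "0\<^sub>m n 1 \<in> W"
    and add: "\<And>v w. v \<in> W \<Longrightarrow> w \<in> W \<Longrightarrow> v + w \<in> W"
    and scale: "\<And>c w. w \<in> W \<Longrightarrow> c \<cdot>\<^sub>m w \<in> W"
  obtains r S L where "S \<in> carrier_mat n r" "L \<in> carrier_mat r n" "L * S = 1\<^sub>m r"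
    "\<And>w. w \<in> W \<longleftrightarrow> w \<in> carrier_mat n 1 \<and> S * (L * w) = w"
proof -
  define P where "P r \<longleftrightarrow> (\<exists>S L. S \<in> carrier_mat n r \<and> L \<in> carrier_mat r n \<and> L * S = 1\<^sub>m r \<and>
    (\<forall>C \<in> carrier_mat r 1. S * C \<in> W))" for r
  have "P 0"
    unfolding P_def using zero
    by (intro exI[of _ "0\<^sub>m n 0"] exI[of _ "0\<^sub>m 0 n"]) (auto intro!: eq_matI)
  moreover have bound: "P r \<Longrightarrow> r \<le> n" for r
    unfolding P_def using left_inverse_dim by blast
  ultimately have "P (Greatest P)"
    by (rule GreatestI_nat)
  then obtain S L where S: "S \<in> carrier_mat n (Greatest P)" and L: "L \<in> carrier_mat (Greatest P) n"
    and LS: "L * S = 1\<^sub>m (Greatest P)" and SW: "\<And>C. C \<in> carrier_mat (Greatest P) 1 \<Longrightarrow> S * C \<in> W"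
    unfolding P_def by blast
  define r where "r = Greatest P"
  note S = S[folded r_def] and L = L[folded r_def] and LS = LS[folded r_def]
    and SW = SW[folded r_def]
  have max: "\<not> P (r + 1)"
    using Greatest_le_nat[of P "r + 1" n] bound unfolding r_def by auto
  have "S * (L * w) = w" if w: "w \<in> W" for w
  proof (rule ccontr)
    assume ne: "S * (L * w) \<noteq> w"
    have wc: "w \<in> carrier_mat n 1"
      using w sub by blast
    define w' where "w' = w + (-1) \<cdot>\<^sub>m (S * (L * w))"
    have Lw: "L * w \<in> carrier_mat r 1" and SLw: "S * (L * w) \<in> carrier_mat n 1"
      using L S wc by auto
    have w'W: "w' \<in> W" and w'c: "w' \<in> carrier_mat n 1"
      unfolding w'_def using w wc SLw SW[OF Lw] by (auto intro: add scale)
    have "L * (S * (L * w)) = L * w"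
      using assoc_mult_mat[OF L S Lw] LS left_mult_one_mat[OF Lw] by simp
    then have Lw': "L * w' = 0\<^sub>m r 1"
      unfolding w'_def using L Lw wc SLw
      by (subst mult_add_distrib_mat[OF L wc], simp, subst mult_smult_distrib[OF L SLw])
        (auto intro!: eq_matI)
    have "\<exists>i<n. w' $$ (i, 0) \<noteq> 0"
    proof (rule ccontr)
      assume "\<not> ?thesis"
      then have "w' $$ (i, 0) = 0" if "i < n" for i
        using that by blast
      then have "S * (L * w) = w"
        using wc SLw unfolding w'_def by (intro eq_matI) auto
      then show False
        using ne by blast
    qed
    then obtain i0 where i0: "i0 < n" "w' $$ (i0, 0) \<noteq> 0"
      by blast
    define l0 where "l0 = Matrix.mat 1 n (\<lambda>(_, j). if j = i0 then 1 / w' $$ (i0, 0) else 0)"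
    have l0: "l0 \<in> carrier_mat 1 n"
      by (simp add: l0_def)
    have l0w': "l0 * w' = 1\<^sub>m 1"
    proof (rule eq_matI)
      fix i j :: nat assume "i < dim_row (1\<^sub>m 1 :: 'a mat)" "j < dim_col (1\<^sub>m 1 :: 'a mat)"
      then have "i = 0" "j = 0"
        by auto
      moreover have "(l0 * w') $$ (0, 0) = 1"
        using i0 by (subst mult_entry[OF l0 w'c])
          (auto simp: l0_def if_distrib[of "\<lambda>x. x * _"] cong: if_cong)
      ultimately show "(l0 * w') $$ (i, j) = 1\<^sub>m 1 $$ (i, j)"
        by simp
    qed (use l0 w'c in auto)
    \<comment> \<open>the functional \<open>l0\<close>, corrected to vanish on the image of \<open>S\<close>\<close>
    define l where "l = l0 + (-1) \<cdot>\<^sub>m (l0 * S * L)"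
    have l0S: "l0 * S \<in> carrier_mat 1 r" and l0SL: "l0 * S * L \<in> carrier_mat 1 n"
      using l0 S L by auto
    have l: "l \<in> carrier_mat 1 n"
      unfolding l_def using l0 l0SL by auto
    have "l0 * S * L * S = l0 * S"
      using assoc_mult_mat[OF l0S L S] LS right_mult_one_mat[OF l0S] by simp
    then have lS: "l * S = 0\<^sub>m 1 r"
      unfolding l_def using l0S l0 S l0SL
      by (subst add_mult_distrib_mat[OF l0 _ S], simp, subst mult_smult_assoc_mat[OF l0SL S])
        (auto intro!: eq_matI)
    have "l0 * S * L * w' = 0\<^sub>m 1 1"
      using assoc_mult_mat[OF l0S L w'c] right_mult_zero_mat[OF l0S] by (simp only: Lw')
    then have lw': "l * w' = 1\<^sub>m 1"
      unfolding l_def using l0w' l0 w'c l0SL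
      by (subst add_mult_distrib_mat[OF l0 _ w'c], simp, subst mult_smult_assoc_mat[OF l0SL w'c])
        (auto intro!: eq_matI)
    let ?S = "four_block_mat S w' (0\<^sub>m 0 r) (0\<^sub>m 0 1)"
    let ?L = "four_block_mat L (0\<^sub>m r 0) l (0\<^sub>m 1 0)"
    have Sc: "?S \<in> carrier_mat n (r + 1)" and Lc: "?L \<in> carrier_mat (r + 1) n"
      using S w'c L l by auto
    have "?L * ?S = four_block_mat (L * S + 0\<^sub>m r 0 * 0\<^sub>m 0 r) (L * w' + 0\<^sub>m r 0 * 0\<^sub>m 0 1)
        (l * S + 0\<^sub>m 1 0 * 0\<^sub>m 0 r) (l * w' + 0\<^sub>m 1 0 * 0\<^sub>m 0 1)"
      by (rule mult_four_block_mat) (use S w'c L l in auto)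
    also have "\<dots> = four_block_mat (1\<^sub>m r) (0\<^sub>m r 1) (0\<^sub>m 1 r) (1\<^sub>m 1)"
      using LS Lw' lS lw' by (intro arg_cong4[where f = four_block_mat]) (auto intro!: eq_matI simp: scalar_prod_def)
    finally have "?L * ?S = 1\<^sub>m (r + 1)"
      by simp
    moreover have "?S * C \<in> W" if C: "C \<in> carrier_mat (r + 1) 1" for C
    proof -
      define C1 where "C1 = Matrix.mat r 1 (\<lambda>(i, _). C $$ (i, 0))"
      have C1: "C1 \<in> carrier_mat r 1"
        by (simp add: C1_def)
      have "?S * C = S * C1 + C $$ (r, 0) \<cdot>\<^sub>m w'"
      proof (rule eq_matI)
        fix i j assume ij: "i < dim_row (S * C1 + C $$ (r, 0) \<cdot>\<^sub>m w')"
          "j < dim_col (S * C1 + C $$ (r, 0) \<cdot>\<^sub>m w')"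
        then have ij: "i < n" "j = 0"
          using w'c by auto
        have "(?S * C) $$ (i, 0) = (\<Sum>k<r. S $$ (i, k) * C $$ (k, 0)) + w' $$ (i, 0) * C $$ (r, 0)"
          using ij S w'c by (subst mult_entry[OF Sc C]) auto
        also have "(\<Sum>k<r. S $$ (i, k) * C $$ (k, 0)) = (S * C1) $$ (i, 0)"
          using ij by (subst mult_entry[OF S C1]) (auto simp: C1_def)
        finally show "(?S * C) $$ (i, j) = (S * C1 + C $$ (r, 0) \<cdot>\<^sub>m w') $$ (i, j)"
          using ij S w'c C1 by (auto simp: mult.commute)
      qed (use Sc C w'c S in auto)
      then show ?thesis
        using SW[OF C1] w'W by (auto intro: add scale)
    qed
    ultimately have "P (r + 1)"
      unfolding P_def using Sc Lc by blast
    with max show False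
      by blast
  qed
  moreover have "w \<in> W" if "w \<in> carrier_mat n 1" "S * (L * w) = w" for w
    using SW[of "L * w"] L that by auto
  ultimately have "w \<in> W \<longleftrightarrow> w \<in> carrier_mat n 1 \<and> S * (L * w) = w" for w
    using sub by blast
  with S L LS show thesis
    by (rule that)
qed

subsection \<open>Kronecker products\<close>

lemma kronecker_dim [simp]:
  "dim_row (kronecker A B) = dim_row A * dim_row B"
  "dim_col (kronecker A B) = dim_col A * dim_col B"
  by (simp_all add: kronecker_def)

lemma kronecker_carrier [intro]:
  "A \<in> carrier_mat n m \<Longrightarrow> B \<in> carrier_mat p r \<Longrightarrow> kronecker A B \<in> carrier_mat (n * p) (m * r)"
  by auto

lemma kronecker_entry:
  "i < n * p \<Longrightarrow> j < m * r \<Longrightarrow> A \<in> carrier_mat n m \<Longrightarrow> B \<in> carrier_mat p r \<Longrightarrow>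
    kronecker A B $$ (i, j) = A $$ (i div p, j div r) * B $$ (i mod p, j mod r)"
  by (auto simp: kronecker_def)

lemma div_mod_less:
  fixes i :: nat assumes "i < n * p" shows "i div p < n" "i mod p < p"
proof -
  have "p > 0"
    using assms by (cases p) auto
  then show "i div p < n" "i mod p < p"
    using assms by (auto simp: less_mult_imp_div_less)
qed

lemma sum_div_mod:
  fixes f :: "nat \<Rightarrow> nat \<Rightarrow> 'a :: comm_monoid_add"
  shows "(\<Sum>t<m * r. f (t div r) (t mod r)) = (\<Sum>a<m. \<Sum>b<r. f a b)"
proof -
  have "(\<Sum>t<m * r. f (t div r) (t mod r)) = (\<Sum>a<m. \<Sum>t\<in>{a * r..<a * r + r}. f (t div r) (t mod r))"
    by (rule sum.nat_group[symmetric])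
  also have "\<dots> = (\<Sum>a<m. \<Sum>b<r. f a b)"
  proof (rule sum.cong[OF refl])
    fix a
    have "(\<Sum>t\<in>{a * r..<a * r + r}. f (t div r) (t mod r)) =
        (\<Sum>t\<in>{0..<r}. f ((t + a * r) div r) ((t + a * r) mod r))"
      using sum.shift_bounds_nat_ivl[of "\<lambda>t. f (t div r) (t mod r)" 0 "a * r" r]
      by (simp add: add.commute)
    also have "\<dots> = (\<Sum>b<r. f a b)"
      by (intro sum.cong) auto
    finally show "(\<Sum>t\<in>{a * r..<a * r + r}. f (t div r) (t mod r)) = (\<Sum>b<r. f a b)" .
  qed
  finally show ?thesis .
qed

lemma kronecker_mult:
  fixes A B C D :: "'a :: comm_ring_1 mat"
  assumes A: "A \<in> carrier_mat n m" and C: "C \<in> carrier_mat m k"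
    and B: "B \<in> carrier_mat p r" and D: "D \<in> carrier_mat r s"
  shows "kronecker A B * kronecker C D = kronecker (A * C) (B * D)"
proof (rule eq_matI)
  note AB = kronecker_carrier[OF A B] and CD = kronecker_carrier[OF C D]
  fix i j assume "i < dim_row (kronecker (A * C) (B * D))" "j < dim_col (kronecker (A * C) (B * D))"
  then have i: "i < n * p" and j: "j < k * s"
    using A B C D by auto
  let ?f = "\<lambda>a b. A $$ (i div p, a) * B $$ (i mod p, b) * (C $$ (a, j div s) * D $$ (b, j mod s))"
  have "(kronecker A B * kronecker C D) $$ (i, j) = (\<Sum>t<m * r. ?f (t div r) (t mod r))"
    using i j by (subst mult_entry[OF AB CD]) (auto intro!: sum.cong
        simp: kronecker_entry[OF _ _ A B] kronecker_entry[OF _ _ C D])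
  also have "\<dots> = (\<Sum>a<m. \<Sum>b<r. ?f a b)"
    by (rule sum_div_mod)
  also have "\<dots> = (\<Sum>a<m. A $$ (i div p, a) * C $$ (a, j div s)) *
      (\<Sum>b<r. B $$ (i mod p, b) * D $$ (b, j mod s))"
    by (simp add: sum_product algebra_simps)
  also have "\<dots> = kronecker (A * C) (B * D) $$ (i, j)"
    using div_mod_less[OF i] div_mod_less[OF j]
    by (simp only: kronecker_entry[OF i j mult_carrier_mat[OF A C] mult_carrier_mat[OF B D]]
        mult_entry[OF A C] mult_entry[OF B D])
  finally show "(kronecker A B * kronecker C D) $$ (i, j) = kronecker (A * C) (B * D) $$ (i, j)" .
qed (use assms in auto)

lemma kronecker_one: "kronecker (1\<^sub>m n) (1\<^sub>m p) = (1\<^sub>m (n * p) :: 'a :: comm_ring_1 mat)"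
proof (rule eq_matI)
  fix i j assume "i < dim_row (1\<^sub>m (n * p) :: 'a mat)" "j < dim_col (1\<^sub>m (n * p) :: 'a mat)"
  then have ij: "i < n * p" "j < n * p"
    by auto
  have "i = j \<longleftrightarrow> i div p = j div p \<and> i mod p = j mod p"
    by (metis div_mult_mod_eq)
  with ij show "kronecker (1\<^sub>m n) (1\<^sub>m p) $$ (i, j) = (1\<^sub>m (n * p) :: 'a mat) $$ (i, j)"
    using div_mod_less[OF ij(1)] div_mod_less[OF ij(2)]
    by (simp add: kronecker_entry[OF ij one_carrier_mat one_carrier_mat])
qed auto

lemma kronecker_GL:
  fixes A B :: "'a :: comm_ring_1 mat"
  assumes A: "A \<in> GL n" and B: "B \<in> GL p"
  shows "kronecker A B \<in> GL (n * p)" "mat_inv (kronecker A B) = kronecker (mat_inv A) (mat_inv B)"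
proof -
  note c = GL_carrier[OF A] GL_carrier[OF B] mat_inv_GL[OF A] mat_inv_GL[OF B]
  have "kronecker A B * kronecker (mat_inv A) (mat_inv B) = 1\<^sub>m (n * p)"
    "kronecker (mat_inv A) (mat_inv B) * kronecker A B = 1\<^sub>m (n * p)"
    using c by (simp_all add: kronecker_mult[of _ n n _ n _ p p _ p] kronecker_one)
  then show "kronecker A B \<in> GL (n * p)" "mat_inv (kronecker A B) = kronecker (mat_inv A) (mat_inv B)"
    using GL_memI[of "kronecker A B" "n * p" "kronecker (mat_inv A) (mat_inv B)"] c by auto
qed

lemma kronecker_map:
  assumes "\<And>i j k l. i < dim_row A \<Longrightarrow> j < dim_col A \<Longrightarrow> k < dim_row B \<Longrightarrow> l < dim_col B \<Longrightarrow>
    h (A $$ (i, j) * B $$ (k, l)) = h (A $$ (i, j)) * h (B $$ (k, l))"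
  shows "map_mat h (kronecker A B) = kronecker (map_mat h A) (map_mat h B)"
  by (rule eq_matI) (auto simp: kronecker_def div_mod_less intro!: assms)

subsection \<open>Direct sums\<close>

definition mat_direct_sum :: "'a :: comm_ring_1 mat \<Rightarrow> 'a mat \<Rightarrow> 'a mat" where
  "mat_direct_sum A B = four_block_mat A (0\<^sub>m (dim_row A) (dim_col B)) (0\<^sub>m (dim_row B) (dim_col A)) B"

definition incl1 :: "nat \<Rightarrow> nat \<Rightarrow> 'a :: comm_ring_1 mat" where
  "incl1 n p = four_block_mat (1\<^sub>m n) (0\<^sub>m n 0) (0\<^sub>m p n) (0\<^sub>m p 0)"

definition incl2 :: "nat \<Rightarrow> nat \<Rightarrow> 'a :: comm_ring_1 mat" where
  "incl2 n p = four_block_mat (0\<^sub>m n p) (0\<^sub>m n 0) (1\<^sub>m p) (0\<^sub>m p 0)"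

definition row_append :: "'a :: comm_ring_1 mat \<Rightarrow> 'a mat \<Rightarrow> 'a mat" where
  "row_append U V = four_block_mat U V (0\<^sub>m 0 (dim_col U)) (0\<^sub>m 0 (dim_col V))"

lemma mat_direct_sum_carrier:
  "A \<in> carrier_mat n m \<Longrightarrow> B \<in> carrier_mat p r \<Longrightarrow> mat_direct_sum A B \<in> carrier_mat (n + p) (m + r)"
  by (auto simp: mat_direct_sum_def)

lemma incl_carrier:
  "incl1 n p \<in> carrier_mat (n + p) n" "incl2 n p \<in> carrier_mat (n + p) p"
  by (auto simp: incl1_def incl2_def)

lemma row_append_carrier:
  "U \<in> carrier_mat k n \<Longrightarrow> V \<in> carrier_mat k p \<Longrightarrow> row_append U V \<in> carrier_mat k (n + p)"
  by (auto simp: row_append_def)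

lemma mat_direct_sum_mult:
  assumes "A \<in> carrier_mat n m" "B \<in> carrier_mat p r" "C \<in> carrier_mat m k" "D \<in> carrier_mat r s"
  shows "mat_direct_sum A B * mat_direct_sum C D = mat_direct_sum (A * C) (B * D)"
  using assms unfolding mat_direct_sum_def
  by (subst mult_four_block_mat[of _ n m _ r _ p _ _ k _ s]) auto

lemma mat_direct_sum_one: "mat_direct_sum (1\<^sub>m n) (1\<^sub>m p) = 1\<^sub>m (n + p)"
  by (simp add: mat_direct_sum_def)

lemma mat_direct_sum_GL:
  fixes A B :: "'a :: comm_ring_1 mat"
  assumes A: "A \<in> GL n" and B: "B \<in> GL p"
  shows "mat_direct_sum A B \<in> GL (n + p)" "mat_inv (mat_direct_sum A B) = mat_direct_sum (mat_inv A) (mat_inv B)"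
proof -
  note c = GL_carrier[OF A] GL_carrier[OF B] mat_inv_GL[OF A] mat_inv_GL[OF B]
  have 1: "mat_direct_sum A B * mat_direct_sum (mat_inv A) (mat_inv B) = 1\<^sub>m (n + p)"
    "mat_direct_sum (mat_inv A) (mat_inv B) * mat_direct_sum A B = 1\<^sub>m (n + p)"
    using c by (simp_all add: mat_direct_sum_mult[of _ n n _ p p _ n _ p] mat_direct_sum_one)
  show "mat_direct_sum A B \<in> GL (n + p)" "mat_inv (mat_direct_sum A B) = mat_direct_sum (mat_inv A) (mat_inv B)"
    by (rule GL_memI[OF _ _ 1]; use c in \<open>auto intro: mat_direct_sum_carrier\<close>)+
qed

lemma mat_direct_sum_incl:
  assumes "A \<in> carrier_mat n m" "B \<in> carrier_mat p r"
  shows "mat_direct_sum A B * incl1 m r = incl1 n p * A" "mat_direct_sum A B * incl2 m r = incl2 n p * B"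
proof -
  have "four_block_mat X (0\<^sub>m n 0) Y (0\<^sub>m p 0) = four_block_mat (1\<^sub>m n) (0\<^sub>m n 0) (0\<^sub>m p n) (0\<^sub>m p 0) * X"
    if "X \<in> carrier_mat n m" "Y = 0\<^sub>m p m" for X Y :: "'a mat"
    using that by (intro eq_matI)
      (auto simp: scalar_prod_def if_distrib[of "\<lambda>x. x * _"] cong: if_cong)
  then show "mat_direct_sum A B * incl1 m r = incl1 n p * A"
    using assms unfolding mat_direct_sum_def incl1_def
    by (subst mult_four_block_mat[of _ n m _ r _ p _ _ m _ 0]) auto
  have "four_block_mat Y (0\<^sub>m n 0) X (0\<^sub>m p 0) = four_block_mat (0\<^sub>m n p) (0\<^sub>m n 0) (1\<^sub>m p) (0\<^sub>m p 0) * X"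
    if "X \<in> carrier_mat p r" "Y = 0\<^sub>m n r" for X Y :: "'a mat"
    using that by (intro eq_matI)
      (auto simp: scalar_prod_def if_distrib[of "\<lambda>x. x * _"] cong: if_cong)
  then show "mat_direct_sum A B * incl2 m r = incl2 n p * B"
    using assms unfolding mat_direct_sum_def incl2_def
    by (subst mult_four_block_mat[of _ n m _ r _ p _ _ r _ 0]) auto
qed

lemma row_append_incl:
  assumes "U \<in> carrier_mat k n" "V \<in> carrier_mat k p"
  shows "row_append U V * incl1 n p = U" "row_append U V * incl2 n p = V"
proof -
  have "four_block_mat X (0\<^sub>m k 0) (0\<^sub>m 0 c) (0\<^sub>m 0 0) = X" if "X \<in> carrier_mat k c" for X :: "'a mat" and c
    using that by (intro eq_matI) auto
  then show "row_append U V * incl1 n p = U" "row_append U V * incl2 n p = V"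
    using assms unfolding row_append_def incl1_def incl2_def
    by (subst mult_four_block_mat[of _ k n _ p _ 0]; auto)+
qed

lemma incl_map:
  assumes "h 0 = 0" "h 1 = 1"
  shows "map_mat h (incl1 n p) = incl1 n p" "map_mat h (incl2 n p) = incl2 n p"
  using assms by (auto simp: incl1_def incl2_def intro!: eq_matI)

section \<open>Matrices of meromorphic functions\<close>

definition mat_regular :: "complex \<Rightarrow> mero mat \<Rightarrow> bool" where
  "mat_regular z M \<longleftrightarrow> (\<forall>i<dim_row M. \<forall>j<dim_col M. mero_regular z (M $$ (i, j)))"

lemma mat_regular_iff: "z \<noteq> 0 \<Longrightarrow> mat_regular z M \<longleftrightarrow> z \<notin> poles_mat M"
  by (fastforce simp: mat_regular_def poles_mat_def mero_regular_def)

lemma mat_regular_entry: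
  "mat_regular z M \<Longrightarrow> M \<in> carrier_mat n m \<Longrightarrow> i < n \<Longrightarrow> j < m \<Longrightarrow> mero_regular z (M $$ (i, j))"
  by (auto simp: mat_regular_def)

lemma mat_mult_eval:
  assumes z: "z \<noteq> 0" and M: "M \<in> carrier_mat n m" "mat_regular z M"
    and N: "N \<in> carrier_mat m k" "mat_regular z N"
  shows "mat_regular z (M * N)" "eval_mat z (M * N) = eval_mat z M * eval_mat z N"
proof -
  have *: "mero_regular z ((M * N) $$ (i, j)) \<and> mero_eval ((M * N) $$ (i, j)) z =
      (eval_mat z M * eval_mat z N) $$ (i, j)" if "i < n" "j < k" for i j
  proof -
    have r: "mero_regular z (M $$ (i, l))" "mero_regular z (N $$ (l, j))" if "l < m" for l
      using mat_regular_entry[OF M(2,1)] mat_regular_entry[OF N(2,1)] \<open>i < n\<close> \<open>j < k\<close> that by auto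
    have "eval_mat z M \<in> carrier_mat n m" "eval_mat z N \<in> carrier_mat m k"
      using M N by auto
    then have "(eval_mat z M * eval_mat z N) $$ (i, j) =
        (\<Sum>l<m. mero_eval (M $$ (i, l) * N $$ (l, j)) z)"
      using that M(1) N(1) r by (subst mult_entry[of _ n m _ k]) (auto simp: eval_mult)
    moreover have "(M * N) $$ (i, j) = (\<Sum>l<m. M $$ (i, l) * N $$ (l, j))"
      using that by (rule mult_entry[OF M(1) N(1)])
    ultimately show ?thesis
      using regular_eval_sum[OF z, of "{..<m}" "\<lambda>l. M $$ (i, l) * N $$ (l, j)"] r by auto
  qed
  show "mat_regular z (M * N)"
    using * M(1) N(1) by (auto simp: mat_regular_def simp del: index_mult_mat(1))
  show "eval_mat z (M * N) = eval_mat z M * eval_mat z N"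
    using * M(1) N(1) by (intro eq_matI) (auto simp del: index_mult_mat(1))
qed

lemma mat_regular_const [simp]: "z \<noteq> 0 \<Longrightarrow> mat_regular z (const_mat A)"
  by (auto simp: mat_regular_def)

lemma eval_mat_const [simp]: "z \<noteq> 0 \<Longrightarrow> eval_mat z (const_mat A) = A"
  by (intro eq_matI) auto

lemma const_mat_one [simp]: "const_mat (1\<^sub>m n) = 1\<^sub>m n"
  by (intro eq_matI) (auto simp: mero_const_hom)

lemma semiring_hom_const: "semiring_hom mero_const"
  by unfold_locales (simp_all add: mero_const_hom)

lemma semiring_hom_shift: "semiring_hom (mero_shift q)"
  by unfold_locales (simp_all add: mero_shift_hom)

lemmas const_mat_mult = semiring_hom.mat_hom_mult[OF semiring_hom_const]

lemmas shift_mat_mult = semiring_hom.mat_hom_mult[OF semiring_hom_shift]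

lemma shift_mat_const [simp]: "shift_mat q (const_mat A) = const_mat A"
  by (intro eq_matI) (auto simp: mero_shift_hom)

lemma shift_mat_one [simp]: "shift_mat q (1\<^sub>m n) = 1\<^sub>m n"
  by (intro eq_matI) auto

lemma mat_regular_one [simp]: "z \<noteq> 0 \<Longrightarrow> mat_regular z (1\<^sub>m n)"
  and eval_mat_one [simp]: "z \<noteq> 0 \<Longrightarrow> eval_mat z (1\<^sub>m n) = 1\<^sub>m n"
  using mat_regular_const[of z "1\<^sub>m n"] eval_mat_const[of z "1\<^sub>m n"] by simp_all

lemma eval_mat_shift:
  assumes "q \<noteq> 0" "mat_regular (q * z) M"
  shows "mat_regular z (shift_mat q M)" "eval_mat z (shift_mat q M) = eval_mat (q * z) M"
  using assms by (auto simp: mat_regular_def regular_shift eval_shift intro!: eq_matI)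

lemma kronecker_regular:
  assumes "mat_regular z M" "mat_regular z N"
  shows "mat_regular z (kronecker M N)"
  using assms by (auto simp: mat_regular_def kronecker_def div_mod_less)

lemma kronecker_eval:
  "mat_regular z M \<Longrightarrow> mat_regular z N \<Longrightarrow>
    eval_mat z (kronecker M N) = kronecker (eval_mat z M) (eval_mat z N)"
  by (rule kronecker_map) (auto simp: mat_regular_def eval_mult)

lemma mat_eq_evalI:
  assumes Z: "countable Z" and M: "M \<in> carrier_mat n m" and N: "N \<in> carrier_mat n m"
    and eq: "\<And>z. z \<noteq> 0 \<Longrightarrow> z \<notin> Z \<Longrightarrow>
      mat_regular z M \<and> mat_regular z N \<and> eval_mat z M = eval_mat z N"
  shows "M = N"
proof (rule eq_matI)
  fix i j assume ij: "i < dim_row N" "j < dim_col N"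
  let ?f = "M $$ (i, j)" and ?g = "N $$ (i, j)"
  have "?f + mero_const (- 1) * ?g = 0"
  proof (rule mero_eq_0_if_eval_0[OF Z])
    fix z :: complex assume z: "z \<noteq> 0" "z \<notin> Z"
    have r: "mero_regular z ?f" "mero_regular z ?g"
      using eq[OF z] ij M N by (auto simp: mat_regular_def)
    have "eval_mat z M $$ (i, j) = eval_mat z N $$ (i, j)"
      using eq[OF z] by simp
    then have "mero_eval ?f z = mero_eval ?g z"
      using ij M N by auto
    moreover have "mero_eval (?f + mero_const (- 1) * ?g) z = mero_eval ?f z + (- 1) * mero_eval ?g z"
      using r z(1) by (subst eval_add) (auto simp: eval_mult intro!: regular_mult)
    ultimately show "mero_eval (?f + mero_const (- 1) * ?g) z = 0"
      by simp
  qed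
  then show "?f = ?g"
    by (simp add: mero_const_uminus mero_const_hom)
qed (use M N in auto)

section \<open>Spectral data\<close>

text \<open>The columns of \<open>P\<close> form a basis of generalized eigenvectors of \<open>A\<close>, and the diagonal of \<open>J\<close>
  lists their eigenvalues.\<close>

definition spectral_data ::
  "nat \<Rightarrow> complex mat \<Rightarrow> complex mat \<Rightarrow> complex mat \<Rightarrow> complex mat \<Rightarrow> bool" where
  "spectral_data n A P P' J \<longleftrightarrow>
     P \<in> carrier_mat n n \<and> P' \<in> carrier_mat n n \<and> J \<in> carrier_mat n n \<and>
     P * P' = 1\<^sub>m n \<and> P' * P = 1\<^sub>m n \<and> A = P * J * P' \<and>
     coloured_triangular n (\<lambda>i j. J $$ (i, j))"

lemma jordan_matrix_coloured:
  assumes "i < sum_list (map fst n_as)" "j < sum_list (map fst n_as)"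
    "jordan_matrix n_as $$ (i, j) \<noteq> (0 :: 'a :: comm_ring_1)"
  shows "jordan_matrix n_as $$ (i, i) = jordan_matrix n_as $$ (j, j)"
  using assms
proof (induction n_as arbitrary: i j)
  case (Cons na n_as)
  obtain m a where na: "na = (m, a)"
    by (cases na)
  have J: "jordan_matrix (na # n_as) = four_block_mat (jordan_block m a)
      (0\<^sub>m m (sum_list (map fst n_as))) (0\<^sub>m (sum_list (map fst n_as)) m) (jordan_matrix n_as)"
    by (auto simp: na jordan_matrix_def Let_def)
      (metis jordan_matrix_def jordan_matrix_dim)+
  show ?case
    using Cons.prems Cons.IH[of "i - m" "j - m"] unfolding J
    by (auto simp: na jordan_block_def split: if_splits)
qed simp

lemma spectral_data_exists:
  assumes A: "A \<in> GL n"
  shows "\<exists>P P' J. spectral_data n A P P' J"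
proof -
  have Ac: "A \<in> carrier_mat n n"
    using A by (rule GL_carrier)
  obtain as where "char_poly A = (\<Prod>a\<leftarrow>as. [:- a, 1:])"
    using char_poly_factorized[OF Ac] by blast
  then obtain n_as where "jordan_nf A n_as"
    using jordan_nf_exists[OF Ac] by blast
  then obtain P P' where sim: "similar_mat_wit A (jordan_matrix n_as) P P'"
    by (auto simp: jordan_nf_def similar_mat_def)
  define J :: "complex mat" where "J = jordan_matrix n_as"
  have car: "P \<in> carrier_mat n n" "P' \<in> carrier_mat n n" "J \<in> carrier_mat n n"
    and inv: "P * P' = 1\<^sub>m n" "P' * P = 1\<^sub>m n" and AJ: "A = P * J * P'"
    using similar_mat_witD2[OF Ac sim] by (auto simp: J_def)
  have dim: "sum_list (map fst n_as) = n"
    using car(3) unfolding J_def by auto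
  have tri: "i \<le> j" if "i < n" "j < n" "J $$ (i, j) \<noteq> 0" for i j
    using jordan_matrix_upper_triangular[of i n_as j] that dim unfolding J_def by force
  have "det A \<noteq> 0"
  proof -
    have "det A * det (mat_inv A) = 1"
      using det_mult[OF Ac mat_inv_GL(1)[OF A]] mat_inv_GL(2)[OF A] by simp
    then show ?thesis
      by auto
  qed
  moreover have "det A = det P * det J * det P'"
    using car by (simp add: AJ det_mult[of _ n] del: assoc_mult_mat)
  ultimately have "det J \<noteq> 0"
    by auto
  moreover have "det J = prod_list (diag_mat J)"
    by (rule det_upper_triangular[OF _ car(3)])
      (simp add: upper_triangular_def J_def jordan_matrix_upper_triangular)
  ultimately have "J $$ (i, i) \<noteq> 0" if "i < n" for i
    using that car(3) by (force simp: diag_mat_def prod_list_zero_iff)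
  moreover have "J $$ (i, i) = J $$ (j, j)" if "i < n" "j < n" "J $$ (i, j) \<noteq> 0" for i j
    using jordan_matrix_coloured[of i n_as j] that dim unfolding J_def by blast
  ultimately have "coloured_triangular n (\<lambda>i j. J $$ (i, j))"
    unfolding coloured_triangular_def using tri by blast
  with car inv AJ show ?thesis
    unfolding spectral_data_def by blast
qed

lemma spectral_data_kronecker:
  assumes A: "spectral_data n A P P' J" and B: "spectral_data p B Q Q' K"
  shows "spectral_data (n * p) (kronecker A B) (kronecker P Q) (kronecker P' Q') (kronecker J K)"
proof -
  note a = A[unfolded spectral_data_def] and b = B[unfolded spectral_data_def]
  have J: "coloured_triangular n (\<lambda>i j. J $$ (i, j))" and K: "coloured_triangular p (\<lambda>i j. K $$ (i, j))"
    using a b by blast+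
  have JK: "kronecker J K $$ (i, j) = J $$ (i div p, j div p) * K $$ (i mod p, j mod p)"
    if "i < n * p" "j < n * p" for i j
    using kronecker_entry[OF that] a b by blast
  have "coloured_triangular (n * p) (\<lambda>i j. kronecker J K $$ (i, j))"
    unfolding coloured_triangular_def
  proof (intro conjI allI impI)
    fix i j assume ij: "i < n * p" "j < n * p" "kronecker J K $$ (i, j) \<noteq> 0"
    note di = div_mod_less[OF ij(1)] and dj = div_mod_less[OF ij(2)]
    have nz: "J $$ (i div p, j div p) \<noteq> 0" "K $$ (i mod p, j mod p) \<noteq> 0"
      using ij JK by auto
    have le: "i div p \<le> j div p" "i mod p \<le> j mod p"
      using nz di dj by (auto intro: coloured_triangularD(2)[OF J] coloured_triangularD(2)[OF K])
    have "i = i div p * p + i mod p"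
      by simp
    also have "\<dots> \<le> j div p * p + j mod p"
      using le by (intro add_mono mult_right_mono) auto
    finally show "i \<le> j"
      by simp
    have "J $$ (j div p, j div p) = J $$ (i div p, i div p)"
      "K $$ (j mod p, j mod p) = K $$ (i mod p, i mod p)"
      using coloured_triangularD(3)[OF J di(1) dj(1)] coloured_triangularD(3)[OF K di(2) dj(2)] nz
      by simp_all
    then show "kronecker J K $$ (i, i) = kronecker J K $$ (j, j)"
      by (simp only: JK[OF ij(1,1)] JK[OF ij(2,2)])
  next
    fix i assume i: "i < n * p"
    then show "kronecker J K $$ (i, i) \<noteq> 0"
      using coloured_triangularD(1)[OF J div_mod_less(1)[OF i]]
        coloured_triangularD(1)[OF K div_mod_less(2)[OF i]] by (simp add: JK)
  qed
  then show ?thesis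
    using a b unfolding spectral_data_def
    by (auto simp: kronecker_mult[of _ n n _ n _ p p _ p] kronecker_one)
qed

lemma spectral_dataD:
  assumes "spectral_data n A P P' J"
  shows "P \<in> carrier_mat n n" "P' \<in> carrier_mat n n" "J \<in> carrier_mat n n" "A \<in> carrier_mat n n"
    "P * P' = 1\<^sub>m n" "P' * P = 1\<^sub>m n" "A = P * J * P'"
    "coloured_triangular n (\<lambda>i j. J $$ (i, j))"
  using assms by (auto simp: spectral_data_def)

lemma mat_diag_dims [simp]: "dim_row (mat_diag n t) = n" "dim_col (mat_diag n t) = n"
  by (simp_all add: mat_diag_def)

lemma mat_diag_entry: "i < n \<Longrightarrow> j < n \<Longrightarrow> mat_diag n t $$ (i, j) = (if i = j then t j else 0)"
  by (simp add: mat_diag_def)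

section \<open>Morphisms of the local categories\<close>

context laurent_ring
begin

lemma R_mat_const_mult:
  assumes S: "S \<in> carrier_mat m k" "\<And>i j. i < m \<Longrightarrow> j < k \<Longrightarrow> R (S $$ (i, j))"
  shows "X \<in> carrier_mat n m \<Longrightarrow> i < n \<Longrightarrow> j < k \<Longrightarrow> R ((const_mat X * S) $$ (i, j))"
    and "Y \<in> carrier_mat k l \<Longrightarrow> i < m \<Longrightarrow> j < l \<Longrightarrow> R ((S * const_mat Y) $$ (i, j))"
proof -
  assume X: "X \<in> carrier_mat n m" and ij: "i < n" "j < k"
  then have "(const_mat X * S) $$ (i, j) = (\<Sum>l<m. mero_const (X $$ (i, l)) * S $$ (l, j))"
    using S(1) by (subst mult_entry[of _ n m _ k]) auto
  then show "R ((const_mat X * S) $$ (i, j))"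
    using S(2) ij by (auto intro!: R_sum R_scale)
next
  assume Y: "Y \<in> carrier_mat k l" and ij: "i < m" "j < l"
  then have "(S * const_mat Y) $$ (i, j) = (\<Sum>t<k. mero_const (Y $$ (t, j)) * S $$ (i, t))"
    using S(1) by (subst mult_entry[of _ m k _ l]) (auto simp: mult.commute)
  then show "R ((S * const_mat Y) $$ (i, j))"
    using S(2) ij by (auto intro!: R_sum R_scale)
qed

text \<open>In bases of generalized eigenvectors a morphism of a local category solves a triangular system of
  \<open>q\<close>-difference equations with constant coefficients.\<close>

lemma local_hom_spectral:
  assumes q: "norm q > 1" and S: "S \<in> local_hom R q A B"
    and A: "spectral_data n A P P' J" and B: "spectral_data p B Q Q' K"
  defines "T \<equiv> const_mat Q' * (S * const_mat P)"
  shows "T \<in> carrier_mat p n" "S = const_mat Q * (T * const_mat P')"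
    "\<And>i j. i < p \<Longrightarrow> j < n \<Longrightarrow> T $$ (i, j) \<in> monomials q (J $$ (j, j)) (K $$ (i, i))"
proof -
  note a = spectral_dataD[OF A] and b = spectral_dataD[OF B]
  have S': "S \<in> carrier_mat p n" "\<And>i j. i < p \<Longrightarrow> j < n \<Longrightarrow> R (S $$ (i, j))"
    "shift_mat q S * const_mat A = const_mat B * S"
    using S a(4) b(4) unfolding local_hom_def by auto
  have c: "const_mat P \<in> carrier_mat n n" "const_mat P' \<in> carrier_mat n n"
    "const_mat Q \<in> carrier_mat p p" "const_mat Q' \<in> carrier_mat p p"
    "const_mat J \<in> carrier_mat n n" "const_mat K \<in> carrier_mat p p"
    "shift_mat q S \<in> carrier_mat p n" "const_mat A \<in> carrier_mat n n" "const_mat B \<in> carrier_mat p p"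
    using a b S' by auto
  have inv: "const_mat P * const_mat P' = 1\<^sub>m n" "const_mat P' * const_mat P = 1\<^sub>m n"
    "const_mat Q * const_mat Q' = 1\<^sub>m p" "const_mat Q' * const_mat Q = 1\<^sub>m p"
    using a b by (simp_all flip: const_mat_mult)
  have AP: "const_mat A * const_mat P = const_mat P * const_mat J"
  proof -
    have "A * P = P * J * (P' * P)"
      unfolding a(7) using a(1-3) by (intro assoc_mult_mat[of _ n n _ n _ n]) auto
    then have "A * P = P * J"
      using right_mult_one_mat[of "P * J" n n] a(1,3) by (simp add: a(6))
    then show ?thesis
      by (simp only: const_mat_mult[OF a(4,1), symmetric] const_mat_mult[OF a(1,3), symmetric])
  qed
  have QB: "const_mat Q' * const_mat B = const_mat K * const_mat Q'"
  proof -
    have "Q' * B = K * Q'"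
      using b(1-3) by (simp add: b(7) mat_assoc_dim mat_cancel_dim[OF b(6)] del: assoc_mult_mat)
    then show ?thesis
      by (simp only: const_mat_mult[OF b(2,4), symmetric] const_mat_mult[OF b(3,2), symmetric])
  qed
  show T: "T \<in> carrier_mat p n"
    unfolding T_def using c S' by auto
  have "T * const_mat P' = const_mat Q' * S"
    unfolding T_def using c S' by (simp add: mat_assoc_dim inv mat_one_right_dim del: assoc_mult_mat)
  then show "S = const_mat Q * (T * const_mat P')"
    using mat_cancel_left[OF inv(3) c(3,4) S'(1)] by simp
  have RT: "R (T $$ (i, j))" if "i < p" "j < n" for i j
    unfolding T_def
    using R_mat_const_mult(1)[OF mult_carrier_mat[OF S'(1) c(1)] R_mat_const_mult(2)[OF S'(1,2) a(1)] b(2)]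
      that by blast
  have shT: "shift_mat q T = const_mat Q' * (shift_mat q S * const_mat P)"
    unfolding T_def using c S' by (simp add: shift_mat_mult[of _ p p _ n] shift_mat_mult[of _ p n _ n])
  have "shift_mat q T * const_mat J = const_mat Q' * (shift_mat q S * (const_mat P * const_mat J))"
    unfolding shT using c S'(1) by (simp add: mat_assoc_dim del: assoc_mult_mat)
  also have "\<dots> = const_mat Q' * ((shift_mat q S * const_mat A) * const_mat P)"
    using c S'(1) by (simp add: mat_assoc_dim AP del: assoc_mult_mat)
  also have "\<dots> = (const_mat Q' * const_mat B) * (S * const_mat P)"
    unfolding S'(3) using c S'(1) by (simp add: mat_assoc_dim del: assoc_mult_mat)
  also have "\<dots> = const_mat K * T"
    unfolding QB T_def using c S'(1) by (simp add: mat_assoc_dim del: assoc_mult_mat)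
  finally have eq: "shift_mat q T * const_mat J = const_mat K * T" .
  have "(\<Sum>l<n. mero_shift q (T $$ (i, l)) * mero_const (J $$ (l, j))) =
      (\<Sum>l<p. mero_const (K $$ (i, l)) * T $$ (l, j))" if "i < p" "j < n" for i j
  proof -
    have "(shift_mat q T * const_mat J) $$ (i, j) =
        (\<Sum>l<n. mero_shift q (T $$ (i, l)) * mero_const (J $$ (l, j)))"
      using that T a by (subst mult_entry[of _ p n _ n]) auto
    moreover have "(const_mat K * T) $$ (i, j) = (\<Sum>l<p. mero_const (K $$ (i, l)) * T $$ (l, j))"
      using that T b by (subst mult_entry[of _ p p _ n]) auto
    ultimately show ?thesis
      using eq by simp
  qed
  then show "T $$ (i, j) \<in> monomials q (J $$ (j, j)) (K $$ (i, i))" if "i < p" "j < n" for i j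
    using triangular_solution_monomial[OF q a(8) b(8), of "\<lambda>i j. T $$ (i, j)" i j] RT that by blast
qed

lemma local_hom_carrier:
  "S \<in> local_hom R q A B \<Longrightarrow> A \<in> GL n \<Longrightarrow> B \<in> GL p \<Longrightarrow> S \<in> carrier_mat p n"
  by (auto simp: local_hom_def GL_def)

lemma local_hom_regular_char:
  assumes q: "norm q > 1" and S: "S \<in> local_hom R q A B"
    and A: "spectral_data n A P P' J" and B: "spectral_data p B Q Q' K"
  shows "z \<noteq> 0 \<Longrightarrow> mat_regular z S"
    and "a \<noteq> 0 \<Longrightarrow> b \<noteq> 0 \<Longrightarrow> mult_char g \<Longrightarrow> g q = b / a \<Longrightarrow>
      eval_mat b S * (P * mat_diag n (\<lambda>i. g (J $$ (i, i))) * P') =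
      (Q * mat_diag p (\<lambda>i. g (K $$ (i, i))) * Q') * eval_mat a S"
proof -
  note dA = spectral_dataD[OF A] and dB = spectral_dataD[OF B]
  define T where "T = const_mat Q' * (S * const_mat P)"
  note T = local_hom_spectral[OF q S A B, folded T_def]
  have rT: "mat_regular z T" if "z \<noteq> 0" for z
    using T(1,3) that by (auto simp: mat_regular_def intro: monomials_regular)
  have c: "const_mat P' \<in> carrier_mat n n" "const_mat Q \<in> carrier_mat p p"
    using dA dB by auto
  have ev: "mat_regular z S \<and> eval_mat z S = Q * (eval_mat z T * P')" if z: "z \<noteq> 0" for z
  proof -
    note m1 = mat_mult_eval[OF z T(1) rT[OF z] c(1) mat_regular_const[OF z]]
    note m2 = mat_mult_eval[OF z c(2) mat_regular_const[OF z] mult_carrier_mat[OF T(1) c(1)] m1(1)]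
    show ?thesis
      using m1 m2 z T(2) by simp
  qed
  then show "z \<noteq> 0 \<Longrightarrow> mat_regular z S"
    by blast
  assume ab: "a \<noteq> 0" "b \<noteq> 0" and g: "mult_char g" "g q = b / a"
  let ?D = "mat_diag n (\<lambda>i. g (J $$ (i, i)))" and ?E = "mat_diag p (\<lambda>i. g (K $$ (i, i)))"
  have q0: "q \<noteq> 0"
    using q by auto
  have eT: "eval_mat z T \<in> carrier_mat p n" for z
    using T(1) by simp
  have D: "?D \<in> carrier_mat n n" "?E \<in> carrier_mat p p"
    by simp_all
  have core: "eval_mat b T * ?D = ?E * eval_mat a T"
  proof (rule eq_matI)
    fix i j assume "i < dim_row (?E * eval_mat a T)" "j < dim_col (?E * eval_mat a T)"
    then have ij: "i < p" "j < n"
      using T(1) by auto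
    have "J $$ (j, j) \<noteq> 0"
      using coloured_triangularD(1)[OF dA(8) ij(2)] .
    then have "mero_eval (T $$ (i, j)) b * g (J $$ (j, j)) = g (K $$ (i, i)) * mero_eval (T $$ (i, j)) a"
      by (rule monomials_eval_char[OF g q0 _ ab T(3)[OF ij]])
    then show "(eval_mat b T * ?D) $$ (i, j) = (?E * eval_mat a T) $$ (i, j)"
      using ij T(1) by (simp add: mat_diag_mult_right[OF eT] mat_diag_mult_left[OF eT])
  qed (use T(1) in auto)
  note dims = dA(1-3)[THEN carrier_matD(1)] dA(1-3)[THEN carrier_matD(2)]
    dB(1-3)[THEN carrier_matD(1)] dB(1-3)[THEN carrier_matD(2)]
    T(1)[THEN carrier_matD(1)] T(1)[THEN carrier_matD(2)]
  have "eval_mat b S * (P * ?D * P') = Q * (eval_mat b T * ?D * P')"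
    using ev[OF ab(2)] dims
    by (simp add: mat_assoc_dim mat_cancel_dim[OF dA(6)] del: assoc_mult_mat)
  also have "\<dots> = Q * (?E * eval_mat a T * P')"
    unfolding core ..
  also have "\<dots> = (Q * ?E * Q') * eval_mat a S"
    using ev[OF ab(1)] dims
    by (simp add: mat_assoc_dim mat_cancel_dim[OF dB(6)] del: assoc_mult_mat)
  finally show "eval_mat b S * (P * ?D * P') = (Q * ?E * Q') * eval_mat a S" .
qed

lemma local_hom_regular:
  assumes "norm q > 1" "S \<in> local_hom R q A B" "A \<in> GL n" "B \<in> GL p" "z \<noteq> 0"
  shows "mat_regular z S"
  using assms spectral_data_exists local_hom_regular_char(1) by metis

lemma const_one_local_hom:
  assumes "A \<in> GL n"
  shows "1\<^sub>m n \<in> local_hom R q A A"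
proof -
  have "R f" if "f \<in> elements_mat (1\<^sub>m n :: mero mat)" for f
    using that R_const[of 1] R_0 by (auto simp: mero_const_hom)
  then show ?thesis
    using GL_carrier[OF assms] by (auto simp: local_hom_def)
qed

end

text \<open>The character \<open>g\<close> applied to the semisimple part of \<open>A\<close>.\<close>

definition char_mat :: "(complex \<Rightarrow> complex) \<Rightarrow> complex mat \<Rightarrow> complex mat" where
  "char_mat g A = (SOME D. \<exists>n P P' J. spectral_data n A P P' J \<and>
     D = P * mat_diag n (\<lambda>i. g (J $$ (i, i))) * P')"

text \<open>Naturality with respect to the identity morphism of \<open>A\<close> compares any two choices of spectral
  data.\<close>

lemma char_mat_eq:
  assumes g: "mult_char g" and A: "A \<in> GL n" and d: "spectral_data n A P P' J"
  shows "char_mat g A = P * mat_diag n (\<lambda>i. g (J $$ (i, i))) * P'"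
proof -
  interpret laurent_ring mero_plane mero_laurent
    by (rule laurent_ring_plane)
  have uniq: "D = P * mat_diag n (\<lambda>i. g (J $$ (i, i))) * P'"
    if ex: "\<exists>n P P' J. spectral_data n A P P' J \<and> D = P * mat_diag n (\<lambda>i. g (J $$ (i, i))) * P'" for D
  proof -
    obtain m Q Q' K where K: "spectral_data m A Q Q' K"
      and D: "D = Q * mat_diag m (\<lambda>i. g (K $$ (i, i))) * Q'"
      using ex by blast
    have [simp]: "m = n"
      using spectral_dataD(4)[OF K] GL_carrier[OF A] by auto
    \<comment> \<open>any base of norm greater than 1 would do; here it is 2, between the points 1 and \<open>g 2\<close>\<close>
    have "g 2 \<noteq> 0"
      using g by (simp add: mult_char_nonzero)
    then have "eval_mat (g 2) (1\<^sub>m n) * (P * mat_diag n (\<lambda>i. g (J $$ (i, i))) * P') =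
        (Q * mat_diag m (\<lambda>i. g (K $$ (i, i))) * Q') * eval_mat 1 (1\<^sub>m n)"
      using g by (intro local_hom_regular_char(2)[OF _ const_one_local_hom[OF A] d K, of 2]) auto
    then show ?thesis
      using \<open>g 2 \<noteq> 0\<close> spectral_dataD(1-3)[OF d] spectral_dataD(1-3)[OF K]
      by (simp add: D left_mult_one_mat[of _ n n] right_mult_one_mat[of _ n n] del: assoc_mult_mat)
  qed
  have "\<exists>D n P P' J. spectral_data n A P P' J \<and> D = P * mat_diag n (\<lambda>i. g (J $$ (i, i))) * P'"
    by (intro exI conjI, rule d, rule refl)
  then show ?thesis
    unfolding char_mat_def by (rule someI2_ex) (rule uniq)
qed

lemma spectral_diag_GL:
  assumes d: "spectral_data n A P P' J" and t: "\<And>i. i < n \<Longrightarrow> t i \<noteq> 0"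
  shows "P * mat_diag n t * P' \<in> GL n"
proof -
  note d = spectral_dataD[OF d]
  have D: "mat_diag n t * mat_diag n (\<lambda>i. inverse (t i)) = 1\<^sub>m n"
    "mat_diag n (\<lambda>i. inverse (t i)) * mat_diag n t = 1\<^sub>m n"
    using t by (auto intro!: eq_matI simp: mat_diag_entry)
  have "mat_diag n t \<in> GL n"
    by (rule GL_memI(1)[OF _ _ D]) auto
  moreover have "P \<in> GL n" "P' \<in> GL n"
    using GL_memI(1)[OF d(1,2,5,6)] GL_memI(1)[OF d(2,1,6,5)] .
  ultimately show ?thesis
    by (intro GL_mult)
qed

lemma char_mat_GL:
  assumes g: "mult_char g" and A: "A \<in> GL n"
  shows "char_mat g A \<in> GL n"
proof -
  obtain P P' J where d: "spectral_data n A P P' J"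
    using spectral_data_exists[OF A] by blast
  have "g (J $$ (i, i)) \<noteq> 0" if "i < n" for i
    using coloured_triangularD(1)[OF spectral_dataD(8)[OF d] that] mult_char_nonzero[OF g] by blast
  then show ?thesis
    unfolding char_mat_eq[OF g A d] by (rule spectral_diag_GL[OF d])
qed

lemma char_mat_kronecker:
  assumes g: "mult_char g" and A: "A \<in> GL n" and B: "B \<in> GL p"
  shows "char_mat g (kronecker A B) = kronecker (char_mat g A) (char_mat g B)"
proof -
  obtain P P' J where a: "spectral_data n A P P' J"
    using spectral_data_exists[OF A] by blast
  obtain Q Q' K where b: "spectral_data p B Q Q' K"
    using spectral_data_exists[OF B] by blast
  note da = spectral_dataD[OF a] and db = spectral_dataD[OF b]
  let ?D = "mat_diag n (\<lambda>i. g (J $$ (i, i)))" and ?E = "mat_diag p (\<lambda>i. g (K $$ (i, i)))"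
  have nz: "J $$ (i, i) \<noteq> 0" "K $$ (k, k) \<noteq> 0" if "i < n" "k < p" for i k
    using coloured_triangularD(1)[OF da(8)] coloured_triangularD(1)[OF db(8)] that by blast+
  have D: "?D \<in> carrier_mat n n" "?E \<in> carrier_mat p p"
    by simp_all
  have diag: "mat_diag (n * p) (\<lambda>i. g (kronecker J K $$ (i, i))) = kronecker ?D ?E"
  proof (rule eq_matI)
    fix i j assume "i < dim_row (kronecker ?D ?E)" "j < dim_col (kronecker ?D ?E)"
    then have ij: "i < n * p" "j < n * p"
      by auto
    have "i = j \<longleftrightarrow> i div p = j div p \<and> i mod p = j mod p"
      by (metis div_mult_mod_eq)
    then show "mat_diag (n * p) (\<lambda>i. g (kronecker J K $$ (i, i))) $$ (i, j) = kronecker ?D ?E $$ (i, j)"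
      using ij div_mod_less[OF ij(1)] div_mod_less[OF ij(2)] nz
      by (simp add: mat_diag_entry kronecker_entry[OF ij] kronecker_entry[OF ij(2) ij(2) da(3) db(3)]
          kronecker_entry[OF ij D] mult_char_mult[OF g])
  qed auto
  have "char_mat g (kronecker A B) =
      kronecker P Q * kronecker ?D ?E * kronecker P' Q'"
    unfolding diag[symmetric]
    by (rule char_mat_eq[OF g kronecker_GL(1)[OF A B] spectral_data_kronecker[OF a b]])
  also have "\<dots> = kronecker (P * ?D * P') (Q * ?E * Q')"
    using kronecker_mult[OF da(1) D(1) db(1) D(2)]
      kronecker_mult[OF mult_carrier_mat[OF da(1) D(1)] da(2) mult_carrier_mat[OF db(1) D(2)] db(2)]
    by simp
  finally show ?thesis
    by (simp only: char_mat_eq[OF g A a] char_mat_eq[OF g B b])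
qed

lemma char_mat_one:
  assumes "mult_char g"
  shows "char_mat g (1\<^sub>m 1) = 1\<^sub>m 1"
proof -
  have "spectral_data 1 (1\<^sub>m 1) (1\<^sub>m 1) (1\<^sub>m 1) (1\<^sub>m 1)"
    by (auto simp: spectral_data_def coloured_triangular_def)
  from char_mat_eq[OF assms one_GL this] show ?thesis
    using assms by (auto simp: mult_char_1 mat_diag_def intro!: eq_matI)
qed

section \<open>Arrows of the local groupoids\<close>

lemma local_cat_simps [simp]:
  "Obj (local_cat R q) = (\<Union>n. GL n)" "Hom (local_cat R q) = local_hom R q"
  "tensor (local_cat R q) = kronecker" "unit_obj (local_cat R q) = 1\<^sub>m 1"
  by (simp_all add: local_cat_def)

lemma omega_simps [simp]: "fib_dim (omega a) = dim_row" "fib_map (omega a) = eval_mat a"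
  by (simp_all add: omega_def)

lemma local_arrowI:
  assumes GL: "\<And>n A. A \<in> GL n \<Longrightarrow> h A \<in> GL n"
    and nat: "\<And>n p A B S. A \<in> GL n \<Longrightarrow> B \<in> GL p \<Longrightarrow> S \<in> local_hom R q A B \<Longrightarrow>
      eval_mat b S * h A = h B * eval_mat a S"
    and ten: "\<And>n p A B. A \<in> GL n \<Longrightarrow> B \<in> GL p \<Longrightarrow> h (kronecker A B) = kronecker (h A) (h B)"
    and one: "h (1\<^sub>m 1) = 1\<^sub>m 1"
  shows "restrict h (\<Union>n. GL n) \<in> Iso_tensor (local_cat R q) (omega a) (omega b)"
proof -
  have 1: "1\<^sub>m 1 \<in> (\<Union>n. GL n)"
    using one_GL by blast
  have k: "kronecker A B \<in> (\<Union>n. GL n)" if "A \<in> GL n" "B \<in> GL p" for A B :: "complex mat" and n p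
    using kronecker_GL(1)[OF that] by blast
  have d: "h A \<in> carrier_mat (dim_row A) (dim_row A) \<and> invertible_mat (h A)" if "A \<in> GL n" for A n
    using GL[OF that] GL_dim_unique[OF that] by (simp add: GL_iff)
  show ?thesis
    unfolding Iso_tensor_def using 1 k d nat ten one
    by (auto simp del: UN_iff simp: restrict_def extensional_def)
qed

context laurent_ring
begin

lemma char_arrow:
  assumes q: "norm q > 1" and ab: "a \<noteq> 0" "b \<noteq> 0" and g: "mult_char g" "g q = b / a"
  shows "restrict (char_mat g) (\<Union>n. GL n) \<in> Iso_tensor (local_cat R q) (omega a) (omega b)"
proof (rule local_arrowI)
  fix n p A B S assume A: "A \<in> GL n" and B: "B \<in> GL p" and S: "S \<in> local_hom R q A B"
  obtain P P' J where a: "spectral_data n A P P' J"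
    using spectral_data_exists[OF A] by blast
  obtain Q Q' K where b: "spectral_data p B Q Q' K"
    using spectral_data_exists[OF B] by blast
  show "eval_mat b S * char_mat g A = char_mat g B * eval_mat a S"
    unfolding char_mat_eq[OF g(1) A a] char_mat_eq[OF g(1) B b]
    by (rule local_hom_regular_char(2)[OF q S a b ab g])
qed (use char_mat_GL char_mat_kronecker char_mat_one g(1) in blast)+

text \<open>The equation \<open>(\<sigma>\<^sub>qS)A = BS\<close> read at \<open>a\<close> says that the objects themselves form an arrow.\<close>

lemma shift_arrow:
  assumes q: "norm q > 1" and a: "a \<noteq> 0"
  shows "restrict (\<lambda>A. A) (\<Union>n. GL n) \<in> Iso_tensor (local_cat R q) (omega a) (omega (q * a))"
proof (rule local_arrowI)
  fix n p A B S assume A: "A \<in> GL n" and B: "B \<in> GL p" and S: "S \<in> local_hom R q A B"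
  have q0: "q \<noteq> 0" and qa: "q * a \<noteq> 0"
    using q a by auto
  have Sc: "S \<in> carrier_mat p n" and eq: "shift_mat q S * const_mat A = const_mat B * S"
    using local_hom_carrier[OF S A B] S by (auto simp: local_hom_def)
  have c: "shift_mat q S \<in> carrier_mat p n" "const_mat A \<in> carrier_mat n n" "const_mat B \<in> carrier_mat p p"
    using Sc GL_carrier[OF A] GL_carrier[OF B] by auto
  note reg = local_hom_regular[OF q S A B]
  have "eval_mat a (shift_mat q S * const_mat A) = eval_mat (q * a) S * A"
    using mat_mult_eval(2)[OF a c(1) eval_mat_shift(1)[OF q0 reg[OF qa]] c(2) mat_regular_const[OF a]]
      eval_mat_shift(2)[OF q0 reg[OF qa]] a by simp
  moreover have "eval_mat a (const_mat B * S) = B * eval_mat a S"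
    using mat_mult_eval(2)[OF a c(3) mat_regular_const[OF a] Sc reg[OF a]] a by simp
  ultimately show "eval_mat (q * a) S * A = B * eval_mat a S"
    using eq by simp
qed simp_all

end

section \<open>Characters of the multiplicative group\<close>

lemma mult_char_exists:
  assumes q: "norm q > 1" and a: "a \<noteq> 0"
  obtains g where "mult_char g" "g q = a"
proof
  let ?g = "\<lambda>z. exp (complex_of_real (ln (norm z)) * (Ln a / complex_of_real (ln (norm q))))"
  show "mult_char ?g"
    by (auto simp: mult_char_def norm_mult ln_mult distrib_right add_divide_distrib exp_add)
  have "ln (norm q) > 0"
    using q by (rule ln_gt_zero)
  then show "?g q = a"
    using a by simp
qed

text \<open>The compact torus \<open>\<complex>\<^sup>*/q\<^sup>\<int>\<close> is the product of the circle of \<open>|z|\<close> modulo \<open>|q|\<close> with the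
  circle of arguments, twisted by the argument of \<open>q\<close>; the two coordinates are characters.\<close>

lemma mult_char_separating:
  assumes q: "norm q > 1"
  obtains g1 g2 where "mult_char g1" "g1 q = 1" "mult_char g2" "g2 q = 1"
    "\<And>x. x \<noteq> 0 \<Longrightarrow> g1 x = 1 \<Longrightarrow> g2 x = 1 \<Longrightarrow> \<exists>k. x = q powi k"
proof
  define l where "l z = ln (norm z) / ln (norm q)" for z :: complex
  have lq: "ln (norm q) > 0" and q0: "q \<noteq> 0" "norm q > 0"
    using q by (auto intro: ln_gt_zero)
  have l1: "l q = 1" "l 1 = 0"
    using lq by (auto simp: l_def)
  have lm: "l (x * y) = l x + l y" if "x \<noteq> 0" "y \<noteq> 0" for x y
    using that by (simp add: l_def norm_mult ln_mult add_divide_distrib)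
  have em: "exp (c * of_real (l (x * y))) = exp (c * of_real (l x)) * exp (c * of_real (l y))"
    if "x \<noteq> 0" "y \<noteq> 0" for x y c :: complex
    using that by (simp add: lm distrib_left flip: exp_add)
  let ?g1 = "\<lambda>z. exp (2 * of_real pi * \<i> * of_real (l z))"
  let ?g2 = "\<lambda>z. sgn z * exp (- (\<i> * of_real (Arg q)) * of_real (l z))"
  show "mult_char ?g1"
    by (auto simp: mult_char_def l1 em)
  show "mult_char ?g2"
    unfolding mult_char_def
  proof (intro conjI allI impI)
    fix x y :: complex assume xy: "x \<noteq> 0" "y \<noteq> 0"
    show "?g2 (x * y) = ?g2 x * ?g2 y"
      unfolding em[OF xy] sgn_mult by (simp only: mult_ac)
  qed (simp add: l1)
  show "?g1 q = 1"
    by (simp add: l1)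
  have sq: "sgn q = exp (\<i> * of_real (Arg q))"
    using q0 Arg_eq[of q] by (simp add: sgn_eq field_simps)
  then show "?g2 q = 1"
    by (simp add: l1 exp_minus)
  fix x :: complex assume x: "x \<noteq> 0" "?g1 x = 1" "?g2 x = 1"
  obtain k :: int where k: "l x = of_int k"
    using x(2) by (auto simp: exp_eq_1)
  have "ln (norm x) = of_int k * ln (norm q)"
    using k lq by (simp add: l_def field_simps)
  then have "norm x = exp (of_int k * ln (norm q))"
    using x(1) by (metis exp_ln zero_less_norm_iff)
  also have "\<dots> = norm q powi k"
    using q0 by (simp flip: exp_power_int)
  finally have nx: "norm x = norm q powi k" .
  have "exp (- (\<i> * of_real (Arg q)) * of_real (l x)) = inverse (sgn q powi k)"
    by (simp add: k sq exp_power_int exp_minus mult.commute)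
  with x(3) have "sgn x * inverse (sgn q powi k) = 1"
    by (simp only:)
  then have sx: "sgn x = sgn q powi k"
    by (simp only: divide_inverse[symmetric] divide_eq_1_iff)
  have "x = of_real (norm x) * sgn x"
    using x(1) by (simp add: sgn_eq)
  also have "\<dots> = (of_real (norm q) * sgn q) powi k"
    unfolding nx sx by (simp add: power_int_mult_distrib)
  also have "of_real (norm q) * sgn q = q"
    using q0 by (simp add: sgn_eq)
  finally show "\<exists>k. x = q powi k" ..
qed

text \<open>A finite Stone-Weierstrass argument: an algebra of functions on a finite set contains every
  function that is constant on the classes which the algebra does not separate.\<close>

lemma separated_functions:
  fixes T :: "(nat \<Rightarrow> complex) set"
  assumes const: "\<And>c. (\<lambda>_. c) \<in> T"
    and add: "\<And>s t. s \<in> T \<Longrightarrow> t \<in> T \<Longrightarrow> (\<lambda>i. s i + t i) \<in> T"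
    and mult: "\<And>s t. s \<in> T \<Longrightarrow> t \<in> T \<Longrightarrow> (\<lambda>i. s i * t i) \<in> T"
    and cong: "\<And>s t. s \<in> T \<Longrightarrow> (\<And>i. i < n \<Longrightarrow> s i = t i) \<Longrightarrow> t \<in> T"
    and f: "\<And>i j. i < n \<Longrightarrow> j < n \<Longrightarrow> (\<And>s. s \<in> T \<Longrightarrow> s i = s j) \<Longrightarrow> f i = f j"
  shows "f \<in> T"
proof -
  define E where "E i j \<longleftrightarrow> (\<forall>s\<in>T. s i = s j)" for i j
  have sum: "(\<lambda>j. \<Sum>k\<in>I. F k j) \<in> T" if "\<And>k. k \<in> I \<Longrightarrow> F k \<in> T" for F and I :: "nat set"
    using that by (induction I rule: infinite_finite_induct) (auto intro: const add)
  have prod: "(\<lambda>j. \<Prod>k\<in>I. F k j) \<in> T" if "\<And>k. k \<in> I \<Longrightarrow> F k \<in> T" for F and I :: "nat set"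
    using that by (induction I rule: infinite_finite_induct) (auto intro: const mult)
  have "\<exists>s. s \<in> T \<and> s i = 1 \<and> (\<not> E i k \<longrightarrow> s k = 0)" for i k
  proof (cases "E i k")
    case False
    then obtain s where s: "s \<in> T" "s i \<noteq> s k"
      by (auto simp: E_def)
    have "(\<lambda>j. 1 / (s i - s k) * (s j + - s k)) \<in> T"
      by (intro mult add const s(1))
    then show ?thesis
      using s(2) by (intro exI[of _ "\<lambda>j. 1 / (s i - s k) * (s j + - s k)"]) auto
  qed (use const[of 1] in auto)
  then obtain sep where sep: "\<And>i k. sep i k \<in> T \<and> sep i k i = 1 \<and> (\<not> E i k \<longrightarrow> sep i k k = 0)"
    by metis
  define e where "e i j = (\<Prod>k\<in>{k. k < n \<and> \<not> E i k}. sep i k j)" for i j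
  have eT: "e i \<in> T" for i
    unfolding e_def using sep by (intro prod) auto
  have e: "e i j = (if E i j then 1 else 0)" if "i < n" "j < n" for i j
  proof (cases "E i j")
    case True
    have "sep i k j = 1" for k
      using sep[of i k] True unfolding E_def by metis
    then show ?thesis
      using True by (simp add: e_def)
  next
    case False
    then have "sep i j j = 0"
      using sep by blast
    then show ?thesis
      using False that unfolding e_def by (auto intro!: prod_zero)
  qed
  define N where "N j = card {k. k < n \<and> E k j}" for j
  have Esym: "E i j \<Longrightarrow> E j i" and Etrans: "E i j \<Longrightarrow> E j k \<Longrightarrow> E i k" for i j k
    by (auto simp: E_def)
  have "(\<lambda>j. \<Sum>i<n. (f i / of_nat (N i)) * e i j) \<in> T"
    using eT by (intro sum mult const) auto
  moreover have "(\<Sum>i<n. (f i / of_nat (N i)) * e i j) = f j" if j: "j < n" for j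
  proof -
    have "(\<Sum>i<n. (f i / of_nat (N i)) * e i j) = (\<Sum>i<n. if E i j then f j / of_nat (N j) else 0)"
    proof (rule sum.cong[OF refl])
      fix i assume i: "i \<in> {..<n}"
      have "N i = N j" if "E i j"
        unfolding N_def using Esym Etrans that by (intro arg_cong[where f = card]) blast
      moreover have "f i = f j" if "E i j"
        using f[of i j] that i j by (auto simp: E_def)
      ultimately show "(f i / of_nat (N i)) * e i j = (if E i j then f j / of_nat (N j) else 0)"
        using e[of i j] i j by auto
    qed
    also have "\<dots> = (\<Sum>i\<in>{i. i < n \<and> E i j}. f j / of_nat (N j))"
      by (intro sum.mono_neutral_cong_right) auto
    also have "\<dots> = of_nat (N j) * (f j / of_nat (N j))"
      by (simp add: N_def)
    also have "\<dots> = f j"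
    proof -
      have "j \<in> {k. k < n \<and> E k j}"
        using j by (auto simp: E_def)
      then have "N j \<noteq> 0"
        unfolding N_def by (subst card_0_eq) auto
      then show ?thesis
        by simp
    qed
    finally show ?thesis .
  qed
  ultimately show ?thesis
    by (rule cong)
qed

section \<open>Stable families of subspaces over one local groupoid\<close>

lemma spectral_diag_mult:
  assumes "P \<in> carrier_mat n n" "P' \<in> carrier_mat n n" "P' * P = (1\<^sub>m n :: 'a :: comm_ring_1 mat)"
  shows "P * mat_diag n s * P' * (P * mat_diag n t * P') = P * mat_diag n (\<lambda>i. s i * t i) * P'"
proof -
  have "P * mat_diag n s * P' * (P * mat_diag n t * P') =
      P * ((mat_diag n s * mat_diag n t) * P')"
    using assms by (simp add: mat_assoc_dim mat_cancel_dim[OF assms(3)] del: assoc_mult_mat mat_diag_diag)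
  also have "\<dots> = P * mat_diag n (\<lambda>i. s i * t i) * P'"
    using assms by (simp add: mat_assoc_dim del: assoc_mult_mat)
  finally show ?thesis .
qed

lemma spectral_diag_add:
  assumes "P \<in> carrier_mat n n" "P' \<in> carrier_mat n n"
  shows "P * mat_diag n s * P' + P * mat_diag n t * P' =
    P * mat_diag n (\<lambda>i. s i + t i) * (P' :: 'a :: comm_ring_1 mat)"
proof -
  have "mat_diag n (\<lambda>i. s i + t i) = mat_diag n s + mat_diag n t"
    by (rule eq_matI) (auto simp: mat_diag_entry)
  then show ?thesis
    using assms mult_add_distrib_mat[OF assms(1), of "mat_diag n s" n "mat_diag n t"]
      add_mult_distrib_mat[of "P * mat_diag n s" n n "P * mat_diag n t" P' n]
    by simp
qed

text \<open>The integer \<open>k\<close> such that \<open>q\<^sup>-\<^sup>k x\<close> lies in the fundamental annulus \<open>1 \<le> |y| < |q|\<close>.\<close>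

definition log_floor :: "complex \<Rightarrow> complex \<Rightarrow> int" where
  "log_floor q x = \<lfloor>ln (norm x) / ln (norm q)\<rfloor>"

lemma log_floor_mult:
  assumes q: "norm q > 1" and x: "x \<noteq> 0"
  shows "log_floor q (q powi m * x) = m + log_floor q x"
proof -
  have lq: "ln (norm q) > 0"
    using q by (rule ln_gt_zero)
  have "ln (norm (q powi m * x)) = ln (norm (q powi m)) + ln (norm x)"
    unfolding norm_mult using q x by (intro ln_mult_pos) auto
  also have "ln (norm (q powi m)) = of_int m * ln (norm q)"
  proof -
    have "norm q > 0"
      using q by linarith
    then have "norm q powi m = exp (of_int m * ln (norm q))"
      by (simp flip: exp_power_int)
    then show ?thesis
      by (simp add: norm_power_int)
  qed
  finally have "ln (norm (q powi m * x)) / ln (norm q) = of_int m + ln (norm x) / ln (norm q)"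
    using lq by (simp add: add_divide_distrib)
  then show ?thesis
    by (simp add: log_floor_def)
qed

context laurent_ring
begin

context
  fixes q :: complex and n :: nat and A P P' J :: "complex mat" and W :: "complex \<Rightarrow> complex mat set"
  assumes q: "norm q > 1" and A: "A \<in> GL n" and d: "spectral_data n A P P' J"
    and W1: "W 1 \<subseteq> carrier_mat n 1" "0\<^sub>m n 1 \<in> W 1"
      "\<And>v w. v \<in> W 1 \<Longrightarrow> w \<in> W 1 \<Longrightarrow> v + w \<in> W 1" "\<And>c w. w \<in> W 1 \<Longrightarrow> c \<cdot>\<^sub>m w \<in> W 1"
    and stable: "\<And>a b h w. a \<noteq> 0 \<Longrightarrow> b \<noteq> 0 \<Longrightarrow>
      h \<in> Iso_tensor (local_cat R q) (omega a) (omega b) \<Longrightarrow> w \<in> carrier_mat n 1 \<Longrightarrow>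
      w \<in> W a \<longleftrightarrow> h A * w \<in> W b"
begin

private definition eig :: "nat \<Rightarrow> complex" where
  "eig i = J $$ (i, i)"

private definition diag_op :: "(nat \<Rightarrow> complex) \<Rightarrow> complex mat" where
  "diag_op t = P * mat_diag n t * P'"

private definition deg :: "nat \<Rightarrow> int" where
  "deg i = log_floor q (eig i)"

private lemma q0: "q \<noteq> 0"
  using q by auto

private lemma eig_nonzero: "i < n \<Longrightarrow> eig i \<noteq> 0"
  unfolding eig_def by (rule coloured_triangularD(1)[OF spectral_dataD(8)[OF d]])

private lemma diag_op_carrier: "diag_op t \<in> carrier_mat n n"
  using spectral_dataD(1,2)[OF d] unfolding diag_op_def
  by (intro mult_carrier_mat[of _ n n _ n]) auto

private lemma diag_op_mult: "diag_op s * diag_op t = diag_op (\<lambda>i. s i * t i)"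
  unfolding diag_op_def by (rule spectral_diag_mult[OF spectral_dataD(1,2,6)[OF d]])

private lemma diag_op_add: "diag_op s + diag_op t = diag_op (\<lambda>i. s i + t i)"
  unfolding diag_op_def by (rule spectral_diag_add[OF spectral_dataD(1,2)[OF d]])

private lemma diag_op_cong: "(\<And>i. i < n \<Longrightarrow> s i = t i) \<Longrightarrow> diag_op s = diag_op t"
proof -
  assume "\<And>i. i < n \<Longrightarrow> s i = t i"
  then have "mat_diag n s = mat_diag n t"
    by (intro eq_matI) (auto simp: mat_diag_entry)
  then show ?thesis
    by (simp add: diag_op_def)
qed

private lemma diag_op_const: "w \<in> carrier_mat n 1 \<Longrightarrow> diag_op (\<lambda>_. c) * w = c \<cdot>\<^sub>m w"
proof -
  assume w: "w \<in> carrier_mat n 1"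
  note P = spectral_dataD(1,2,5)[OF d]
  have "mat_diag n (\<lambda>_. c) = c \<cdot>\<^sub>m 1\<^sub>m n"
    by (rule eq_matI) (auto simp: mat_diag_entry)
  then have "diag_op (\<lambda>_. c) = c \<cdot>\<^sub>m (P * P')"
    using P(1,2) mult_smult_distrib[OF P(1) one_carrier_mat, of c]
      mult_smult_assoc_mat[OF P(1,2), of c] right_mult_one_mat[OF P(1)]
    by (simp add: diag_op_def del: assoc_mult_mat)
  then show ?thesis
    using w mult_smult_assoc_mat[OF one_carrier_mat w, of c] left_mult_one_mat[OF w] P(3) by simp
qed

private lemma char_stable:
  assumes g: "mult_char g" "g q = b / a" and ab: "a \<noteq> 0" "b \<noteq> 0" and w: "w \<in> carrier_mat n 1"
  shows "w \<in> W a \<longleftrightarrow> diag_op (\<lambda>i. g (eig i)) * w \<in> W b"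
proof -
  have "restrict (char_mat g) (\<Union>n. GL n) A = diag_op (\<lambda>i. g (eig i))"
    using A char_mat_eq[OF g(1) A d] by (auto simp: diag_op_def eig_def)
  then show ?thesis
    using stable[OF ab char_arrow[OF q ab g] w] by simp
qed

private lemma shift_stable:
  assumes "a \<noteq> 0" "w \<in> carrier_mat n 1"
  shows "w \<in> W a \<longleftrightarrow> A * w \<in> W (q * a)"
proof -
  have "restrict (\<lambda>A. A) (\<Union>n. GL n) A = A" and "q * a \<noteq> 0"
    using A q0 assms(1) by auto
  then show ?thesis
    using stable[OF assms(1) _ shift_arrow[OF q assms(1)] assms(2)] by simp
qed

text \<open>The functions of the eigenvalue index whose diagonal operators preserve \<open>W 1\<close> form an algebra
  containing the characters with value \<open>1\<close> at \<open>q\<close>.\<close>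

private lemma class_function_stable:
  assumes f: "\<And>i j m. i < n \<Longrightarrow> j < n \<Longrightarrow> eig i = q powi m * eig j \<Longrightarrow> f i = f j" and w: "w \<in> W 1"
  shows "diag_op f * w \<in> W 1"
proof -
  define T where "T = {t. \<forall>w \<in> W 1. diag_op t * w \<in> W 1}"
  obtain g1 g2 where g: "mult_char g1" "g1 q = 1" "mult_char g2" "g2 q = 1"
    and sep: "\<And>x. x \<noteq> 0 \<Longrightarrow> g1 x = 1 \<Longrightarrow> g2 x = 1 \<Longrightarrow> \<exists>k. x = q powi k"
    using mult_char_separating[OF q] by metis
  have gT: "(\<lambda>i. g (eig i)) \<in> T" if "mult_char g" "g q = 1" for g
    using char_stable[of g 1 1] that W1(1) by (auto simp: T_def)
  have "f \<in> T"
  proof (rule separated_functions)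
    show "(\<lambda>_. c) \<in> T" for c
      using W1 diag_op_const by (auto simp: T_def subset_iff)
    show "(\<lambda>i. s i + t i) \<in> T" if "s \<in> T" "t \<in> T" for s t
    proof -
      have "diag_op (\<lambda>i. s i + t i) * w = diag_op s * w + diag_op t * w" if "w \<in> W 1" for w
        using that W1(1) unfolding diag_op_add[symmetric]
        by (intro add_mult_distrib_mat[OF diag_op_carrier diag_op_carrier]) auto
      then show ?thesis
        using that W1(3) by (auto simp: T_def)
    qed
    show "(\<lambda>i. s i * t i) \<in> T" if "s \<in> T" "t \<in> T" for s t
    proof -
      have "diag_op (\<lambda>i. s i * t i) * w = diag_op s * (diag_op t * w)" if "w \<in> W 1" for w
        using that W1(1) unfolding diag_op_mult[symmetric]
        by (intro assoc_mult_mat[OF diag_op_carrier diag_op_carrier]) auto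
      then show ?thesis
        using that by (auto simp: T_def)
    qed
    show "t \<in> T" if "s \<in> T" "\<And>i. i < n \<Longrightarrow> s i = t i" for s t
      using that diag_op_cong[of s t] by (auto simp: T_def)
    fix i j assume ij: "i < n" "j < n" and eq: "\<And>s. s \<in> T \<Longrightarrow> s i = s j"
    have "g (eig i * inverse (eig j)) = 1" if "mult_char g" "g q = 1" for g
      using eq[OF gT[OF that]] eig_nonzero[OF ij(1)] eig_nonzero[OF ij(2)] that(1)
      by (simp add: mult_char_mult mult_char_inverse mult_char_nonzero)
    then obtain k where "eig i * inverse (eig j) = q powi k"
      using sep[of "eig i * inverse (eig j)"] g eig_nonzero[OF ij(1)] eig_nonzero[OF ij(2)] by auto
    then have "eig i = q powi k * eig j"
      using eig_nonzero[OF ij(2)] by (simp add: field_simps)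
    then show "f i = f j"
      using f[OF ij] by blast
  qed
  then show ?thesis
    using w by (simp add: T_def)
qed

text \<open>On the eigenvalues the power \<open>y\<^sup>-\<^sup>k\<close>, with \<open>k\<close> the degree, differs from any character with value \<open>1/y\<close> at \<open>q\<close>
  by a function of the class modulo \<open>q\<^sup>\<int>\<close>, and such functions preserve \<open>W 1\<close>.\<close>

private lemma transport_to_1:
  assumes y: "y \<noteq> 0" and w: "w \<in> carrier_mat n 1"
  shows "w \<in> W y \<longleftrightarrow> diag_op (\<lambda>i. y powi (- deg i)) * w \<in> W 1"
proof -
  obtain g where g: "mult_char g" "g q = 1 / y"
    using mult_char_exists[OF q, of "1 / y"] y by auto
  define t where "t i = y powi (- deg i) * inverse (g (eig i))" for i
  have t0: "t i \<noteq> 0" "g (eig i) \<noteq> 0" if "i < n" for i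
    using y g eig_nonzero[OF that] by (auto simp: t_def mult_char_nonzero)
  have cl: "t i = t j" if ij: "i < n" "j < n" "eig i = q powi m * eig j" for i j m
  proof -
    have "deg i = m + deg j"
      unfolding deg_def ij(3) by (rule log_floor_mult[OF q eig_nonzero[OF ij(2)]])
    moreover have "g (eig i) = inverse y powi m * g (eig j)"
      unfolding ij(3) using g q0 eig_nonzero[OF ij(2)]
      by (simp add: mult_char_mult mult_char_powi field_simps)
    ultimately have "t i = y powi (- (m + deg j)) * (inverse (inverse y powi m) * inverse (g (eig j)))"
      by (simp add: t_def)
    also have "y powi (- (m + deg j)) = y powi (- m) * y powi (- deg j)"
      using y by (simp flip: power_int_add)
    also have "inverse (inverse y powi m) = y powi m"
      by (simp add: power_int_inverse)
    also have "y powi (- m) * y powi (- deg j) * (y powi m * inverse (g (eig j))) =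
        y powi (- m) * y powi m * t j"
      by (simp add: t_def)
    also have "y powi (- m) * y powi m = 1"
      using y by (simp flip: power_int_add)
    finally show ?thesis
      by simp
  qed
  define v where "v = diag_op (\<lambda>i. g (eig i)) * w"
  have vc: "v \<in> carrier_mat n 1"
    unfolding v_def using diag_op_carrier w by (rule mult_carrier_mat)
  have "w \<in> W y \<longleftrightarrow> v \<in> W 1"
    unfolding v_def using char_stable[OF g(1), of 1 y] g(2) y w by simp
  also have "\<dots> \<longleftrightarrow> diag_op t * v \<in> W 1"
  proof
    show "diag_op t * v \<in> W 1" if "v \<in> W 1"
      using class_function_stable[OF cl that] .
    assume tv: "diag_op t * v \<in> W 1"
    have "diag_op (\<lambda>i. inverse (t i)) * (diag_op t * v) \<in> W 1"
    proof (rule class_function_stable[OF _ tv])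
      fix i j m assume "i < n" "j < n" "eig i = q powi m * eig j"
      from cl[OF this] show "inverse (t i) = inverse (t j)"
        by simp
    qed
    also have "diag_op (\<lambda>i. inverse (t i)) * (diag_op t * v) = diag_op (\<lambda>i. inverse (t i) * t i) * v"
      unfolding diag_op_mult[symmetric]
      by (rule assoc_mult_mat[OF diag_op_carrier diag_op_carrier vc, symmetric])
    also have "diag_op (\<lambda>i. inverse (t i) * t i) = diag_op (\<lambda>_. 1)"
      using t0 by (intro diag_op_cong) auto
    also have "diag_op (\<lambda>_. 1) * v = v"
      unfolding diag_op_const[OF vc] using vc by (intro eq_matI) auto
    finally show "v \<in> W 1" .
  qed
  also have "diag_op t * v = diag_op (\<lambda>i. t i * g (eig i)) * w"
    unfolding v_def diag_op_mult[symmetric]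
    by (rule assoc_mult_mat[OF diag_op_carrier diag_op_carrier w, symmetric])
  also have "diag_op (\<lambda>i. t i * g (eig i)) = diag_op (\<lambda>i. y powi (- deg i))"
    using t0 by (intro diag_op_cong) (auto simp: t_def)
  finally show ?thesis .
qed

text \<open>For \<open>e = 1\<close> the gauge transformation, and for \<open>e = -1\<close> its inverse.\<close>

private definition gauge_mat :: "int \<Rightarrow> mero mat" where
  "gauge_mat e = const_mat P * mat_diag n (\<lambda>i. mero_monom (e * deg i)) * const_mat P'"

private lemma const_P:
  "const_mat P \<in> carrier_mat n n" "const_mat P' \<in> carrier_mat n n"
  "const_mat P' * const_mat P = 1\<^sub>m n" "const_mat P * const_mat P' = 1\<^sub>m n"
  using spectral_dataD[OF d] by (auto simp flip: const_mat_mult)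

private lemma gauge_carrier: "gauge_mat e \<in> carrier_mat n n"
  unfolding gauge_mat_def using const_P by (intro mult_carrier_mat[of _ n n _ n]) auto

private lemma gauge_inverse: "gauge_mat (- 1) * gauge_mat 1 = 1\<^sub>m n"
proof -
  have "mat_diag n (\<lambda>i. mero_monom (- 1 * deg i) * mero_monom (1 * deg i)) = 1\<^sub>m n"
    by (rule eq_matI) (auto simp: mat_diag_entry simp flip: mero_monom_add)
  then show ?thesis
    unfolding gauge_mat_def spectral_diag_mult[OF const_P(1-3)]
    using const_P by (simp add: right_mult_one_mat[of _ n n])
qed

private lemma gauge_eval:
  assumes z: "z \<noteq> 0"
  shows "mat_regular z (gauge_mat e)" "eval_mat z (gauge_mat e) = diag_op (\<lambda>i. z powi (e * deg i))"
proof -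
  let ?D = "mat_diag n (\<lambda>i. mero_monom (e * deg i))"
  have D: "?D \<in> carrier_mat n n" "mat_regular z ?D" "eval_mat z ?D = mat_diag n (\<lambda>i. z powi (e * deg i))"
    using z by (auto simp: mat_regular_def mat_diag_entry intro!: eq_matI)
  note m1 = mat_mult_eval[OF z const_P(1) mat_regular_const[OF z] D(1,2)]
  note m2 = mat_mult_eval[OF z mult_carrier_mat[OF const_P(1) D(1)] m1(1) const_P(2) mat_regular_const[OF z]]
  show "mat_regular z (gauge_mat e)" "eval_mat z (gauge_mat e) = diag_op (\<lambda>i. z powi (e * deg i))"
    using m1 m2 z D(3) unfolding gauge_mat_def diag_op_def by (simp_all del: assoc_mult_mat)
qed

text \<open>The gauge is a morphism to \<open>A\<close> from the matrix obtained by moving the eigenvalues of \<open>A\<close> into the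
  fundamental annulus.\<close>

private lemma gauge_equation:
  "shift_mat q (gauge_mat 1) * const_mat (diag_op (\<lambda>i. q powi (- deg i)) * A) = const_mat A * gauge_mat 1"
proof -
  note dA = spectral_dataD[OF d]
  let ?X = "mat_diag n (\<lambda>i. mero_monom (deg i))" and ?Q = "mat_diag n (\<lambda>i. q powi (- deg i))"
  have cJ: "const_mat J \<in> carrier_mat n n" and cA: "const_mat A \<in> carrier_mat n n"
    using dA by auto
  have shX: "shift_mat q ?X * const_mat ?Q = ?X"
  proof (rule eq_matI)
    fix i j assume "i < dim_row ?X" "j < dim_col ?X"
    then have ij: "i < n" "j < n"
      by auto
    have "shift_mat q ?X = mat_diag n (\<lambda>i. mero_const (q powi deg i) * mero_monom (deg i))"
      "const_mat ?Q = mat_diag n (\<lambda>i. mero_const (q powi (- deg i)))"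
      using q0 by (auto simp: mat_diag_entry mero_shift_monom mero_const_hom intro!: eq_matI)
    then have "shift_mat q ?X * const_mat ?Q =
        mat_diag n (\<lambda>i. mero_const (q powi deg i) * mero_monom (deg i) * mero_const (q powi (- deg i)))"
      by simp
    moreover have "mero_const (q powi k) * mero_monom k * mero_const (q powi (- k)) = mero_monom k" for k
    proof -
      have "mero_const (q powi k) * mero_const (q powi (- k)) = 1"
        using q0 by (simp add: power_int_minus mero_const_hom flip: mero_const_hom(4))
      then show ?thesis
        by (metis mult.assoc mult.commute mult_1)
    qed
    ultimately show "(shift_mat q ?X * const_mat ?Q) $$ (i, j) = ?X $$ (i, j)"
      by simp
  qed auto
  have XJ: "?X * const_mat J = const_mat J * ?X"
  proof (rule eq_matI)
    fix i j assume "i < dim_row (const_mat J * ?X)" "j < dim_col (const_mat J * ?X)"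
    then have ij: "i < n" "j < n"
      using dA(3) by auto
    have "deg i = deg j" if "J $$ (i, j) \<noteq> 0"
      using coloured_triangularD(3)[OF dA(8) ij that] by (simp add: deg_def eig_def)
    then show "(?X * const_mat J) $$ (i, j) = (const_mat J * ?X) $$ (i, j)"
      using ij dA(3) by (cases "J $$ (i, j) = 0")
        (simp_all add: mat_diag_mult_left[OF cJ] mat_diag_mult_right[OF cJ] mero_const_hom mult.commute)
  qed (use dA(3) in auto)
  have "diag_op (\<lambda>i. q powi (- deg i)) * A = P * (?Q * (J * P'))"
    unfolding diag_op_def dA(7) using dA(1-3)
    by (simp add: mat_assoc_dim mat_cancel_dim[OF dA(6)] del: assoc_mult_mat)
  also have "const_mat \<dots> = const_mat P * (const_mat ?Q * (const_mat J * const_mat P'))"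
    using dA(1-3) by (simp add: const_mat_mult[of _ n n _ n] mult_carrier_mat[of _ n n _ n])
  finally have 1: "const_mat (diag_op (\<lambda>i. q powi (- deg i)) * A) =
    const_mat P * (const_mat ?Q * (const_mat J * const_mat P'))" .
  have 2: "shift_mat q (gauge_mat 1) = const_mat P * (shift_mat q ?X * const_mat P')"
  proof -
    have "shift_mat q (gauge_mat 1) = shift_mat q (const_mat P * ?X) * const_mat P'"
      unfolding gauge_mat_def using const_P
      by (subst shift_mat_mult[of _ n n _ n]) (auto intro!: mult_carrier_mat[of _ n n _ n])
    also have "shift_mat q (const_mat P * ?X) = const_mat P * shift_mat q ?X"
      using const_P by (subst shift_mat_mult[of _ n n _ n]) auto
    finally show ?thesis
      using const_P by (simp add: mat_assoc_dim del: assoc_mult_mat)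
  qed
  have 3: "const_mat A = const_mat P * (const_mat J * const_mat P')"
    unfolding dA(7) using dA(1-3) by (simp add: const_mat_mult[of _ n n _ n] mult_carrier_mat[of _ n n _ n])
  have "shift_mat q (gauge_mat 1) * const_mat (diag_op (\<lambda>i. q powi (- deg i)) * A) =
      const_mat P * ((shift_mat q ?X * const_mat ?Q) * (const_mat J * const_mat P'))"
    unfolding 1 2 using const_P(1,2) cJ
    by (simp add: mat_assoc_dim mat_cancel_dim[OF const_P(3)] del: assoc_mult_mat)
  also have "\<dots> = const_mat P * ((?X * const_mat J) * const_mat P')"
    unfolding shX using const_P(1,2) cJ by (simp add: mat_assoc_dim del: assoc_mult_mat)
  also have "\<dots> = const_mat A * gauge_mat 1"
    unfolding XJ 3 gauge_mat_def using const_P(1,2) cJ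
    by (simp add: mat_assoc_dim mat_cancel_dim[OF const_P(3)] del: assoc_mult_mat)
  finally show ?thesis .
qed

private lemma gauge_R: "i < n \<Longrightarrow> j < n \<Longrightarrow> R (gauge_mat e $$ (i, j))"
proof -
  assume ij: "i < n" "j < n"
  let ?D = "mat_diag n (\<lambda>i. mero_monom (e * deg i))"
  have D: "?D \<in> carrier_mat n n" "\<And>i j. i < n \<Longrightarrow> j < n \<Longrightarrow> R (?D $$ (i, j))"
    by (auto simp: mat_diag_entry R_monom R_0)
  note R1 = R_mat_const_mult(1)[OF D spectral_dataD(1)[OF d]]
  show ?thesis
    unfolding gauge_mat_def
    by (rule R_mat_const_mult(2)[OF mult_carrier_mat[OF const_P(1) D(1)] R1 spectral_dataD(2)[OF d] ij])
qed

lemma local_subobject_aux: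
  obtains r B S L where "B \<in> GL r" "S \<in> carrier_mat n r" "L \<in> carrier_mat r n"
    "S \<in> local_hom R q B A" "L * S = 1\<^sub>m r"
    "\<And>z. z \<noteq> 0 \<Longrightarrow> mat_regular z S" "\<And>z. z \<noteq> 0 \<Longrightarrow> mat_regular z L"
    "\<And>z w. z \<noteq> 0 \<Longrightarrow> w \<in> carrier_mat n 1 \<Longrightarrow> w \<in> W z \<longleftrightarrow> eval_mat z S * (eval_mat z L * w) = w"
proof -
  obtain r S1 L1 where S1: "S1 \<in> carrier_mat n r" and L1: "L1 \<in> carrier_mat r n"
    and LS1: "L1 * S1 = 1\<^sub>m r"
    and W1_iff: "\<And>w. w \<in> W 1 \<longleftrightarrow> w \<in> carrier_mat n 1 \<and> S1 * (L1 * w) = w"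
    using subspace_projector[OF W1] by metis
  \<comment> \<open>the object with eigenvalues in the fundamental annulus; \<open>W 1\<close> is an invariant subspace of it\<close>
  define A' where "A' = diag_op (\<lambda>i. q powi (- deg i)) * A"
  have Ac: "A \<in> carrier_mat n n"
    using A by (rule GL_carrier)
  have A'GL: "A' \<in> GL n"
    unfolding A'_def diag_op_def using q0 by (intro GL_mult(1)[OF _ A] spectral_diag_GL[OF d]) auto
  note A'c = GL_carrier[OF A'GL] and A'i = mat_inv_GL[OF A'GL]
  have st: "w \<in> W 1 \<longleftrightarrow> A' * w \<in> W 1" if w: "w \<in> carrier_mat n 1" for w
  proof -
    have "w \<in> W 1 \<longleftrightarrow> A * w \<in> W q"
      using shift_stable[of 1 w] w by simp
    also have "\<dots> \<longleftrightarrow> diag_op (\<lambda>i. q powi (- deg i)) * (A * w) \<in> W 1"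
      using transport_to_1[OF q0 mult_carrier_mat[OF Ac w]] .
    also have "diag_op (\<lambda>i. q powi (- deg i)) * (A * w) = A' * w"
      unfolding A'_def by (rule assoc_mult_mat[OF diag_op_carrier Ac w, symmetric])
    finally show ?thesis .
  qed
  have S1W: "S1 * C \<in> W 1" if C: "C \<in> carrier_mat r 1" for C
    unfolding W1_iff using S1 C mat_cancel_left[OF LS1 L1 S1 C] by simp
  have fixed: "S1 * (L1 * (X * S1)) = X * S1"
    if X: "X \<in> carrier_mat n n" and XW: "\<And>w. w \<in> W 1 \<Longrightarrow> X * w \<in> W 1" for X
  proof (rule mat_eq_columnsI)
    fix C :: "complex mat" assume C: "C \<in> carrier_mat r 1"
    have "X * (S1 * C) \<in> W 1"
      using XW S1W[OF C] .
    then have "S1 * (L1 * (X * (S1 * C))) = X * (S1 * C)"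
      unfolding W1_iff by blast
    then show "S1 * (L1 * (X * S1)) * C = X * S1 * C"
      using S1 L1 X C by (simp add: mat_assoc_dim del: assoc_mult_mat)
  qed (use S1 L1 X in \<open>auto simp: mat_assoc_dim\<close>)
  have fix1: "S1 * (L1 * (A' * S1)) = A' * S1"
    using st W1(1) by (intro fixed[OF A'c]) blast
  have fix2: "S1 * (L1 * (mat_inv A' * S1)) = mat_inv A' * S1"
  proof (rule fixed[OF A'i(1)])
    fix w assume w: "w \<in> W 1"
    then have wc: "w \<in> carrier_mat n 1"
      using W1(1) by blast
    have "A' * (mat_inv A' * w) = w"
      by (rule mat_cancel_left[OF A'i(2) A'c A'i(1) wc])
    then show "mat_inv A' * w \<in> W 1"
      using st[OF mult_carrier_mat[OF A'i(1) wc]] w by simp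
  qed
  define B where "B = L1 * (A' * S1)"
  define B' where "B' = L1 * (mat_inv A' * S1)"
  have Bc: "B \<in> carrier_mat r r" "B' \<in> carrier_mat r r"
    unfolding B_def B'_def using S1 L1 A'c A'i(1) by (auto intro!: mult_carrier_mat[of _ r n _ r] mult_carrier_mat[of _ n n _ r])
  have "B * B' = L1 * (A' * (S1 * (L1 * (mat_inv A' * S1))))"
    unfolding B_def B'_def using S1 L1 A'c A'i(1) by (simp add: mat_assoc_dim del: assoc_mult_mat)
  also have "\<dots> = 1\<^sub>m r"
    unfolding fix2 mat_cancel_left[OF A'i(2) A'c A'i(1) S1] by (rule LS1)
  finally have BB': "B * B' = 1\<^sub>m r" .
  have "B' * B = L1 * (mat_inv A' * (S1 * (L1 * (A' * S1))))"
    unfolding B_def B'_def using S1 L1 A'c A'i(1) by (simp add: mat_assoc_dim del: assoc_mult_mat)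
  also have "\<dots> = 1\<^sub>m r"
    unfolding fix1 mat_cancel_left[OF A'i(3) A'i(1) A'c S1] by (rule LS1)
  finally have B'B: "B' * B = 1\<^sub>m r" .
  have BGL: "B \<in> GL r"
    by (rule GL_memI(1)[OF Bc BB' B'B])
  define S where "S = gauge_mat 1 * const_mat S1"
  define L where "L = const_mat L1 * gauge_mat (- 1)"
  have cS1: "const_mat S1 \<in> carrier_mat n r" and cL1: "const_mat L1 \<in> carrier_mat r n"
    and cB: "const_mat B \<in> carrier_mat r r" and cA: "const_mat A \<in> carrier_mat n n"
    and cA': "const_mat A' \<in> carrier_mat n n"
    using S1 L1 Bc Ac A'c by auto
  have S: "S \<in> carrier_mat n r" and L: "L \<in> carrier_mat r n"
    unfolding S_def L_def
    by (rule mult_carrier_mat[OF gauge_carrier cS1], rule mult_carrier_mat[OF cL1 gauge_carrier])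
  have "L * S = const_mat L1 * const_mat S1"
    unfolding L_def S_def using gauge_carrier[of 1] gauge_carrier[of "- 1"] cS1 cL1
    by (simp add: mat_assoc_dim mat_cancel_dim[OF gauge_inverse] del: assoc_mult_mat)
  then have LS: "L * S = 1\<^sub>m r"
    using LS1 by (simp flip: const_mat_mult[OF L1 S1])
  have hom: "S \<in> local_hom R q B A"
  proof -
    have R: "R (S $$ (i, j))" if "i < n" "j < r" for i j
      unfolding S_def by (rule R_mat_const_mult(2)[OF gauge_carrier gauge_R S1 that])
    have "const_mat S1 * const_mat B = const_mat (S1 * B)"
      by (rule const_mat_mult[OF S1 Bc(1), symmetric])
    also have "S1 * B = A' * S1"
      unfolding B_def by (rule fix1)
    also have "const_mat (A' * S1) = const_mat A' * const_mat S1"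
      by (rule const_mat_mult[OF A'c S1])
    finally have SB: "const_mat S1 * const_mat B = const_mat A' * const_mat S1" .
    have shc: "shift_mat q (gauge_mat 1) \<in> carrier_mat n n"
      using gauge_carrier by simp
    have "shift_mat q S * const_mat B = shift_mat q (gauge_mat 1) * (const_mat S1 * const_mat B)"
      unfolding S_def shift_mat_mult[OF gauge_carrier cS1] shift_mat_const
      by (rule assoc_mult_mat[OF shc cS1 cB])
    also have "\<dots> = shift_mat q (gauge_mat 1) * const_mat A' * const_mat S1"
      unfolding SB by (rule assoc_mult_mat[OF shc cA' cS1, symmetric])
    also have "\<dots> = const_mat A * S"
      unfolding A'_def gauge_equation S_def by (rule assoc_mult_mat[OF cA gauge_carrier cS1])
    finally have "shift_mat q S * const_mat B = const_mat A * S" .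
    then show ?thesis
      using S Bc(1) Ac R unfolding local_hom_def by auto
  qed
  have ev: "mat_regular z S \<and> mat_regular z L \<and> eval_mat z S = diag_op (\<lambda>i. z powi deg i) * S1 \<and>
      eval_mat z L = L1 * diag_op (\<lambda>i. z powi (- deg i))" if z: "z \<noteq> 0" for z
    unfolding S_def L_def
    using mat_mult_eval[OF z gauge_carrier gauge_eval(1)[OF z, of 1] cS1 mat_regular_const[OF z]]
      mat_mult_eval[OF z cL1 mat_regular_const[OF z] gauge_carrier gauge_eval(1)[OF z, of "- 1"]]
      gauge_eval(2)[OF z, of 1] gauge_eval(2)[OF z, of "- 1"] z by simp
  have iff: "w \<in> W z \<longleftrightarrow> eval_mat z S * (eval_mat z L * w) = w"
    if z: "z \<noteq> 0" and w: "w \<in> carrier_mat n 1" for z w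
  proof -
    let ?U = "diag_op (\<lambda>i. z powi deg i)" and ?V = "diag_op (\<lambda>i. z powi (- deg i))"
    note U = diag_op_carrier[of "\<lambda>i. z powi deg i"] and V = diag_op_carrier[of "\<lambda>i. z powi (- deg i)"]
    have one: "diag_op (\<lambda>_. 1) = 1\<^sub>m n"
      using spectral_dataD[OF d] by (simp add: diag_op_def right_mult_one_mat[of _ n n])
    have UV: "?U * ?V = 1\<^sub>m n" "?V * ?U = 1\<^sub>m n"
      using z by (simp_all add: diag_op_mult one power_int_minus)
    have Vw: "?V * w \<in> carrier_mat n 1"
      using V w by (rule mult_carrier_mat)
    have E: "eval_mat z S * (eval_mat z L * w) = ?U * (S1 * (L1 * (?V * w)))"
      using ev[OF z] S1 L1 U V w by (simp add: mat_assoc_dim del: assoc_mult_mat)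
    have X: "S1 * (L1 * (?V * w)) \<in> carrier_mat n 1"
      using S1 L1 Vw by (auto intro: mult_carrier_mat)
    have "w \<in> W z \<longleftrightarrow> S1 * (L1 * (?V * w)) = ?V * w"
      using transport_to_1[OF z w] Vw W1_iff by blast
    also have "\<dots> \<longleftrightarrow> ?U * (S1 * (L1 * (?V * w))) = w"
      using mat_cancel_left[OF UV(1) U V w] mat_cancel_left[OF UV(2) V U X] by metis
    finally show ?thesis
      unfolding E .
  qed
  show thesis
    by (rule that[OF BGL S L hom LS]) (use ev iff in blast)+
qed

end

text \<open>After the gauge transformation all eigenvalues of \<open>A\<close> lie in the fundamental annulus. Stability
  under the shift arrow then makes the fibre at \<open>1\<close> an invariant subspace of the transformed matrix,
  and stability under the characters makes the fibre at \<open>z\<close> its image under the gauge. The matrix \<open>L\<close>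
  is kept because \<open>S L\<close> projects onto the family and \<open>L\<close> is free of singularities.\<close>

lemma local_subobject:
  assumes q: "norm q > 1" and A: "A \<in> GL n"
    and W1: "W 1 \<subseteq> carrier_mat n 1" "0\<^sub>m n 1 \<in> W 1"
      "\<And>v w. v \<in> W 1 \<Longrightarrow> w \<in> W 1 \<Longrightarrow> v + w \<in> W 1" "\<And>c w. w \<in> W 1 \<Longrightarrow> c \<cdot>\<^sub>m w \<in> W 1"
    and stable: "\<And>a b h w. a \<noteq> 0 \<Longrightarrow> b \<noteq> 0 \<Longrightarrow>
      h \<in> Iso_tensor (local_cat R q) (omega a) (omega b) \<Longrightarrow> w \<in> carrier_mat n 1 \<Longrightarrow>
      w \<in> W a \<longleftrightarrow> h A * w \<in> W b"
  obtains r B S L where "B \<in> GL r" "S \<in> carrier_mat n r" "L \<in> carrier_mat r n"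
    "S \<in> local_hom R q B A" "L * S = 1\<^sub>m r"
    "\<And>z. z \<noteq> 0 \<Longrightarrow> mat_regular z S" "\<And>z. z \<noteq> 0 \<Longrightarrow> mat_regular z L"
    "\<And>z w. z \<noteq> 0 \<Longrightarrow> w \<in> carrier_mat n 1 \<Longrightarrow> w \<in> W z \<longleftrightarrow> eval_mat z S * (eval_mat z L * w) = w"
proof -
  obtain P P' J where d: "spectral_data n A P P' J"
    using spectral_data_exists[OF A] by blast
  show thesis
    by (rule local_subobject_aux[where q = q and n = n and A = A and P = P and P' = P' and
          J = J and W = W, OF q A d W1(1,2)]) (fact W1 stable that)+
qed

end

section \<open>The category of connection triples\<close>

lemma regular_direct_sum: "z \<noteq> 0 \<Longrightarrow> mat_regular z M \<Longrightarrow> mat_regular z N \<Longrightarrow> mat_regular z (mat_direct_sum M N)"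
  by (auto simp: mat_regular_def mat_direct_sum_def)

lemma mat_direct_sum_map: "h 0 = 0 \<Longrightarrow> map_mat h (mat_direct_sum A B) = mat_direct_sum (map_mat h A) (map_mat h B)"
  by (auto simp: mat_direct_sum_def intro!: eq_matI)

lemma mat_inv_one: "mat_inv (1\<^sub>m n) = (1\<^sub>m n :: 'a :: comm_ring_1 mat)"
  by (rule GL_memI(2)) auto

lemma scalar_mat_eqI:
  "A \<in> carrier_mat 1 1 \<Longrightarrow> B \<in> carrier_mat 1 1 \<Longrightarrow> A $$ (0, 0) = B $$ (0, 0) \<Longrightarrow> A = B"
  by (rule eq_matI) auto

locale connection_category =
  fixes q :: complex and \<Sigma> :: "complex set"
  assumes q: "norm q > 1" and fin: "finite \<Sigma>"
begin

abbreviation "Cat \<equiv> C_Sigma q \<Sigma>"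

abbreviation "Iso x y \<equiv> Iso_tensor Cat (fibre x) (fibre y)"

definition rank :: "triple \<Rightarrow> nat" where
  "rank X = dim_row (zero_part X)"

sublocale zero: laurent_ring mero_plane mero_laurent
  by (rule laurent_ring_plane)

sublocale infinity: laurent_ring mero_sphere_minus_0 "\<lambda>f c. mero_laurent (mero_inv f) (\<lambda>m. c (- m))"
  by (rule laurent_ring_sphere)

lemma q0: "q \<noteq> 0"
  using q by auto

lemma countable_orbits: "countable (q_orbits q \<Sigma>)"
proof -
  have "q_orbits q \<Sigma> = (\<lambda>(k, s). q powi k * s) ` (UNIV \<times> \<Sigma>)"
    by (auto simp: q_orbits_def image_iff)
  moreover have "countable (UNIV \<times> \<Sigma> :: (int \<times> complex) set)"
    using fin by (intro countable_SIGMA) (auto intro: countable_finite)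
  ultimately show ?thesis
    by simp
qed

lemma Cat_simps [simp]: "Hom Cat = triple_hom q" "tensor Cat = triple_tensor"
  "unit_obj Cat = (1\<^sub>m 1, 1\<^sub>m 1, 1\<^sub>m 1)"
  by (simp_all add: C_Sigma_def)

lemma singular_set_subset_iff:
  "singular_set M \<subseteq> Z \<longleftrightarrow> (\<forall>z. z \<noteq> 0 \<longrightarrow> z \<notin> Z \<longrightarrow> mat_regular z M \<and> mat_regular z (mat_inv M))"
proof -
  have "\<not> mero_pole f 0" for f
    by transfer simp
  then have nz: "z \<noteq> 0" if "z \<in> poles_mat N" for z N
    using that by (auto simp: poles_mat_def)
  have "singular_set M \<subseteq> Z \<longleftrightarrow>
      (\<forall>z. z \<noteq> 0 \<longrightarrow> z \<notin> Z \<longrightarrow> z \<notin> poles_mat M \<and> z \<notin> poles_mat (mat_inv M))"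
    unfolding singular_set_def using nz[of _ M] nz[of _ "mat_inv M"] by blast
  also have "\<dots> \<longleftrightarrow> (\<forall>z. z \<noteq> 0 \<longrightarrow> z \<notin> Z \<longrightarrow> mat_regular z M \<and> mat_regular z (mat_inv M))"
    by (simp add: mat_regular_iff cong: imp_cong)
  finally show ?thesis .
qed

lemma Obj_iff:
  "(A0, M, Ai) \<in> Obj Cat \<longleftrightarrow> (\<exists>n. A0 \<in> GL n \<and> Ai \<in> GL n \<and> M \<in> GL n \<and>
     shift_mat q M * const_mat A0 = const_mat Ai * M \<and>
     (\<forall>z. z \<noteq> 0 \<longrightarrow> z \<notin> q_orbits q \<Sigma> \<longrightarrow> mat_regular z M \<and> mat_regular z (mat_inv M)))"
  by (auto simp: C_Sigma_def triples_def singular_set_subset_iff)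

lemma ObjI:
  assumes "A0 \<in> GL n" "Ai \<in> GL n" "M \<in> GL n" "shift_mat q M * const_mat A0 = const_mat Ai * M"
    "\<And>z. z \<noteq> 0 \<Longrightarrow> z \<notin> q_orbits q \<Sigma> \<Longrightarrow> mat_regular z M \<and> mat_regular z (mat_inv M)"
  shows "(A0, M, Ai) \<in> Obj Cat" "rank (A0, M, Ai) = n"
  using assms GL_dim_unique by (auto simp: Obj_iff rank_def)

lemma ObjE:
  assumes "X \<in> Obj Cat"
  obtains A0 M Ai where "X = (A0, M, Ai)" "A0 \<in> GL (rank X)" "Ai \<in> GL (rank X)" "M \<in> GL (rank X)"
    "shift_mat q M * const_mat A0 = const_mat Ai * M"
    "\<And>z. z \<noteq> 0 \<Longrightarrow> z \<notin> q_orbits q \<Sigma> \<Longrightarrow> mat_regular z M"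
    "\<And>z. z \<noteq> 0 \<Longrightarrow> z \<notin> q_orbits q \<Sigma> \<Longrightarrow> mat_regular z (mat_inv M)"
proof -
  obtain A0 M Ai where X: "X = (A0, M, Ai)"
    by (cases X)
  then obtain n where n: "A0 \<in> GL n" "Ai \<in> GL n" "M \<in> GL n"
    "shift_mat q M * const_mat A0 = const_mat Ai * M"
    "\<forall>z. z \<noteq> 0 \<longrightarrow> z \<notin> q_orbits q \<Sigma> \<longrightarrow> mat_regular z M \<and> mat_regular z (mat_inv M)"
    using assms Obj_iff by blast
  moreover have "rank X = n"
    using n(1) GL_dim_unique by (auto simp: rank_def X)
  ultimately show thesis
    using that[of A0 M Ai] X by blast
qed

lemma fibre_comp_simps [simp]:
  "fib_dim (fibre_comp p r F) = fib_dim F \<circ> p" "fib_map (fibre_comp p r F) = fib_map F \<circ> r"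
  by (simp_all add: fibre_comp_def)

lemma fib_dim_fibre: "X \<in> Obj Cat \<Longrightarrow> fib_dim (fibre x) X = rank X"
proof -
  assume "X \<in> Obj Cat"
  then obtain A0 M Ai where X: "X = (A0, M, Ai)" and GL: "A0 \<in> GL (rank X)" "Ai \<in> GL (rank X)"
    using ObjE by metis
  have "zero_part X = A0" "infinity_part X = Ai"
    by (simp_all add: X)
  then show ?thesis
    using GL[THEN GL_dim_unique] by (cases x) simp_all
qed

lemma fib_map_carrier:
  assumes "X \<in> Obj Cat" "Y \<in> Obj Cat" "f \<in> triple_hom q X Y"
  shows "fib_map (fibre x) f \<in> carrier_mat (rank Y) (rank X)"
proof -
  obtain A0 M Ai where X: "X = (A0, M, Ai)" "A0 \<in> GL (rank X)" "Ai \<in> GL (rank X)"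
    using ObjE[OF assms(1)] by metis
  obtain B0 N Bi where Y: "Y = (B0, N, Bi)" "B0 \<in> GL (rank Y)" "Bi \<in> GL (rank Y)"
    using ObjE[OF assms(2)] by metis
  have "fst f \<in> local_hom mero_plane q A0 B0" "snd f \<in> local_hom mero_sphere_minus_0 q Ai Bi"
    using assms(3) unfolding X(1) Y(1) by auto
  then have "fst f \<in> carrier_mat (rank Y) (rank X)" "snd f \<in> carrier_mat (rank Y) (rank X)"
    using zero.local_hom_carrier[OF _ X(2) Y(2)] infinity.local_hom_carrier[OF _ X(3) Y(3)] by blast+
  then show ?thesis
    by (cases x) auto
qed

lemma IsoI:
  assumes "h \<in> extensional (Obj Cat)"
    "\<And>X. X \<in> Obj Cat \<Longrightarrow> h X \<in> GL (rank X)"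
    "\<And>X Y f. X \<in> Obj Cat \<Longrightarrow> Y \<in> Obj Cat \<Longrightarrow> f \<in> triple_hom q X Y \<Longrightarrow>
      fib_map (fibre y) f * h X = h Y * fib_map (fibre x) f"
    "\<And>X Y. X \<in> Obj Cat \<Longrightarrow> Y \<in> Obj Cat \<Longrightarrow> h (triple_tensor X Y) = kronecker (h X) (h Y)"
    "h (1\<^sub>m 1, 1\<^sub>m 1, 1\<^sub>m 1) = 1\<^sub>m 1"
  shows "h \<in> Iso x y"
  using assms by (auto simp: Iso_tensor_def fib_dim_fibre GL_iff)

lemma IsoD:
  assumes "h \<in> Iso x y"
  shows "h \<in> extensional (Obj Cat)"
    "X \<in> Obj Cat \<Longrightarrow> h X \<in> GL (rank X)"
    "X \<in> Obj Cat \<Longrightarrow> Y \<in> Obj Cat \<Longrightarrow> f \<in> triple_hom q X Y \<Longrightarrow>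
      fib_map (fibre y) f * h X = h Y * fib_map (fibre x) f"
    "X \<in> Obj Cat \<Longrightarrow> Y \<in> Obj Cat \<Longrightarrow> h (triple_tensor X Y) = kronecker (h X) (h Y)"
    "h (1\<^sub>m 1, 1\<^sub>m 1, 1\<^sub>m 1) = 1\<^sub>m 1"
  using assms by (auto simp: Iso_tensor_def fib_dim_fibre GL_iff)

lemma unit_Obj: "(1\<^sub>m 1, 1\<^sub>m 1, 1\<^sub>m 1) \<in> Obj Cat"
  and rank_unit: "rank (1\<^sub>m 1, 1\<^sub>m 1, 1\<^sub>m 1) = 1"
proof -
  show "(1\<^sub>m 1, 1\<^sub>m 1, 1\<^sub>m 1) \<in> Obj Cat"
    by (rule ObjI(1)[of _ 1]) (use one_GL[of 1] in \<open>simp_all add: mat_inv_one\<close>)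
qed (simp add: rank_def)

lemma binary_op_Obj:
  fixes F :: "complex mat \<Rightarrow> complex mat \<Rightarrow> complex mat" and G :: "mero mat \<Rightarrow> mero mat \<Rightarrow> mero mat"
  assumes X: "(A0, M, Ai) \<in> Obj Cat" and Y: "(B0, N, Bi) \<in> Obj Cat"
    and F: "\<And>n p A B. A \<in> GL n \<Longrightarrow> B \<in> GL p \<Longrightarrow> F A B \<in> GL (d n p)"
    and G: "\<And>n p A B. A \<in> GL n \<Longrightarrow> B \<in> GL p \<Longrightarrow> G A B \<in> GL (d n p)"
      "\<And>n p A B. A \<in> GL n \<Longrightarrow> B \<in> GL p \<Longrightarrow> mat_inv (G A B) = G (mat_inv A) (mat_inv B)"
      "\<And>n p A B C D. A \<in> carrier_mat n n \<Longrightarrow> B \<in> carrier_mat p p \<Longrightarrow> C \<in> carrier_mat n n \<Longrightarrow>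
        D \<in> carrier_mat p p \<Longrightarrow> G A B * G C D = G (A * C) (B * D)"
      "\<And>A B. shift_mat q (G A B) = G (shift_mat q A) (shift_mat q B)"
      "\<And>A B. const_mat (F A B) = G (const_mat A) (const_mat B)"
      "\<And>z A B. z \<noteq> 0 \<Longrightarrow> mat_regular z A \<Longrightarrow> mat_regular z B \<Longrightarrow> mat_regular z (G A B)"
  shows "(F A0 B0, G M N, F Ai Bi) \<in> Obj Cat"
    "rank (F A0 B0, G M N, F Ai Bi) = d (rank (A0, M, Ai)) (rank (B0, N, Bi))"
proof -
  define n p where "n = rank (A0, M, Ai)" and "p = rank (B0, N, Bi)"
  have x: "A0 \<in> GL n" "Ai \<in> GL n" "M \<in> GL n" "shift_mat q M * const_mat A0 = const_mat Ai * M"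
    "\<And>z. z \<noteq> 0 \<Longrightarrow> z \<notin> q_orbits q \<Sigma> \<Longrightarrow> mat_regular z M"
    "\<And>z. z \<noteq> 0 \<Longrightarrow> z \<notin> q_orbits q \<Sigma> \<Longrightarrow> mat_regular z (mat_inv M)"
    unfolding n_def by (rule ObjE[OF X]; blast)+
  have y: "B0 \<in> GL p" "Bi \<in> GL p" "N \<in> GL p" "shift_mat q N * const_mat B0 = const_mat Bi * N"
    "\<And>z. z \<noteq> 0 \<Longrightarrow> z \<notin> q_orbits q \<Sigma> \<Longrightarrow> mat_regular z N"
    "\<And>z. z \<noteq> 0 \<Longrightarrow> z \<notin> q_orbits q \<Sigma> \<Longrightarrow> mat_regular z (mat_inv N)"
    unfolding p_def by (rule ObjE[OF Y]; blast)+
  note c = x(1-3)[THEN GL_carrier] y(1-3)[THEN GL_carrier]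
  have "shift_mat q (G M N) * const_mat (F A0 B0) =
      G (shift_mat q M * const_mat A0) (shift_mat q N * const_mat B0)"
    unfolding G(4,5) using c by (intro G(3)[of _ n _ p]) auto
  also have "\<dots> = const_mat (F Ai Bi) * G M N"
    unfolding x(4) y(4) G(5) using c by (intro G(3)[of _ n _ p, symmetric]) auto
  finally have eq: "shift_mat q (G M N) * const_mat (F A0 B0) = const_mat (F Ai Bi) * G M N" .
  have "mat_regular z (G M N) \<and> mat_regular z (mat_inv (G M N))"
    if z: "z \<noteq> 0" "z \<notin> q_orbits q \<Sigma>" for z
    unfolding G(2)[OF x(3) y(3)] using G(6)[OF z(1) x(5)[OF z] y(5)[OF z]]
      G(6)[OF z(1) x(6)[OF z] y(6)[OF z]] by blast
  from ObjI[OF F[OF x(1) y(1)] F[OF x(2) y(2)] G(1)[OF x(3) y(3)] eq this]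
  show "(F A0 B0, G M N, F Ai Bi) \<in> Obj Cat"
    "rank (F A0 B0, G M N, F Ai Bi) = d (rank (A0, M, Ai)) (rank (B0, N, Bi))"
    by (simp_all add: n_def p_def)
qed

lemma tensor_Obj:
  assumes "X \<in> Obj Cat" "Y \<in> Obj Cat"
  shows "triple_tensor X Y \<in> Obj Cat" "rank (triple_tensor X Y) = rank X * rank Y"
proof -
  obtain A0 M Ai B0 N Bi where XY: "X = (A0, M, Ai)" "Y = (B0, N, Bi)"
    by (cases X, cases Y) blast
  have "(kronecker A0 B0, kronecker M N, kronecker Ai Bi) \<in> Obj Cat \<and>
      rank (kronecker A0 B0, kronecker M N, kronecker Ai Bi) = rank (A0, M, Ai) * rank (B0, N, Bi)"
    by (intro conjI binary_op_Obj[where d = "(*)", OF assms[unfolded XY]])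
      (auto simp: kronecker_GL kronecker_mult kronecker_regular mero_shift_hom mero_const_hom
        intro!: kronecker_map)
  then show "triple_tensor X Y \<in> Obj Cat" "rank (triple_tensor X Y) = rank X * rank Y"
    by (simp_all add: XY)
qed

subsection \<open>Direct sums and matrix coefficients\<close>

fun triple_sum :: "triple \<Rightarrow> triple \<Rightarrow> triple" where
  "triple_sum (A0, M, Ai) (B0, N, Bi) = (mat_direct_sum A0 B0, mat_direct_sum M N, mat_direct_sum Ai Bi)"

lemma incl_local_hom:
  assumes R: "R 0" "R (1 :: mero)" and A: "A \<in> GL n" and B: "B \<in> GL p"
  shows "incl1 n p \<in> local_hom R q A (mat_direct_sum A B)" "incl2 n p \<in> local_hom R q B (mat_direct_sum A B)"
proof -
  note c = GL_carrier[OF A] GL_carrier[OF B]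
  have e: "R f" if "f \<in> elements_mat (incl1 n p) \<or> f \<in> elements_mat (incl2 n p)" for f
    using that R by (auto simp: incl1_def incl2_def split: if_splits)
  have "const_mat (mat_direct_sum A B) = mat_direct_sum (const_mat A) (const_mat B)"
    by (rule mat_direct_sum_map) (simp add: mero_const_hom)
  moreover have "shift_mat q (incl1 n p) = incl1 n p" "shift_mat q (incl2 n p) = incl2 n p"
    by (simp_all add: incl_map)
  moreover have "const_mat A \<in> carrier_mat n n" "const_mat B \<in> carrier_mat p p"
    using c by auto
  ultimately show "incl1 n p \<in> local_hom R q A (mat_direct_sum A B)"
    "incl2 n p \<in> local_hom R q B (mat_direct_sum A B)"
    using e c incl_carrier[of n p] mat_direct_sum_carrier[OF c]
      mat_direct_sum_incl[of "const_mat A" n n "const_mat B" p p]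
    by (auto simp: local_hom_def)
qed

lemma sum_Obj:
  assumes X: "X \<in> Obj Cat" and Y: "Y \<in> Obj Cat"
  shows "triple_sum X Y \<in> Obj Cat" "rank (triple_sum X Y) = rank X + rank Y"
    "(incl1 (rank X) (rank Y), incl1 (rank X) (rank Y)) \<in> triple_hom q X (triple_sum X Y)"
    "(incl2 (rank X) (rank Y), incl2 (rank X) (rank Y)) \<in> triple_hom q Y (triple_sum X Y)"
proof -
  obtain A0 M Ai where x: "X = (A0, M, Ai)" "A0 \<in> GL (rank X)" "Ai \<in> GL (rank X)" "M \<in> GL (rank X)"
    using ObjE[OF X] by metis
  obtain B0 N Bi where y: "Y = (B0, N, Bi)" "B0 \<in> GL (rank Y)" "Bi \<in> GL (rank Y)" "N \<in> GL (rank Y)"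
    using ObjE[OF Y] by metis
  note c = x(2-4)[THEN GL_carrier] y(2-4)[THEN GL_carrier]
  have "(mat_direct_sum A0 B0, mat_direct_sum M N, mat_direct_sum Ai Bi) \<in> Obj Cat \<and>
      rank (mat_direct_sum A0 B0, mat_direct_sum M N, mat_direct_sum Ai Bi) =
      rank (A0, M, Ai) + rank (B0, N, Bi)"
    by (intro conjI binary_op_Obj[where d = "(+)", OF X[unfolded x(1)] Y[unfolded y(1)]])
      (auto simp: mat_direct_sum_GL mat_direct_sum_mult mat_direct_sum_map regular_direct_sum
        mero_const_hom)
  then show "triple_sum X Y \<in> Obj Cat" "rank (triple_sum X Y) = rank X + rank Y"
    by (simp_all flip: x(1) y(1) add: triple_sum.simps[of A0 M Ai B0 N Bi, folded x(1) y(1)])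
  have R: "mero_plane 0" "mero_plane 1" "mero_sphere_minus_0 0" "mero_sphere_minus_0 1"
    using zero.R_0 zero.R_monom[of 0] infinity.R_0 infinity.R_monom[of 0] by simp_all
  have hom: "f \<in> triple_hom q Z (triple_sum X Y) \<longleftrightarrow>
      f \<in> triple_hom q Z (mat_direct_sum A0 B0, mat_direct_sum M N, mat_direct_sum Ai Bi)" for f Z
    by (simp add: x(1) y(1))
  have "f \<in> triple_hom q X Z \<longleftrightarrow> f \<in> triple_hom q (A0, M, Ai) Z"
    "f \<in> triple_hom q Y Z \<longleftrightarrow> f \<in> triple_hom q (B0, N, Bi) Z" for f Z
    by (simp_all add: x(1) y(1))
  then show "(incl1 (rank X) (rank Y), incl1 (rank X) (rank Y)) \<in> triple_hom q X (triple_sum X Y)"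
    "(incl2 (rank X) (rank Y), incl2 (rank X) (rank Y)) \<in> triple_hom q Y (triple_sum X Y)"
    using incl_local_hom[OF R(1,2) x(2) y(2)] incl_local_hom[OF R(3,4) x(3) y(3)]
      mat_direct_sum_incl[OF c(3) c(6)] by (simp_all add: hom)
qed

lemma fib_map_incl:
  assumes "x \<in> base_points"
  shows "fib_map (fibre x) (incl1 n p, incl1 n p) = incl1 n p"
    "fib_map (fibre x) (incl2 n p, incl2 n p) = incl2 n p"
  using assms by (auto simp: base_points_def incl_map)

text \<open>Constants are coefficients of the unit object; tensor products and direct sums of objects realize
  products and sums of coefficients.\<close>

lemma poly_function_coefficient:
  assumes x: "x \<in> base_points" and y: "y \<in> base_points"
    and p: "p \<in> poly_functions Cat (fibre x) (fibre y)"
  shows "\<exists>X U V. X \<in> Obj Cat \<and> U \<in> carrier_mat 1 (rank X) \<and> V \<in> carrier_mat (rank X) 1 \<and>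
    (\<forall>h \<in> Iso x y. p h = (U * (h X * V)) $$ (0, 0))"
  using p
proof induction
  case (const c)
  have "(c \<cdot>\<^sub>m 1\<^sub>m 1 * (h (1\<^sub>m 1, 1\<^sub>m 1, 1\<^sub>m 1) * 1\<^sub>m 1)) $$ (0, 0) = c" if "h \<in> Iso x y" for h
    unfolding IsoD(5)[OF that] by (simp add: scalar_prod_def)
  then show ?case
    by (intro exI[of _ "(1\<^sub>m 1, 1\<^sub>m 1, 1\<^sub>m 1)"] exI[of _ "c \<cdot>\<^sub>m 1\<^sub>m 1"] exI[of _ "1\<^sub>m 1"])
      (use unit_Obj rank_unit in auto)
next
  case (entry X i j)
  let ?U = "Matrix.mat 1 (rank X) (\<lambda>(_, k). if k = i then 1 else 0 :: complex)"
    and ?V = "Matrix.mat (rank X) 1 (\<lambda>(k, _). if k = j then 1 else 0 :: complex)"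
  have ij: "i < rank X" "j < rank X"
    using entry fib_dim_fibre by auto
  have "(?U * (h X * ?V)) $$ (0, 0) = h X $$ (i, j)" if h: "h \<in> Iso x y" for h
  proof -
    have hX: "h X \<in> carrier_mat (rank X) (rank X)"
      using IsoD(2)[OF h entry(1)] by (rule GL_carrier)
    have V: "?V \<in> carrier_mat (rank X) 1" and U: "?U \<in> carrier_mat 1 (rank X)"
      by auto
    have "(?U * (h X * ?V)) $$ (0, 0) = (\<Sum>k<rank X. ?U $$ (0, k) * (h X * ?V) $$ (k, 0))"
      by (rule mult_entry[OF U mult_carrier_mat[OF hX V]]) auto
    also have "\<dots> = (h X * ?V) $$ (i, 0)"
      using ij by (simp add: if_distrib[of "\<lambda>t. t * _"] del: index_mult_mat(1) cong: if_cong)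
    also have "\<dots> = (\<Sum>k<rank X. h X $$ (i, k) * ?V $$ (k, 0))"
      by (rule mult_entry[OF hX V ij(1)]) auto
    also have "\<dots> = h X $$ (i, j)"
      using ij by (simp add: if_distrib[of "times _"] cong: if_cong)
    finally show ?thesis .
  qed
  then show ?case
    using entry(1) by (intro exI[of _ X] exI[of _ ?U] exI[of _ ?V]) auto
next
  case (add p r)
  obtain X U V where X: "X \<in> Obj Cat" "U \<in> carrier_mat 1 (rank X)" "V \<in> carrier_mat (rank X) 1"
    and p: "\<And>h. h \<in> Iso x y \<Longrightarrow> p h = (U * (h X * V)) $$ (0, 0)"
    using add.IH(1) by blast
  obtain Y U' V' where Y: "Y \<in> Obj Cat" "U' \<in> carrier_mat 1 (rank Y)" "V' \<in> carrier_mat (rank Y) 1"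
    and r: "\<And>h. h \<in> Iso x y \<Longrightarrow> r h = (U' * (h Y * V')) $$ (0, 0)"
    using add.IH(2) by blast
  note XY = sum_Obj[OF X(1) Y(1)]
  let ?n = "rank X" and ?p = "rank Y"
  let ?i1 = "incl1 ?n ?p :: complex mat" and ?i2 = "incl2 ?n ?p :: complex mat"
  note i = incl_carrier[of ?n ?p]
  define U2 where "U2 = row_append U U'"
  define V2 where "V2 = ?i1 * V + ?i2 * V'"
  have U2: "U2 \<in> carrier_mat 1 (?n + ?p)"
    unfolding U2_def by (rule row_append_carrier[OF X(2) Y(2)])
  have iV: "?i1 * V \<in> carrier_mat (?n + ?p) 1" "?i2 * V' \<in> carrier_mat (?n + ?p) 1"
    using mult_carrier_mat[OF i(1) X(3)] mult_carrier_mat[OF i(2) Y(3)] by blast+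
  have V2: "V2 \<in> carrier_mat (?n + ?p) 1"
    unfolding V2_def using iV by auto
  have "p h + r h = (U2 * (h (triple_sum X Y) * V2)) $$ (0, 0)" if h: "h \<in> Iso x y" for h
  proof -
    let ?H = "h (triple_sum X Y)"
    have H: "?H \<in> carrier_mat (?n + ?p) (?n + ?p)" and hX: "h X \<in> carrier_mat ?n ?n"
      and hY: "h Y \<in> carrier_mat ?p ?p"
      using IsoD(2)[OF h XY(1)] IsoD(2)[OF h X(1)] IsoD(2)[OF h Y(1)] XY(2)
      by (auto intro: GL_carrier)
    have n1: "?i1 * h X = ?H * ?i1"
      using IsoD(3)[OF h X(1) XY(1) XY(3)] fib_map_incl x y by simp
    have n2: "?i2 * h Y = ?H * ?i2"
      using IsoD(3)[OF h Y(1) XY(1) XY(4)] fib_map_incl x y by simp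
    have hV: "h X * V \<in> carrier_mat ?n 1" "h Y * V' \<in> carrier_mat ?p 1"
      using mult_carrier_mat[OF hX X(3)] mult_carrier_mat[OF hY Y(3)] by blast+
    have "?H * V2 = ?H * (?i1 * V) + ?H * (?i2 * V')"
      unfolding V2_def by (rule mult_add_distrib_mat[OF H iV])
    also have "?H * (?i1 * V) = ?i1 * (h X * V)"
      using assoc_mult_mat[OF H i(1) X(3)] assoc_mult_mat[OF i(1) hX X(3)] n1 by simp
    also have "?H * (?i2 * V') = ?i2 * (h Y * V')"
      using assoc_mult_mat[OF H i(2) Y(3)] assoc_mult_mat[OF i(2) hY Y(3)] n2 by simp
    finally have "U2 * (?H * V2) = U2 * (?i1 * (h X * V)) + U2 * (?i2 * (h Y * V'))"
      using mult_add_distrib_mat[OF U2 mult_carrier_mat[OF i(1) hV(1)] mult_carrier_mat[OF i(2) hV(2)]]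
      by simp
    also have "U2 * (?i1 * (h X * V)) = U * (h X * V)"
      using assoc_mult_mat[OF U2 i(1) hV(1)] row_append_incl(1)[OF X(2) Y(2)]
      by (simp add: U2_def del: assoc_mult_mat)
    also have "U2 * (?i2 * (h Y * V')) = U' * (h Y * V')"
      using assoc_mult_mat[OF U2 i(2) hV(2)] row_append_incl(2)[OF X(2) Y(2)]
      by (simp add: U2_def del: assoc_mult_mat)
    finally have "(U2 * (?H * V2)) $$ (0, 0) = (U * (h X * V) + U' * (h Y * V')) $$ (0, 0)"
      by simp
    also have "\<dots> = (U * (h X * V)) $$ (0, 0) + (U' * (h Y * V')) $$ (0, 0)"
      using mult_carrier_mat[OF Y(2) hV(2)] by (intro index_add_mat) auto
    finally show ?thesis
      using p[OF h] r[OF h] by simp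
  qed
  then show ?case
    using XY(1,2) U2 V2 by (intro exI[of _ "triple_sum X Y"] exI[of _ U2] exI[of _ V2]) auto
next
  case (mult p r)
  obtain X U V where X: "X \<in> Obj Cat" "U \<in> carrier_mat 1 (rank X)" "V \<in> carrier_mat (rank X) 1"
    and p: "\<And>h. h \<in> Iso x y \<Longrightarrow> p h = (U * (h X * V)) $$ (0, 0)"
    using mult.IH(1) by blast
  obtain Y U' V' where Y: "Y \<in> Obj Cat" "U' \<in> carrier_mat 1 (rank Y)" "V' \<in> carrier_mat (rank Y) 1"
    and r: "\<And>h. h \<in> Iso x y \<Longrightarrow> r h = (U' * (h Y * V')) $$ (0, 0)"
    using mult.IH(2) by blast
  note XY = tensor_Obj[OF X(1) Y(1)]
  have "p h * r h = (kronecker U U' * (h (triple_tensor X Y) * kronecker V V')) $$ (0, 0)"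
    if h: "h \<in> Iso x y" for h
  proof -
    have hX: "h X \<in> carrier_mat (rank X) (rank X)" and hY: "h Y \<in> carrier_mat (rank Y) (rank Y)"
      using IsoD(2)[OF h X(1)] IsoD(2)[OF h Y(1)] by (auto intro: GL_carrier)
    have hV: "h X * V \<in> carrier_mat (rank X) 1" "h Y * V' \<in> carrier_mat (rank Y) 1"
      using mult_carrier_mat[OF hX X(3)] mult_carrier_mat[OF hY Y(3)] by blast+
    have "kronecker U U' * (h (triple_tensor X Y) * kronecker V V') =
        kronecker (U * (h X * V)) (U' * (h Y * V'))"
      unfolding IsoD(4)[OF h X(1) Y(1)] kronecker_mult[OF hX X(3) hY Y(3)]
      by (rule kronecker_mult[OF X(2) hV(1) Y(2) hV(2)])
    moreover have "kronecker K L $$ (0, 0) = K $$ (0, 0) * L $$ (0, 0)"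
      if "K \<in> carrier_mat 1 1" "L \<in> carrier_mat 1 1" for K L :: "complex mat"
      using that by (auto simp: kronecker_def)
    ultimately show ?thesis
      using mult_carrier_mat[OF X(2) hV(1)] mult_carrier_mat[OF Y(2) hV(2)] p[OF h] r[OF h] by simp
  qed
  moreover have "kronecker U U' \<in> carrier_mat 1 (rank X * rank Y)"
    "kronecker V V' \<in> carrier_mat (rank X * rank Y) 1"
    using kronecker_carrier[OF X(2) Y(2)] kronecker_carrier[OF X(3) Y(3)] by simp_all
  ultimately show ?case
    using XY by (intro exI[of _ "triple_tensor X Y"] exI[of _ "kronecker U U'"]
      exI[of _ "kronecker V V'"]) auto
qed

end

context connection_category
begin

section \<open>The generated groupoid\<close>

lemma Iso_carrier: "h \<in> Iso x y \<Longrightarrow> X \<in> Obj Cat \<Longrightarrow> h X \<in> carrier_mat (rank X) (rank X)"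
  by (rule GL_carrier[OF IsoD(2)])

lemma id_iso_Iso: "id_iso Cat (fibre x) \<in> Iso x x"
proof (rule IsoI)
  show "id_iso Cat (fibre x) \<in> extensional (Obj Cat)"
    by (simp add: id_iso_def)
  have id: "id_iso Cat (fibre x) X = 1\<^sub>m (rank X)" if "X \<in> Obj Cat" for X
    using that by (simp add: id_iso_def fib_dim_fibre)
  show "id_iso Cat (fibre x) X \<in> GL (rank X)" if "X \<in> Obj Cat" for X
    using that by (simp add: id one_GL)
  show "fib_map (fibre x) f * id_iso Cat (fibre x) X = id_iso Cat (fibre x) Y * fib_map (fibre x) f"
    if "X \<in> Obj Cat" "Y \<in> Obj Cat" "f \<in> triple_hom q X Y" for X Y f
    using fib_map_carrier[OF that, of x] that
    by (simp add: id left_mult_one_mat right_mult_one_mat)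
  show "id_iso Cat (fibre x) (triple_tensor X Y) =
      kronecker (id_iso Cat (fibre x) X) (id_iso Cat (fibre x) Y)"
    if "X \<in> Obj Cat" "Y \<in> Obj Cat" for X Y
    using tensor_Obj[OF that] that by (simp add: id kronecker_one)
  show "id_iso Cat (fibre x) (1\<^sub>m 1, 1\<^sub>m 1, 1\<^sub>m 1) = 1\<^sub>m 1"
    by (simp only: id[OF unit_Obj] rank_unit)
qed

lemma comp_iso_apply: "X \<in> Obj Cat \<Longrightarrow> comp_iso Cat h g X = h X * g X"
  by (simp add: comp_iso_def)

lemma comp_iso_Iso:
  assumes g: "g \<in> Iso x y" and h: "h \<in> Iso y z"
  shows "comp_iso Cat h g \<in> Iso x z"
proof (rule IsoI)
  show "comp_iso Cat h g \<in> extensional (Obj Cat)"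
    by (simp add: comp_iso_def)
  show "comp_iso Cat h g X \<in> GL (rank X)" if "X \<in> Obj Cat" for X
    using that GL_mult(1)[OF IsoD(2)[OF h] IsoD(2)[OF g]] by (simp add: comp_iso_apply)
  show "fib_map (fibre z) f * comp_iso Cat h g X = comp_iso Cat h g Y * fib_map (fibre x) f"
    if X: "X \<in> Obj Cat" and Y: "Y \<in> Obj Cat" and f: "f \<in> triple_hom q X Y" for X Y f
  proof -
    note F = fib_map_carrier[OF X Y f]
    note c = Iso_carrier[OF h X] Iso_carrier[OF g X] Iso_carrier[OF h Y] Iso_carrier[OF g Y]
    have "fib_map (fibre z) f * (h X * g X) = fib_map (fibre z) f * h X * g X"
      by (rule assoc_mult_mat[OF F c(1,2), symmetric])
    also have "\<dots> = h Y * (fib_map (fibre y) f * g X)"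
      unfolding IsoD(3)[OF h X Y f] by (rule assoc_mult_mat[OF c(3) F c(2)])
    also have "\<dots> = h Y * g Y * fib_map (fibre x) f"
      unfolding IsoD(3)[OF g X Y f] by (rule assoc_mult_mat[OF c(3,4) F, symmetric])
    finally show ?thesis
      using X Y by (simp only: comp_iso_apply)
  qed
  show "comp_iso Cat h g (triple_tensor X Y) = kronecker (comp_iso Cat h g X) (comp_iso Cat h g Y)"
    if X: "X \<in> Obj Cat" and Y: "Y \<in> Obj Cat" for X Y
  proof -
    note c = Iso_carrier[OF h X] Iso_carrier[OF g X] Iso_carrier[OF h Y] Iso_carrier[OF g Y]
    show ?thesis
      using X Y tensor_Obj[OF X Y] IsoD(4)[OF h X Y] IsoD(4)[OF g X Y] kronecker_mult[OF c]
      by (simp add: comp_iso_apply)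
  qed
  show "comp_iso Cat h g (1\<^sub>m 1, 1\<^sub>m 1, 1\<^sub>m 1) = 1\<^sub>m 1"
    unfolding comp_iso_apply[OF unit_Obj] IsoD(5)[OF g] IsoD(5)[OF h] by simp
qed

lemma inv_iso_apply: "X \<in> Obj Cat \<Longrightarrow> inv_iso Cat h X = mat_inv (h X)"
  by (simp add: inv_iso_def)

lemma inv_iso_Iso:
  assumes h: "h \<in> Iso x y"
  shows "inv_iso Cat h \<in> Iso y x"
proof (rule IsoI)
  show "inv_iso Cat h \<in> extensional (Obj Cat)"
    by (simp add: inv_iso_def)
  show "inv_iso Cat h X \<in> GL (rank X)" if "X \<in> Obj Cat" for X
    using that mat_inv_in_GL[OF IsoD(2)[OF h that]] by (simp add: inv_iso_apply)
  show "fib_map (fibre x) f * inv_iso Cat h X = inv_iso Cat h Y * fib_map (fibre y) f"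
    if X: "X \<in> Obj Cat" and Y: "Y \<in> Obj Cat" and f: "f \<in> triple_hom q X Y" for X Y f
  proof -
    note F = fib_map_carrier[OF X Y f]
    note hX = GL_carrier[OF IsoD(2)[OF h X]] mat_inv_GL[OF IsoD(2)[OF h X]]
    note hY = GL_carrier[OF IsoD(2)[OF h Y]] mat_inv_GL[OF IsoD(2)[OF h Y]]
    have "mat_inv (h Y) * fib_map (fibre y) f =
        mat_inv (h Y) * (fib_map (fibre y) f * (h X * mat_inv (h X)))"
      unfolding hX(3) right_mult_one_mat[OF F] ..
    also have "\<dots> = mat_inv (h Y) * (fib_map (fibre y) f * h X * mat_inv (h X))"
      by (simp only: assoc_mult_mat[OF F hX(1,2)])
    also have "\<dots> = mat_inv (h Y) * (h Y * (fib_map (fibre x) f * mat_inv (h X)))"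
      unfolding IsoD(3)[OF h X Y f] by (simp only: assoc_mult_mat[OF hY(1) F hX(2)])
    also have "\<dots> = fib_map (fibre x) f * mat_inv (h X)"
      by (rule mat_cancel_left[OF hY(4) hY(2) hY(1) mult_carrier_mat[OF F hX(2)]])
    finally show ?thesis
      using X Y by (simp only: inv_iso_apply)
  qed
  show "inv_iso Cat h (triple_tensor X Y) = kronecker (inv_iso Cat h X) (inv_iso Cat h Y)"
    if X: "X \<in> Obj Cat" and Y: "Y \<in> Obj Cat" for X Y
    using X Y tensor_Obj(1)[OF X Y] IsoD(4)[OF h X Y] kronecker_GL(2)[OF IsoD(2)[OF h X] IsoD(2)[OF h Y]]
    by (simp add: inv_iso_apply)
  show "inv_iso Cat h (1\<^sub>m 1, 1\<^sub>m 1, 1\<^sub>m 1) = 1\<^sub>m 1"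
    unfolding inv_iso_apply[OF unit_Obj] IsoD(5)[OF h] by (rule mat_inv_one)
qed

lemma Iso_local_catD:
  assumes "g \<in> Iso_tensor (local_cat R q) (omega a) (omega b)"
  shows "A \<in> GL n \<Longrightarrow> g A \<in> GL n"
    "A \<in> GL n \<Longrightarrow> B \<in> GL p \<Longrightarrow> S \<in> local_hom R q A B \<Longrightarrow> eval_mat b S * g A = g B * eval_mat a S"
    "A \<in> GL n \<Longrightarrow> B \<in> GL p \<Longrightarrow> g (kronecker A B) = kronecker (g A) (g B)"
    "g (1\<^sub>m 1) = 1\<^sub>m 1"
proof -
  note g = assms[unfolded Iso_tensor_def, simplified]
  show "A \<in> GL n \<Longrightarrow> g A \<in> GL n"
    using g GL_dim_unique[of A n] by (auto simp: GL_iff[of "g A"])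
  show "A \<in> GL n \<Longrightarrow> B \<in> GL p \<Longrightarrow> S \<in> local_hom R q A B \<Longrightarrow> eval_mat b S * g A = g B * eval_mat a S"
    "A \<in> GL n \<Longrightarrow> B \<in> GL p \<Longrightarrow> g (kronecker A B) = kronecker (g A) (g B)"
    using g by blast+
  show "g (1\<^sub>m 1) = 1\<^sub>m 1"
    using g by simp
qed

lemma local_part_Iso:
  assumes g: "g \<in> Iso_tensor (local_cat R q) (omega a) (omega b)"
    and GL: "\<And>X. X \<in> Obj Cat \<Longrightarrow> obj_part X \<in> GL (rank X)"
    and hom: "\<And>X Y f. f \<in> triple_hom q X Y \<Longrightarrow> mor_part f \<in> local_hom R q (obj_part X) (obj_part Y)"
    and ten: "\<And>X Y. obj_part (triple_tensor X Y) = kronecker (obj_part X) (obj_part Y)"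
    and one: "obj_part (1\<^sub>m 1, 1\<^sub>m 1, 1\<^sub>m 1) = 1\<^sub>m 1"
    and fib: "\<And>f. fib_map (fibre x) f = eval_mat a (mor_part f)"
      "\<And>f. fib_map (fibre y) f = eval_mat b (mor_part f)"
  shows "restrict (g \<circ> obj_part) (Obj Cat) \<in> Iso x y"
proof (rule IsoI)
  let ?h = "restrict (g \<circ> obj_part) (Obj Cat)"
  note g = Iso_local_catD[OF g]
  have h: "?h X = g (obj_part X)" if "X \<in> Obj Cat" for X
    using that by simp
  show "?h X \<in> GL (rank X)" if "X \<in> Obj Cat" for X
    unfolding h[OF that] by (rule g(1)[OF GL[OF that]])
  show "fib_map (fibre y) f * ?h X = ?h Y * fib_map (fibre x) f"
    if X: "X \<in> Obj Cat" and Y: "Y \<in> Obj Cat" and f: "f \<in> triple_hom q X Y" for X Y f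
    unfolding h[OF X] h[OF Y] fib by (rule g(2)[OF GL[OF X] GL[OF Y] hom[OF f]])
  show "?h (triple_tensor X Y) = kronecker (?h X) (?h Y)" if X: "X \<in> Obj Cat" and Y: "Y \<in> Obj Cat" for X Y
    unfolding h[OF X] h[OF Y] h[OF tensor_Obj(1)[OF X Y]] ten by (rule g(3)[OF GL[OF X] GL[OF Y]])
  show "?h (1\<^sub>m 1, 1\<^sub>m 1, 1\<^sub>m 1) = 1\<^sub>m 1"
    unfolding h[OF unit_Obj] one by (rule g(4))
qed simp

lemma parts_GL: "X \<in> Obj Cat \<Longrightarrow> zero_part X \<in> GL (rank X) \<and> infinity_part X \<in> GL (rank X)"
  using ObjE[of X] by (metis (no_types, lifting) case_prod_conv)

lemma local_zero_Iso:
  assumes "g \<in> G_zero q a b"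
  shows "restrict (g \<circ> zero_part) (Obj Cat) \<in> Iso (At_zero a) (At_zero b)"
  by (rule local_part_Iso[OF assms[unfolded G_zero_def], where mor_part = fst]) (use parts_GL in auto)

lemma local_infinity_Iso:
  assumes "g \<in> G_infinity q a b"
  shows "restrict (g \<circ> infinity_part) (Obj Cat) \<in> Iso (At_infinity a) (At_infinity b)"
  by (rule local_part_Iso[OF assms[unfolded G_infinity_def], where mor_part = snd]) (use parts_GL in auto)

lemma Gamma_path_apply: "(A0, M, Ai) \<in> Obj Cat \<Longrightarrow> Gamma_path q \<Sigma> z (A0, M, Ai) = eval_mat z M"
  by (simp add: Gamma_path_def)

lemma eval_connection_GL:
  assumes M: "M \<in> GL n" and z: "z \<noteq> 0" and r: "mat_regular z M" "mat_regular z (mat_inv M)"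
  shows "eval_mat z M \<in> GL n" "mat_inv (eval_mat z M) = eval_mat z (mat_inv M)"
proof -
  note m = GL_carrier[OF M] mat_inv_GL[OF M]
  have "eval_mat z M * eval_mat z (mat_inv M) = 1\<^sub>m n" "eval_mat z (mat_inv M) * eval_mat z M = 1\<^sub>m n"
    using mat_mult_eval(2)[OF z m(1) r(1) m(2) r(2)] mat_mult_eval(2)[OF z m(2) r(2) m(1) r(1)] m z
    by simp_all
  moreover have "eval_mat z M \<in> carrier_mat n n" "eval_mat z (mat_inv M) \<in> carrier_mat n n"
    using m by auto
  ultimately show "eval_mat z M \<in> GL n" "mat_inv (eval_mat z M) = eval_mat z (mat_inv M)"
    using GL_memI by blast+
qed

lemma Gamma_path_Iso:
  assumes z: "z \<noteq> 0" "z \<notin> q_orbits q \<Sigma>"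
  shows "Gamma_path q \<Sigma> z \<in> Iso (At_zero z) (At_infinity z)"
proof (rule IsoI)
  let ?h = "Gamma_path q \<Sigma> z"
  show "?h X \<in> GL (rank X)" if Obj: "X \<in> Obj Cat" for X
  proof -
    obtain A0 M Ai where X: "X = (A0, M, Ai)" "M \<in> GL (rank X)" "mat_regular z M" "mat_regular z (mat_inv M)"
      using ObjE[OF Obj] z by metis
    show ?thesis
      using eval_connection_GL(1)[OF X(2) z(1) X(3,4)] Gamma_path_apply Obj X(1) by metis
  qed
  fix X Y assume X: "X \<in> Obj Cat" and Y: "Y \<in> Obj Cat"
  obtain A0 M Ai where x: "X = (A0, M, Ai)" "A0 \<in> GL (rank X)" "Ai \<in> GL (rank X)" "M \<in> GL (rank X)"
    "mat_regular z M"
    using ObjE[OF X] z by metis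
  obtain B0 N Bi where y: "Y = (B0, N, Bi)" "B0 \<in> GL (rank Y)" "Bi \<in> GL (rank Y)" "N \<in> GL (rank Y)"
    "mat_regular z N"
    using ObjE[OF Y] z by metis
  have hXY: "?h X = eval_mat z M" "?h Y = eval_mat z N"
    using Gamma_path_apply X Y x(1) y(1) by metis+
  show "fib_map (fibre (At_infinity z)) f * ?h X = ?h Y * fib_map (fibre (At_zero z)) f"
    if "f \<in> triple_hom q X Y" for f
  proof -
    obtain S0 Si where f: "f = (S0, Si)"
      by (cases f)
    have S: "S0 \<in> local_hom mero_plane q A0 B0" "Si \<in> local_hom mero_sphere_minus_0 q Ai Bi"
      "Si * M = N * S0"
      using that unfolding x(1) y(1) f by auto
    note S0 = zero.local_hom_carrier[OF S(1) x(2) y(2)] zero.local_hom_regular[OF q S(1) x(2) y(2) z(1)]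
    note Si = infinity.local_hom_carrier[OF S(2) x(3) y(3)]
      infinity.local_hom_regular[OF q S(2) x(3) y(3) z(1)]
    have "eval_mat z Si * eval_mat z M = eval_mat z N * eval_mat z S0"
      using mat_mult_eval(2)[OF z(1) Si GL_carrier[OF x(4)] x(5)]
        mat_mult_eval(2)[OF z(1) GL_carrier[OF y(4)] y(5) S0] S(3) by simp
    then show ?thesis
      by (simp add: hXY f)
  qed
  have "triple_tensor X Y = (kronecker A0 B0, kronecker M N, kronecker Ai Bi)"
    by (simp add: x(1) y(1))
  then have "?h (triple_tensor X Y) = eval_mat z (kronecker M N)"
    using Gamma_path_apply tensor_Obj(1)[OF X Y] by metis
  then show "?h (triple_tensor X Y) = kronecker (?h X) (?h Y)"
    unfolding hXY using kronecker_eval[OF x(5) y(5)] by simp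
next
  show "Gamma_path q \<Sigma> z (1\<^sub>m 1, 1\<^sub>m 1, 1\<^sub>m 1) = 1\<^sub>m 1"
    unfolding Gamma_path_apply[OF unit_Obj] using z(1) by simp
qed (simp add: Gamma_path_def)

abbreviation "gens \<equiv> local_arrows_and_paths q \<Sigma>"

abbreviation "Gen \<equiv> generated_subgroupoid Cat fibre base_points gens"

lemma gens_Iso:
  assumes "x \<in> base_points" "y \<in> base_points" "h \<in> gens x y"
  shows "h \<in> Iso x y"
proof (cases x; cases y)
  fix a b assume "x = At_zero a" "y = At_zero b"
  then show ?thesis
    using assms(3) local_zero_Iso by auto
next
  fix a b assume "x = At_infinity a" "y = At_infinity b"
  then show ?thesis
    using assms(3) local_infinity_Iso by auto
next
  fix a b assume xy: "x = At_zero a" "y = At_infinity b"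
  then have "a \<noteq> 0"
    using assms(1) by (auto simp: base_points_def)
  then show ?thesis
    using assms(3) Gamma_path_Iso[of a] xy by (auto split: if_splits)
next
  fix a b assume "x = At_infinity a" "y = At_zero b"
  then show ?thesis
    using assms(3) by simp
qed

lemma generated_Iso:
  assumes "(x, y, h) \<in> generated Cat fibre base_points gens"
  shows "x \<in> base_points \<and> y \<in> base_points \<and> h \<in> Iso x y"
  using assms by induction (auto intro: gens_Iso id_iso_Iso comp_iso_Iso inv_iso_Iso)

lemma subgroupoid_Gen: "subgroupoid Cat fibre base_points Gen"
  unfolding subgroupoid_def generated_subgroupoid_def
  using generated_Iso by (auto intro: generated.intros)

section \<open>Stable families over the whole groupoid\<close>

text \<open>The local subobjects at \<open>0\<close> and at \<open>\<infinity>\<close> fit together along the paths: where \<open>M\<close> is regular, it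
  carries the image of \<open>S0\<close> onto that of \<open>Si\<close>, on which the projector \<open>Si Li\<close> is the identity. As only
  countably many points are excepted, \<open>Si Li M S0 = M S0\<close> holds between meromorphic matrices.\<close>

lemma connection_subobject:
  assumes X: "X \<in> Obj Cat"
    and sub: "\<And>x. x \<in> base_points \<Longrightarrow> W x \<subseteq> carrier_mat (rank X) 1 \<and> 0\<^sub>m (rank X) 1 \<in> W x"
    and add: "\<And>x v w. x \<in> base_points \<Longrightarrow> v \<in> W x \<Longrightarrow> w \<in> W x \<Longrightarrow> v + w \<in> W x"
    and scale: "\<And>x c w. x \<in> base_points \<Longrightarrow> w \<in> W x \<Longrightarrow> c \<cdot>\<^sub>m w \<in> W x"
    and stable: "\<And>x y h w. x \<in> base_points \<Longrightarrow> y \<in> base_points \<Longrightarrow> h \<in> gens x y \<Longrightarrow>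
      w \<in> carrier_mat (rank X) 1 \<Longrightarrow> w \<in> W x \<longleftrightarrow> h X * w \<in> W y"
  obtains Z f where "Z \<in> Obj Cat" "f \<in> triple_hom q Z X"
    "\<And>x C. x \<in> base_points \<Longrightarrow> C \<in> carrier_mat (rank Z) 1 \<Longrightarrow> fib_map (fibre x) f * C \<in> W x"
    "\<And>x w. x \<in> base_points \<Longrightarrow> w \<in> W x \<Longrightarrow>
      \<exists>C \<in> carrier_mat (rank Z) 1. w = fib_map (fibre x) f * C"
proof -
  define n where "n = rank X"
  obtain A0 M Ai where x: "X = (A0, M, Ai)" and A0: "A0 \<in> GL n" and Ai: "Ai \<in> GL n" and M: "M \<in> GL n"
    and eqM: "shift_mat q M * const_mat A0 = const_mat Ai * M"
    and rM: "\<And>z. z \<noteq> 0 \<Longrightarrow> z \<notin> q_orbits q \<Sigma> \<Longrightarrow> mat_regular z M"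
    and rM': "\<And>z. z \<noteq> 0 \<Longrightarrow> z \<notin> q_orbits q \<Sigma> \<Longrightarrow> mat_regular z (mat_inv M)"
    using ObjE[OF X] unfolding n_def by metis
  have b: "At_zero a \<in> base_points" "At_infinity a \<in> base_points" if "a \<noteq> 0" for a
    using that by (auto simp: base_points_def)
  have parts: "zero_part X = A0" "infinity_part X = Ai"
    by (simp_all add: x)
  have stable0: "w \<in> W (At_zero a) \<longleftrightarrow> h A0 * w \<in> W (At_zero b)"
    if "a \<noteq> 0" "b \<noteq> 0" "h \<in> Iso_tensor (local_cat mero_plane q) (omega a) (omega b)"
      "w \<in> carrier_mat n 1" for a b h w
  proof -
    have "restrict (h \<circ> zero_part) (Obj Cat) \<in> gens (At_zero a) (At_zero b)"
      using that(3) by (auto simp: G_zero_def)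
    from stable[OF b(1)[OF that(1)] b(1)[OF that(2)] this that(4)[unfolded n_def]] show ?thesis
      using X parts by simp
  qed
  have stable_inf: "w \<in> W (At_infinity a) \<longleftrightarrow> h Ai * w \<in> W (At_infinity b)"
    if "a \<noteq> 0" "b \<noteq> 0" "h \<in> Iso_tensor (local_cat mero_sphere_minus_0 q) (omega a) (omega b)"
      "w \<in> carrier_mat n 1" for a b h w
  proof -
    have "restrict (h \<circ> infinity_part) (Obj Cat) \<in> gens (At_infinity a) (At_infinity b)"
      using that(3) by (auto simp: G_infinity_def)
    from stable[OF b(2)[OF that(1)] b(2)[OF that(2)] this that(4)[unfolded n_def]] show ?thesis
      using X parts by simp
  qed
  have stableM: "w \<in> W (At_zero z) \<longleftrightarrow> eval_mat z M * w \<in> W (At_infinity z)"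
    if z: "z \<noteq> 0" "z \<notin> q_orbits q \<Sigma>" and w: "w \<in> carrier_mat n 1" for z w
  proof -
    have "Gamma_path q \<Sigma> z \<in> gens (At_zero z) (At_infinity z)"
      using z by simp
    from stable[OF b(1)[OF z(1)] b(2)[OF z(1)] this w[unfolded n_def]] show ?thesis
      using X Gamma_path_apply unfolding x by simp
  qed
  note sub = sub[folded n_def]
  obtain r B0 S0 L0 where B0: "B0 \<in> GL r" and S0: "S0 \<in> carrier_mat n r" and L0: "L0 \<in> carrier_mat r n"
    and hom0: "S0 \<in> local_hom mero_plane q B0 A0" and LS0: "L0 * S0 = 1\<^sub>m r"
    and rS0: "\<And>z. z \<noteq> 0 \<Longrightarrow> mat_regular z S0" and rL0: "\<And>z. z \<noteq> 0 \<Longrightarrow> mat_regular z L0"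
    and W0: "\<And>z w. z \<noteq> 0 \<Longrightarrow> w \<in> carrier_mat n 1 \<Longrightarrow>
      w \<in> W (At_zero z) \<longleftrightarrow> eval_mat z S0 * (eval_mat z L0 * w) = w"
  proof (rule zero.local_subobject[where W = "\<lambda>a. W (At_zero a)", OF q A0])
    show "W (At_zero 1) \<subseteq> carrier_mat n 1" "0\<^sub>m n 1 \<in> W (At_zero 1)"
      using sub[OF b(1)[of 1]] by simp_all
    show "v + w \<in> W (At_zero 1)" if "v \<in> W (At_zero 1)" "w \<in> W (At_zero 1)" for v w
      using add[OF b(1)[of 1]] that by simp
    show "c \<cdot>\<^sub>m w \<in> W (At_zero 1)" if "w \<in> W (At_zero 1)" for c w
      using scale[OF b(1)[of 1]] that by simp
  qed (use stable0 in blast)+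
  obtain s Bi Si Li where Bi: "Bi \<in> GL s" and Si: "Si \<in> carrier_mat n s" and Li: "Li \<in> carrier_mat s n"
    and homi: "Si \<in> local_hom mero_sphere_minus_0 q Bi Ai" and LSi: "Li * Si = 1\<^sub>m s"
    and rSi: "\<And>z. z \<noteq> 0 \<Longrightarrow> mat_regular z Si" and rLi: "\<And>z. z \<noteq> 0 \<Longrightarrow> mat_regular z Li"
    and Wi: "\<And>z w. z \<noteq> 0 \<Longrightarrow> w \<in> carrier_mat n 1 \<Longrightarrow>
      w \<in> W (At_infinity z) \<longleftrightarrow> eval_mat z Si * (eval_mat z Li * w) = w"
  proof (rule infinity.local_subobject[where W = "\<lambda>a. W (At_infinity a)", OF q Ai])
    show "W (At_infinity 1) \<subseteq> carrier_mat n 1" "0\<^sub>m n 1 \<in> W (At_infinity 1)"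
      using sub[OF b(2)[of 1]] by simp_all
    show "v + w \<in> W (At_infinity 1)" if "v \<in> W (At_infinity 1)" "w \<in> W (At_infinity 1)" for v w
      using add[OF b(2)[of 1]] that by simp
    show "c \<cdot>\<^sub>m w \<in> W (At_infinity 1)" if "w \<in> W (At_infinity 1)" for c w
      using scale[OF b(2)[of 1]] that by simp
  qed (use stable_inf in blast)+
  note Mc = GL_carrier[OF M] mat_inv_GL[OF M]
  have S0W: "eval_mat z S0 * C \<in> W (At_zero z)" if z: "z \<noteq> 0" and C: "C \<in> carrier_mat r 1" for z C
  proof -
    have e: "eval_mat z S0 \<in> carrier_mat n r" "eval_mat z L0 \<in> carrier_mat r n"
      using S0 L0 by auto
    have one: "eval_mat z L0 * eval_mat z S0 = 1\<^sub>m r"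
      using mat_mult_eval(2)[OF z L0 rL0[OF z] S0 rS0[OF z]] LS0 z by simp
    show ?thesis
      unfolding W0[OF z mult_carrier_mat[OF e(1) C]] mat_cancel_left[OF one e(2,1) C] ..
  qed
  have SiW: "eval_mat z Si * C \<in> W (At_infinity z)" if z: "z \<noteq> 0" and C: "C \<in> carrier_mat s 1" for z C
  proof -
    have e: "eval_mat z Si \<in> carrier_mat n s" "eval_mat z Li \<in> carrier_mat s n"
      using Si Li by auto
    have one: "eval_mat z Li * eval_mat z Si = 1\<^sub>m s"
      using mat_mult_eval(2)[OF z Li rLi[OF z] Si rSi[OF z]] LSi z by simp
    show ?thesis
      unfolding Wi[OF z mult_carrier_mat[OF e(1) C]] mat_cancel_left[OF one e(2,1) C] ..
  qed
  define N where "N = Li * (M * S0)"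
  define N' where "N' = L0 * (mat_inv M * Si)"
  have MS0: "M * S0 \<in> carrier_mat n r" and MSi: "mat_inv M * Si \<in> carrier_mat n s"
    using mult_carrier_mat[OF Mc(1) S0] mult_carrier_mat[OF Mc(2) Si] .
  have N: "N \<in> carrier_mat s r" and N': "N' \<in> carrier_mat r s"
    unfolding N_def N'_def using mult_carrier_mat[OF Li MS0] mult_carrier_mat[OF L0 MSi] .
  have evN: "mat_regular z N \<and> mat_regular z N' \<and>
      mat_regular z (M * S0) \<and> eval_mat z (M * S0) = eval_mat z M * eval_mat z S0 \<and>
      mat_regular z (mat_inv M * Si) \<and> eval_mat z (mat_inv M * Si) = eval_mat z (mat_inv M) * eval_mat z Si"
    if z: "z \<noteq> 0" "z \<notin> q_orbits q \<Sigma>" for z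
  proof -
    note m1 = mat_mult_eval[OF z(1) Mc(1) rM[OF z] S0 rS0[OF z(1)]]
    note m2 = mat_mult_eval[OF z(1) Mc(2) rM'[OF z] Si rSi[OF z(1)]]
    show ?thesis
      unfolding N_def N'_def
      using m1 m2 mat_mult_eval(1)[OF z(1) Li rLi[OF z(1)] MS0 m1(1)]
        mat_mult_eval(1)[OF z(1) L0 rL0[OF z(1)] MSi m2(1)] by blast
  qed
  \<comment> \<open>an identity between meromorphic matrices that is known on columns at almost all points\<close>
  have glue: "S * (L * Y) = Y"
    if car: "S \<in> carrier_mat n k" "L \<in> carrier_mat k n" "Y \<in> carrier_mat n l"
      and reg: "\<And>z. z \<noteq> 0 \<Longrightarrow> z \<notin> q_orbits q \<Sigma> \<Longrightarrow>
        mat_regular z S \<and> mat_regular z L \<and> mat_regular z Y"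
      and fixed: "\<And>z C. z \<noteq> 0 \<Longrightarrow> z \<notin> q_orbits q \<Sigma> \<Longrightarrow> C \<in> carrier_mat l 1 \<Longrightarrow>
        eval_mat z S * (eval_mat z L * (eval_mat z Y * C)) = eval_mat z Y * C" for S L Y k l
  proof (rule mat_eq_evalI[OF countable_orbits])
    fix z :: complex assume z: "z \<noteq> 0" "z \<notin> q_orbits q \<Sigma>"
    have r: "mat_regular z S" "mat_regular z L" "mat_regular z Y"
      using reg[OF z] by blast+
    have e: "eval_mat z S \<in> carrier_mat n k" "eval_mat z L \<in> carrier_mat k n"
      "eval_mat z Y \<in> carrier_mat n l"
      using car by auto
    have "eval_mat z S * (eval_mat z L * eval_mat z Y) = eval_mat z Y"
    proof (rule mat_eq_columnsI[OF mult_carrier_mat[OF e(1) mult_carrier_mat[OF e(2,3)]] e(3)])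
      fix C :: "complex mat" assume C: "C \<in> carrier_mat l 1"
      show "eval_mat z S * (eval_mat z L * eval_mat z Y) * C = eval_mat z Y * C"
        using fixed[OF z C] C car by (simp add: mat_assoc_dim del: assoc_mult_mat)
    qed
    then show "mat_regular z (S * (L * Y)) \<and> mat_regular z Y \<and> eval_mat z (S * (L * Y)) = eval_mat z Y"
      using mat_mult_eval[OF z(1) car(2) r(2) car(3) r(3)]
        mat_mult_eval[OF z(1) car(1) r(1) mult_carrier_mat[OF car(2,3)]] r(3) by simp
  qed (use car in auto)
  have SN: "Si * N = M * S0"
    unfolding N_def
  proof (rule glue[OF Si Li MS0])
    fix z and C :: "complex mat" assume z: "z \<noteq> 0" "z \<notin> q_orbits q \<Sigma>" and C: "C \<in> carrier_mat r 1"
    have e: "eval_mat z M \<in> carrier_mat n n" "eval_mat z S0 \<in> carrier_mat n r"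
      using Mc S0 by auto
    note SC = mult_carrier_mat[OF e(2) C]
    have "eval_mat z M * (eval_mat z S0 * C) \<in> W (At_infinity z)"
      using stableM[OF z SC] S0W[OF z(1) C] by blast
    then show "eval_mat z Si * (eval_mat z Li * (eval_mat z (M * S0) * C)) = eval_mat z (M * S0) * C"
      unfolding Wi[OF z(1) mult_carrier_mat[OF e(1) SC]]
      using evN[OF z] assoc_mult_mat[OF e C] by simp
  qed (use evN rSi rLi in blast)
  have SN': "S0 * N' = mat_inv M * Si"
    unfolding N'_def
  proof (rule glue[OF S0 L0 MSi])
    fix z and C :: "complex mat" assume z: "z \<noteq> 0" "z \<notin> q_orbits q \<Sigma>" and C: "C \<in> carrier_mat s 1"
    have e: "eval_mat z (mat_inv M) \<in> carrier_mat n n" "eval_mat z Si \<in> carrier_mat n s"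
      "eval_mat z M \<in> carrier_mat n n"
      using Mc Si by auto
    have MM': "eval_mat z M * eval_mat z (mat_inv M) = 1\<^sub>m n"
      using mat_mult_eval(2)[OF z(1) Mc(1) rM[OF z] Mc(2) rM'[OF z]] Mc(3) z(1) by simp
    note SC = mult_carrier_mat[OF e(2) C]
    note w = mult_carrier_mat[OF e(1) SC]
    have "eval_mat z (mat_inv M) * (eval_mat z Si * C) \<in> W (At_zero z)"
      unfolding stableM[OF z w] mat_cancel_left[OF MM' e(3,1) SC] by (rule SiW[OF z(1) C])
    then show "eval_mat z S0 * (eval_mat z L0 * (eval_mat z (mat_inv M * Si) * C)) =
        eval_mat z (mat_inv M * Si) * C"
      unfolding W0[OF z(1) w] using evN[OF z] assoc_mult_mat[OF e(1,2) C] by simp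
  qed (use evN rS0 rL0 in blast)
  have NN': "N * N' = 1\<^sub>m s"
  proof -
    have "N * N' = Li * (M * (S0 * N'))"
      unfolding N_def using Li Mc S0 N' by (simp add: mat_assoc_dim del: assoc_mult_mat)
    also have "\<dots> = Li * Si"
      unfolding SN' mat_cancel_left[OF Mc(3) Mc(1,2) Si] ..
    finally show ?thesis
      using LSi by simp
  qed
  have N'N: "N' * N = 1\<^sub>m r"
  proof -
    have "N' * N = L0 * (mat_inv M * (Si * N))"
      unfolding N'_def using L0 Mc Si N by (simp add: mat_assoc_dim del: assoc_mult_mat)
    also have "\<dots> = L0 * S0"
      unfolding SN mat_cancel_left[OF Mc(4) Mc(2,1) S0] ..
    finally show ?thesis
      using LS0 by simp
  qed
  have rs: "s = r"
    using left_inverse_dim[OF N N' NN'] left_inverse_dim[OF N' N N'N] by simp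
  note NGL = GL_memI[OF N[unfolded rs] N' [unfolded rs] NN'[unfolded rs] N'N]
  have eqN: "shift_mat q N * const_mat B0 = const_mat Bi * N"
  proof -
    have c: "const_mat B0 \<in> carrier_mat r r" "const_mat Bi \<in> carrier_mat s s"
      "const_mat A0 \<in> carrier_mat n n" "const_mat Ai \<in> carrier_mat n n"
      "shift_mat q N \<in> carrier_mat s r" "shift_mat q Si \<in> carrier_mat n s" "shift_mat q Li \<in> carrier_mat s n"
      "shift_mat q M \<in> carrier_mat n n" "shift_mat q S0 \<in> carrier_mat n r"
      using GL_carrier[OF B0] GL_carrier[OF Bi] GL_carrier[OF A0] GL_carrier[OF Ai] N Si Li Mc S0 by auto
    have e0: "shift_mat q S0 * const_mat B0 = const_mat A0 * S0"
      and ei: "shift_mat q Si * const_mat Bi = const_mat Ai * Si"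
      using hom0 homi by (auto simp: local_hom_def)
    have one: "shift_mat q Li * shift_mat q Si = 1\<^sub>m s"
      using shift_mat_mult[OF Li Si, of q] LSi by simp
    have "shift_mat q Si * (shift_mat q N * const_mat B0) = shift_mat q (Si * N) * const_mat B0"
      unfolding shift_mat_mult[OF Si N] by (rule assoc_mult_mat[OF c(6,5,1), symmetric])
    also have "\<dots> = shift_mat q M * (shift_mat q S0 * const_mat B0)"
      unfolding SN shift_mat_mult[OF Mc(1) S0] by (rule assoc_mult_mat[OF c(8,9,1)])
    also have "\<dots> = shift_mat q M * const_mat A0 * S0"
      unfolding e0 by (rule assoc_mult_mat[OF c(8,3) S0, symmetric])
    also have "\<dots> = const_mat Ai * (Si * N)"
      unfolding eqM SN by (rule assoc_mult_mat[OF c(4) Mc(1) S0])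
    also have "\<dots> = shift_mat q Si * const_mat Bi * N"
      unfolding ei by (rule assoc_mult_mat[OF c(4) Si N, symmetric])
    also have "\<dots> = shift_mat q Si * (const_mat Bi * N)"
      by (rule assoc_mult_mat[OF c(6,2) N])
    finally have "shift_mat q Li * (shift_mat q Si * (shift_mat q N * const_mat B0)) =
        shift_mat q Li * (shift_mat q Si * (const_mat Bi * N))"
      by simp
    then show ?thesis
      unfolding mat_cancel_left[OF one c(7,6) mult_carrier_mat[OF c(5,1)]]
        mat_cancel_left[OF one c(7,6) mult_carrier_mat[OF c(2) N]] .
  qed
  let ?Z = "(B0, N, Bi)"
  have Z: "?Z \<in> Obj Cat" and rZ: "rank ?Z = r"
    using ObjI[OF B0 Bi[unfolded rs] NGL(1) eqN] evN unfolding NGL(2) by blast+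
  have hom: "(S0, Si) \<in> triple_hom q ?Z X"
    unfolding x using hom0 homi SN by simp
  show thesis
  proof (rule that[OF Z hom])
    fix y and C :: "complex mat" assume y: "y \<in> base_points" and C: "C \<in> carrier_mat (rank ?Z) 1"
    show "fib_map (fibre y) (S0, Si) * C \<in> W y"
      using y C S0W SiW unfolding rZ rs by (cases y) (auto simp: base_points_def)
  next
    fix y w assume y: "y \<in> base_points" and w: "w \<in> W y"
    then have wc: "w \<in> carrier_mat n 1"
      using sub by blast
    show "\<exists>C \<in> carrier_mat (rank ?Z) 1. w = fib_map (fibre y) (S0, Si) * C"
    proof (cases y)
      case (At_zero a)
      then have "a \<noteq> 0"
        using y by (auto simp: base_points_def)
      then show ?thesis
        using W0[of a w] w wc At_zero L0 unfolding rZ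
        by (intro bexI[of _ "eval_mat a L0 * w"]) auto
    next
      case (At_infinity a)
      then have "a \<noteq> 0"
        using y by (auto simp: base_points_def)
      then show ?thesis
        using Wi[of a w] w wc At_infinity Li unfolding rZ rs
        by (intro bexI[of _ "eval_mat a Li * w"]) auto
    qed
  qed
qed

text \<open>The subobject generated by the orbit of \<open>V\<close> absorbs \<open>h(X) V\<close> for every tensor isomorphism \<open>h\<close>.\<close>

lemma coefficient_vanishes:
  assumes x: "x \<in> base_points" and y: "y \<in> base_points" and X: "X \<in> Obj Cat"
    and U: "U \<in> carrier_mat 1 (rank X)" and V: "V \<in> carrier_mat (rank X) 1"
    and zero: "\<And>h. h \<in> Gen x y \<Longrightarrow> U * (h X * V) = 0\<^sub>m 1 1"
    and h: "h \<in> Iso x y"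
  shows "U * (h X * V) = 0\<^sub>m 1 1"
proof -
  define n where "n = rank X"
  note U = U[folded n_def] and V = V[folded n_def]
  have Gen_Iso: "h \<in> Iso u v" if "h \<in> Gen u v" for h u v
    using that generated_Iso by (auto simp: generated_subgroupoid_def)
  have hX: "h X \<in> carrier_mat n n" if "h \<in> Iso u v" for h u v
    unfolding n_def by (rule GL_carrier[OF IsoD(2)[OF that X]])
  \<comment> \<open>the span of the orbit of \<open>V\<close>, written as a double annihilator\<close>
  define W where "W z = {w \<in> carrier_mat n 1. \<forall>U \<in> carrier_mat 1 n.
    (\<forall>h \<in> Gen x z. U * (h X * V) = 0\<^sub>m 1 1) \<longrightarrow> U * w = 0\<^sub>m 1 1}" for z
  have orbit: "h X * w \<in> W v" if g: "h \<in> Gen u v" and w: "w \<in> W u" for h u v w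
  proof -
    note H = hX[OF Gen_Iso[OF g]]
    have wc: "w \<in> carrier_mat n 1"
      using w by (simp add: W_def)
    have "U * (h X * w) = 0\<^sub>m 1 1"
      if U: "U \<in> carrier_mat 1 n" and U0: "\<forall>k \<in> Gen x v. U * (k X * V) = 0\<^sub>m 1 1" for U
    proof -
      have UH: "U * h X \<in> carrier_mat 1 n"
        using U H by (rule mult_carrier_mat)
      have "U * h X * (k X * V) = 0\<^sub>m 1 1" if k: "k \<in> Gen x u" for k
      proof -
        note K = hX[OF Gen_Iso[OF k]]
        have "comp_iso Cat h k \<in> Gen x v"
          using k g by (auto simp: generated_subgroupoid_def intro: generated.comp)
        then have "U * (h X * k X * V) = 0\<^sub>m 1 1"
          using U0 X by (auto simp: comp_iso_apply)
        then show ?thesis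
          using assoc_mult_mat[OF H K V] assoc_mult_mat[OF U H mult_carrier_mat[OF K V]] by simp
      qed
      then have "U * h X * w = 0\<^sub>m 1 1"
        using w UH by (auto simp: W_def)
      then show ?thesis
        using assoc_mult_mat[OF U H wc] by simp
    qed
    then show ?thesis
      using mult_carrier_mat[OF H wc] by (auto simp: W_def)
  qed
  have zero_mat: "0\<^sub>m 1 1 + 0\<^sub>m 1 1 = (0\<^sub>m 1 1 :: complex mat)" "c \<cdot>\<^sub>m 0\<^sub>m 1 1 = (0\<^sub>m 1 1 :: complex mat)" for c
    by (auto intro!: eq_matI)
  obtain Z f where Z: "Z \<in> Obj Cat" "f \<in> triple_hom q Z X"
    and fW: "\<And>x C. x \<in> base_points \<Longrightarrow> C \<in> carrier_mat (rank Z) 1 \<Longrightarrow> fib_map (fibre x) f * C \<in> W x"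
    and Wf: "\<And>x w. x \<in> base_points \<Longrightarrow> w \<in> W x \<Longrightarrow>
      \<exists>C \<in> carrier_mat (rank Z) 1. w = fib_map (fibre x) f * C"
  proof (rule connection_subobject[OF X, of W, folded n_def])
    show "W u \<subseteq> carrier_mat n 1 \<and> 0\<^sub>m n 1 \<in> W u" for u
      by (auto simp: W_def)
    show "v + w \<in> W u" if "v \<in> W u" "w \<in> W u" for u v w
      using that zero_mat(1) by (auto simp: W_def mult_add_distrib_mat[of _ 1 n _ 1])
    show "c \<cdot>\<^sub>m w \<in> W u" if "w \<in> W u" for u c w
      using that zero_mat(2) by (auto simp: W_def mult_smult_distrib[of _ 1 n _ 1])
    show "w \<in> W u \<longleftrightarrow> h X * w \<in> W v"
      if "u \<in> base_points" "v \<in> base_points" "h \<in> gens u v" "w \<in> carrier_mat n 1" for u v h w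
    proof
      have g: "h \<in> Gen u v" "inv_iso Cat h \<in> Gen v u"
        using that by (auto simp: generated_subgroupoid_def intro: generated.intros)
      show "h X * w \<in> W v" if "w \<in> W u"
        by (rule orbit[OF g(1) that])
      assume "h X * w \<in> W v"
      from orbit[OF g(2) this] have "mat_inv (h X) * (h X * w) \<in> W u"
        using X by (simp add: inv_iso_apply)
      moreover have GL: "h X \<in> GL n"
        unfolding n_def by (rule IsoD(2)[OF Gen_Iso[OF g(1)] X])
      have "mat_inv (h X) * (h X * w) = w"
        by (rule mat_cancel_left[OF mat_inv_GL(3)[OF GL] mat_inv_GL(1)[OF GL] GL_carrier[OF GL] that(4)])
      ultimately show "w \<in> W u"
        by simp
    qed
  qed blast
  have "V \<in> W x"
  proof -
    have "id_iso Cat (fibre x) \<in> Gen x x"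
      using x by (auto simp: generated_subgroupoid_def intro: generated.ident)
    moreover have "id_iso Cat (fibre x) X = 1\<^sub>m n"
      using X by (simp add: id_iso_def fib_dim_fibre n_def)
    ultimately show ?thesis
      unfolding W_def using V left_mult_one_mat[OF V] by (auto dest: bspec)
  qed
  then obtain C where C: "C \<in> carrier_mat (rank Z) 1" "V = fib_map (fibre x) f * C"
    using Wf[OF x] by blast
  have F: "fib_map (fibre u) f \<in> carrier_mat n (rank Z)" for u
    unfolding n_def by (rule fib_map_carrier[OF Z(1) X Z(2)])
  have hZ: "h Z \<in> carrier_mat (rank Z) (rank Z)"
    by (rule GL_carrier[OF IsoD(2)[OF h Z(1)]])
  have "h X * V = h X * fib_map (fibre x) f * C"
    unfolding C(2) by (rule assoc_mult_mat[OF hX[OF h] F C(1), symmetric])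
  also have "\<dots> = fib_map (fibre y) f * (h Z * C)"
    unfolding IsoD(3)[OF h Z(1) X Z(2), symmetric] by (rule assoc_mult_mat[OF F hZ C(1)])
  also have "\<dots> \<in> W y"
    by (rule fW[OF y mult_carrier_mat[OF hZ C(1)]])
  finally show ?thesis
    using U zero by (auto simp: W_def)
qed

lemma Gen_dense:
  assumes x: "x \<in> base_points" and y: "y \<in> base_points"
  shows "zariski_topology Cat (fibre x) (fibre y) closure_of Gen x y = Iso x y"
proof -
  let ?T = "zariski_topology Cat (fibre x) (fibre y)"
  have sub: "Gen x y \<subseteq> Iso x y"
    using generated_Iso by (auto simp: generated_subgroupoid_def)
  have "closedin ?T (?T closure_of Gen x y)"
    by (rule closedin_closure_of)
  then obtain P where P: "P \<subseteq> poly_functions Cat (fibre x) (fibre y)"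
    "?T closure_of Gen x y = zero_locus Cat (fibre x) (fibre y) P"
    unfolding closedin_zariski by blast
  have GP: "Gen x y \<subseteq> zero_locus Cat (fibre x) (fibre y) P"
    unfolding P(2)[symmetric] by (rule closure_of_subset) (use sub in simp)
  have "p h = 0" if p: "p \<in> P" and h: "h \<in> Iso x y" for p h
  proof -
    obtain X U V where X: "X \<in> Obj Cat" and U: "U \<in> carrier_mat 1 (rank X)"
      and V: "V \<in> carrier_mat (rank X) 1"
      and coeff: "\<And>h. h \<in> Iso x y \<Longrightarrow> p h = (U * (h X * V)) $$ (0, 0)"
      using poly_function_coefficient[OF x y, of p] p P(1) by blast
    have car: "U * (h X * V) \<in> carrier_mat 1 1" if "h \<in> Iso x y" for h
      using mult_carrier_mat[OF U mult_carrier_mat[OF GL_carrier[OF IsoD(2)[OF that X]] V]] .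
    have "U * (h X * V) = 0\<^sub>m 1 1" if g: "h \<in> Gen x y" for h
    proof (rule scalar_mat_eqI)
      have "p h = 0"
        using g GP p by (auto simp: zero_locus_def)
      then show "(U * (h X * V)) $$ (0, 0) = 0\<^sub>m 1 1 $$ (0, 0)"
        using coeff[of h] sub g by auto
    qed (use car sub g in auto)
    then have "U * (h X * V) = 0\<^sub>m 1 1"
      by (rule coefficient_vanishes[OF x y X U V _ h])
    then show ?thesis
      unfolding coeff[OF h] by simp
  qed
  then show ?thesis
    unfolding P(2) by (auto simp: zero_locus_def)
qed

end

theorem mainTheorem6:
  fixes q :: complex and \<Sigma> :: "complex set"
  assumes "norm q > 1" and "finite \<Sigma>" and "\<Sigma> \<subseteq> - {0}"
  shows "zariski_dense_subgroupoid (C_Sigma q \<Sigma>) fibre base_points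
           (generated_subgroupoid (C_Sigma q \<Sigma>) fibre base_points (local_arrows_and_paths q \<Sigma>))"
proof -
  interpret connection_category q \<Sigma>
    by unfold_locales (fact assms)+
  show ?thesis
    unfolding zariski_dense_subgroupoid_def using subgroupoid_Gen Gen_dense by blast
qed

end
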